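(* Let $X$ be a second-order stochastic process on $[0,1]$ with continuous trajectories, continuous mean function $m$ and continuous positive definite covariance function $K$, with $\mathbb{E}\|X\|_2^2<\infty$, and let $\lambda_1,\lambda_2,\dots$ be the eigenvalues of its covariance operator $\mathcal{K}$. Let $X_1,\dots,X_n$ be a sample of independent realizations of $X$ and fix $\alpha>0$. Then $$\sqrt n\,\widehat M_{\alpha,n}(\bar X,m)\ \xrightarrow{d}\ \Big(\sum_{j=1}^\infty\frac{\lambda_j^2}{(\lambda_j+\alpha)^2}Y_j\Big)^{1/2},$$ where $Y_1,Y_2,\dots$ are independent $\chi^2_1$ random variables.
   Context: $\|\cdot\|_2$ is the $L^2[0,1]$ norm; $\mathcal{K}f=\int_0^1K(\cdot,t)f(t)dt$. $\bar X=n^{-1}\sum_iX_i$, $\widehat K(s,t)=n^{-1}\sum_i(X_i(s)-\bar X(s))(X_i(t)-\bar X(t))$, $\widehat{\mathcal{K}}f=\int_0^1\widehat K(\cdot,t)f(t)dt$, $\mathbb{I}$ the identity. For a positive semidefinite kernel $R$ on $[0,1]^2$, $\mathcal{H}(R)$ is its RKHS: the completion of finite combinations $\sum_ia_iR(t_i,\cdot)$ under $\langle\sum_ia_iR(t_i,\cdot),\sum_jb_jR(s_j,\cdot)\rangle_R=\sum_{i,j}a_ib_jR(t_i,s_j)$, with norm $\|\cdot\|_R$. Estimator: for $f,g\in L^2[0,1]$, $\widehat M_{\alpha,n}(f,g)=\|\widehat f_\alpha-\widehat g_\alpha\|_{\widehat K}$ with $\widehat f_\alpha=(\widehat{\mathcal{K}}+\alpha\mathbb{I})^{-1}\widehat{\mathcal{K}}f$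 and likewise for $g$; here $f=\bar X$, $g=m$. *)

theory Defs
  imports "HOL-Probability.Probability"
begin

definition int_op :: "(real \<Rightarrow> real \<Rightarrow> real) \<Rightarrow> (real \<Rightarrow> real) \<Rightarrow> real \<Rightarrow> real" where
  "int_op R f s = (LBINT t=0..1. R s t * f t)"

definition sq_int :: "(real \<Rightarrow> real) \<Rightarrow> bool" where
  "sq_int f \<longleftrightarrow> f \<in> borel_measurable lborel \<and> set_integrable lborel {0..1} (\<lambda>t. (f t)\<^sup>2)"

definition xbar :: "nat \<Rightarrow> (nat \<Rightarrow> real \<Rightarrow> real) \<Rightarrow> real \<Rightarrow> real" where
  "xbar n x s = (1 / real n) * (\<Sum>i<n. x i s)"

definition emp_cov :: "nat \<Rightarrow> (nat \<Rightarrow> real \<Rightarrow> real) \<Rightarrow> real \<Rightarrow> real \<Rightarrow> real" where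
  "emp_cov n x s t = (1 / real n) * (\<Sum>i<n. (x i s - xbar n x s) * (x i t - xbar n x t))"

definition reg_sol :: "(real \<Rightarrow> real \<Rightarrow> real) \<Rightarrow> real \<Rightarrow> (real \<Rightarrow> real) \<Rightarrow> real \<Rightarrow> real" where
  "reg_sol R \<alpha> f = (THE u. sq_int u \<and> (\<forall>s\<in>{0..1}. int_op R u s + \<alpha> * u s = int_op R f s)
                         \<and> (\<forall>s. s \<notin> {0..1} \<longrightarrow> u s = 0))"

text \<open>RKHS of a kernel R on [0,1]^2. Elements of the pre-Hilbert space are finite
  combinations sum a_i R(t_i, .), represented by lists of pairs (a_i, t_i).\<close>
definition pre_ip :: "(real \<Rightarrow> real \<Rightarrow> real) \<Rightarrow> (real \<times> real) list \<Rightarrow> (real \<times> real) list \<Rightarrow> real" where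
  "pre_ip R as bs = sum_list [fst p * fst q * R (snd p) (snd q). p \<leftarrow> as, q \<leftarrow> bs]"

definition pre_eval :: "(real \<Rightarrow> real \<Rightarrow> real) \<Rightarrow> (real \<times> real) list \<Rightarrow> real \<Rightarrow> real" where
  "pre_eval R as x = sum_list [fst p * R (snd p) x. p \<leftarrow> as]"

definition pre_diff :: "(real \<times> real) list \<Rightarrow> (real \<times> real) list \<Rightarrow> (real \<times> real) list" where
  "pre_diff as bs = as @ map (\<lambda>(a, t). (- a, t)) bs"

text \<open>Norm in the completion: h is the pointwise limit on [0,1] of a Cauchy sequence of
  finite combinations, and its norm is the limit of their norms.\<close>
definition rkhs_norm :: "(real \<Rightarrow> real \<Rightarrow> real) \<Rightarrow> (real \<Rightarrow> real) \<Rightarrow> real" where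
  "rkhs_norm R h = (THE c. \<exists>hs :: nat \<Rightarrow> (real \<times> real) list.
      (\<forall>k. snd ` set (hs k) \<subseteq> {0..1}) \<and>
      (\<forall>\<epsilon>>0. \<exists>N. \<forall>j\<ge>N. \<forall>k\<ge>N. pre_ip R (pre_diff (hs j) (hs k)) (pre_diff (hs j) (hs k)) < \<epsilon>) \<and>
      (\<forall>x\<in>{0..1}. (\<lambda>k. pre_eval R (hs k) x) \<longlonglongrightarrow> h x) \<and>
      (\<lambda>k. sqrt (pre_ip R (hs k) (hs k))) \<longlonglongrightarrow> c)"

definition M_hat :: "real \<Rightarrow> nat \<Rightarrow> (nat \<Rightarrow> real \<Rightarrow> real) \<Rightarrow> (real \<Rightarrow> real) \<Rightarrow> (real \<Rightarrow> real) \<Rightarrow> real" where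
  "M_hat \<alpha> n x f g = rkhs_norm (emp_cov n x)
      (\<lambda>s. reg_sol (emp_cov n x) \<alpha> f s - reg_sol (emp_cov n x) \<alpha> g s)"

text \<open>lam is the sequence of eigenvalues (with multiplicity) of the integral operator with
  kernel K: there is an orthonormal family of eigenfunctions, and K annihilates its
  orthogonal complement in L2[0,1] (possible zero entries contribute nothing).\<close>
definition cov_eigenvalues :: "(real \<Rightarrow> real \<Rightarrow> real) \<Rightarrow> (nat \<Rightarrow> real) \<Rightarrow> bool" where
  "cov_eigenvalues K lam \<longleftrightarrow> (\<exists>\<phi> :: nat \<Rightarrow> real \<Rightarrow> real.
     (\<forall>j. sq_int (\<phi> j)) \<and>
     (\<forall>i j. (LBINT t=0..1. \<phi> i t * \<phi> j t) = (if i = j then 1 else 0)) \<and>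
     (\<forall>j. AE s in lborel. s \<in> {0..1} \<longrightarrow> int_op K (\<phi> j) s = lam j * \<phi> j s) \<and>
     (\<forall>f. sq_int f \<and> (\<forall>j. (LBINT t=0..1. \<phi> j t * f t) = 0) \<longrightarrow>
          (AE s in lborel. s \<in> {0..1} \<longrightarrow> int_op K f s = 0)))"

definition chi2_1_density :: "real \<Rightarrow> real" where
  "chi2_1_density x = (if x > 0 then exp (- x / 2) / sqrt (2 * pi * x) else 0)"

end

theory Submission
  imports Defs
begin

text \<open>
  Write Z i = X i - m, d for the mean of the Z i, c i = Z i - d, and T for the empirical covariance
  operator, which has finite rank. If w solves T w + \<alpha> w = d, then the difference of the two
  regularised solutions is T w, and its squared RKHS norm is the inner product of T w and w.

  Keep J eigenfunctions of K and let w' be the corresponding truncated solution for K in place of T.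
  Testing the equation for w - w' against w - w' bounds the error by finitely many entries of T - K,
  controlled by the weak law of large numbers, and by the mass of d and of the Z i outside the
  J-dimensional eigenspace, which tends to 0 with J because by Mercer's expansion the eigenvalues
  sum to the trace of K. Hence n times the squared statistic behaves like the sum over j < J of
  lam j / (lam j + \<alpha>)^2 times the squared j-th coordinate of sqrt n d.

  The Laplace transform of this quadratic form is a Gaussian average of characteristic functions of
  linear combinations, so the one-dimensional central limit theorem gives its limit. Convergence
  of Laplace transforms of nonnegative variables implies convergence in distribution.
\<close>

section \<open>Regularised inversion in an inner product space\<close>

text \<open>The terms averaged in the empirical covariance are products of two square integrable
  variables, so only first moments are at hand: neither a variance nor a rate for its entries can be
  used. Hence every error bound is made linear in quantities whose expectation is known or tends to
  0. AM-GM with a weight \<epsilon> separates products of norms, and a cutoff R on the squared norm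
  of sqrt n d removes the one product that survives. The parameters are then fixed in the order R,
  \<epsilon>, J, n.

  Convergence of T in operator norm is avoided too: testing an equation with the error and dropping
  a nonnegative term takes the place of a perturbation argument for inverses.

  The estimator is given by two nested definite descriptions, the regularised solution and the RKHS
  norm. An explicit finite rank solution replaces both and is also the source of
  measurability.\<close>

context
  fixes \<phi> :: "nat \<Rightarrow> 'h::real_inner" and J :: nat
  assumes orthonormal: "\<And>j k. j < J \<Longrightarrow> k < J \<Longrightarrow> \<phi> j \<bullet> \<phi> k = (if j = k then 1 else 0)"
begin

definition span_proj :: "'h \<Rightarrow> 'h" where
  "span_proj f = (\<Sum>j<J. (f \<bullet> \<phi> j) *\<^sub>R \<phi> j)"

lemma proj_inner: "j < J \<Longrightarrow> span_proj f \<bullet> \<phi> j = f \<bullet> \<phi> j"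
  by (simp add: span_proj_def inner_sum_left orthonormal if_distrib cong: if_cong)

lemma proj_inner_left: "span_proj f \<bullet> g = (\<Sum>j<J. (f \<bullet> \<phi> j) * (g \<bullet> \<phi> j))"
  by (simp add: span_proj_def inner_sum_left inner_commute[of g])

lemma proj_self_adjoint: "span_proj f \<bullet> g = f \<bullet> span_proj g"
  by (simp add: proj_inner_left inner_commute[of f] mult.commute)

lemma norm_diff_proj: "(norm (f - span_proj f))\<^sup>2 = (norm f)\<^sup>2 - (\<Sum>j<J. (f \<bullet> \<phi> j)\<^sup>2)"
proof -
  have a: "span_proj f \<bullet> span_proj f = (\<Sum>j<J. (f \<bullet> \<phi> j)\<^sup>2)"
    by (simp add: proj_inner_left[of _ "span_proj f"] proj_inner power2_eq_square)
  have b: "f \<bullet> span_proj f = (\<Sum>j<J. (f \<bullet> \<phi> j)\<^sup>2)"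
    by (simp add: inner_commute[of f] proj_inner_left power2_eq_square)
  show ?thesis
    by (simp add: power2_norm_eq_inner inner_diff_left inner_diff_right a b inner_commute[of "span_proj f" f])
qed

lemma bessel: "(\<Sum>j<J. (f \<bullet> \<phi> j)\<^sup>2) \<le> (norm f)\<^sup>2"
  using norm_diff_proj[of f] zero_le_power2[of "norm (f - span_proj f)"] by linarith

lemma abs_inner_le: "j < J \<Longrightarrow> \<bar>f \<bullet> \<phi> j\<bar> \<le> norm f"
  using Cauchy_Schwarz_ineq2[of f "\<phi> j"] by (simp add: norm_eq_sqrt_inner[of "\<phi> j"] orthonormal)

text \<open>Testing each equation with its own solution gives an energy identity: the quadratic form
  equals \<open>d \<bullet> w - \<alpha> * (w \<bullet> w)\<close>, and likewise for the truncated
  solution \<open>w'\<close>. The difference of the two forms is therefore linear in the error v = w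
  - w', which is bounded by testing the difference of the equations with v. There
  \<open>T v \<bullet> v\<close> has a sign and is dropped, so the operator norm of T never
  enters.\<close>

lemma resolvent_comparison:
  fixes c :: "nat \<Rightarrow> 'h" and d w :: 'h and lam :: "nat \<Rightarrow> real"
  assumes lam: "\<And>j. j < J \<Longrightarrow> 0 \<le> lam j" and \<alpha>: "0 < \<alpha>" and \<kappa>: "0 \<le> \<kappa>"
    and w: "\<kappa> *\<^sub>R (\<Sum>i<n. (c i \<bullet> w) *\<^sub>R c i) + \<alpha> *\<^sub>R w = d"
  shows "\<bar>\<kappa> * (\<Sum>i<n. (c i \<bullet> w)\<^sup>2) - (\<Sum>j<J. lam j / (lam j + \<alpha>)\<^sup>2 * (d \<bullet> \<phi> j)\<^sup>2)\<bar>
    \<le> 3 / \<alpha> * norm d * (norm (d - span_proj d) + norm d / \<alpha> *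
        ((\<Sum>j<J. \<Sum>k<J. \<bar>\<kappa> * (\<Sum>i<n. (c i \<bullet> \<phi> j) * (c i \<bullet> \<phi> k)) - (if j = k then lam j else 0)\<bar>)
         + \<kappa> * (\<Sum>i<n. norm (c i) * norm (c i - span_proj (c i)))))"
proof -
  define T where "T v = \<kappa> *\<^sub>R (\<Sum>i<n. (c i \<bullet> v) *\<^sub>R c i)" for v
  \<comment> \<open>The resolvent of the diagonal operator with eigenvalues \<open>lam j\<close>,
    applied to the projection of d.\<close>
  define w' where "w' = (\<Sum>j<J. ((d \<bullet> \<phi> j) / (lam j + \<alpha>)) *\<^sub>R \<phi> j)"
  define v where "v = w - w'"
  define Q where "Q u = (\<Sum>j<J. lam j * (w' \<bullet> \<phi> j) * (u \<bullet> \<phi> j))" for u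
  define \<Delta> where "\<Delta> = (\<Sum>j<J. \<Sum>k<J. \<bar>\<kappa> * (\<Sum>i<n. (c i \<bullet> \<phi> j) * (c i \<bullet> \<phi> k)) - (if j = k then lam j else 0)\<bar>)"
  define \<Gamma> where "\<Gamma> = \<kappa> * (\<Sum>i<n. norm (c i) * norm (c i - span_proj (c i)))"
  have pos: "lam j + \<alpha> > 0" if "j < J" for j using lam[OF that] \<alpha> by linarith
  have w'j: "w' \<bullet> \<phi> j = (d \<bullet> \<phi> j) / (lam j + \<alpha>)" if "j < J" for j
    using that by (simp add: w'_def inner_sum_left orthonormal if_distrib cong: if_cong)
  have w'span_proj: "w' = span_proj w'"
    unfolding span_proj_def by (subst w'_def) (rule sum.cong, auto simp: w'j)
  have T_inner: "T u \<bullet> u' = \<kappa> * (\<Sum>i<n. (c i \<bullet> u) * (c i \<bullet> u'))" for u u'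
    by (simp add: T_def inner_sum_left)
  have eqw': "Q u + \<alpha> * (w' \<bullet> u) = span_proj d \<bullet> u" for u
  proof -
    have "w' \<bullet> u = span_proj w' \<bullet> u" using w'span_proj by simp
    then have "Q u + \<alpha> * (w' \<bullet> u) = (\<Sum>j<J. (lam j + \<alpha>) * (w' \<bullet> \<phi> j) * (u \<bullet> \<phi> j))"
      by (simp add: Q_def proj_inner_left sum_distrib_left flip: sum.distrib) (simp add: algebra_simps)
    also have "\<dots> = (\<Sum>j<J. (d \<bullet> \<phi> j) * (u \<bullet> \<phi> j))"
    proof (rule sum.cong)
      fix j assume "j \<in> {..<J}"
      then show "(lam j + \<alpha>) * (w' \<bullet> \<phi> j) * (u \<bullet> \<phi> j) = (d \<bullet> \<phi> j) * (u \<bullet> \<phi> j)"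
        using pos[of j] by (simp add: w'j)
    qed simp
    finally show ?thesis by (simp add: proj_inner_left)
  qed
  have eqw: "T w \<bullet> u + \<alpha> * (w \<bullet> u) = d \<bullet> u" for u
    using arg_cong[OF w, of "\<lambda>x. x \<bullet> u"] by (simp add: T_def inner_add_left)
  have T_nonneg: "0 \<le> T u \<bullet> u" for u
    using \<kappa> by (auto simp: T_inner intro!: mult_nonneg_nonneg[OF \<kappa>] sum_nonneg)
  have Q_nonneg: "0 \<le> Q w'"
    unfolding Q_def using lam by (intro sum_nonneg) (auto simp: mult.assoc)
  have dw': "span_proj d \<bullet> w' = d \<bullet> w'"
    using w'span_proj proj_self_adjoint[of d w'] by simp
  \<comment> \<open>Cancels one factor of a norm without a case distinction on whether it
    vanishes.\<close>
  have cancel: "a \<le> b" if "c * (a * a) \<le> b * a * c" "0 \<le> a" "0 \<le> b" "0 < c" for a b c :: real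
    using that by (cases "a = 0") (auto simp: mult.commute[of c])
  have norm_w: "norm w \<le> norm d / \<alpha>"
  proof -
    have "\<alpha> * (norm w * norm w) \<le> norm d / \<alpha> * norm w * \<alpha>"
      using eqw[of w] T_nonneg[of w] Cauchy_Schwarz_ineq2[of d w] \<alpha>
      by (simp add: power2_norm_eq_inner[symmetric] power2_eq_square)
    then show ?thesis by (rule cancel) (use \<alpha> in auto)
  qed
  have norm_w': "norm w' \<le> norm d / \<alpha>"
  proof -
    have "\<alpha> * (norm w' * norm w') \<le> norm d / \<alpha> * norm w' * \<alpha>"
      using eqw'[of w'] Q_nonneg Cauchy_Schwarz_ineq2[of d w'] \<alpha>
      by (simp add: dw' power2_norm_eq_inner[symmetric] power2_eq_square)
    then show ?thesis by (rule cancel) (use \<alpha> in auto)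
  qed
  have split: "T w' \<bullet> v = T w' \<bullet> span_proj v + T w' \<bullet> (v - span_proj v)"
    by (simp add: inner_diff_right)
  \<comment> \<open>The complementary projection is self-adjoint and moves from v to each
    \<open>c i\<close>, so only the part of the data outside the span is charged.\<close>
  have tail: "\<bar>T w' \<bullet> (v - span_proj v)\<bar> \<le> norm w' * norm v * \<Gamma>"
  proof -
    have "T w' \<bullet> (v - span_proj v) = \<kappa> * (\<Sum>i<n. (c i \<bullet> w') * ((c i - span_proj (c i)) \<bullet> v))"
      by (simp add: T_inner inner_diff_left proj_self_adjoint flip: inner_diff_right)
    also have "\<bar>\<dots>\<bar> \<le> \<kappa> * (\<Sum>i<n. (norm (c i) * norm w') * (norm (c i - span_proj (c i)) * norm v))"
      by (simp add: abs_mult \<kappa>)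
        (intro mult_left_mono order_trans[OF sum_abs] sum_mono \<kappa>,
         auto simp: abs_mult intro!: mult_mono Cauchy_Schwarz_ineq2)
    also have "\<dots> = norm w' * norm v * \<Gamma>"
      by (simp add: \<Gamma>_def sum_distrib_left algebra_simps)
    finally show ?thesis .
  qed
  \<comment> \<open>On the span both forms are given by matrices; they differ entry by entry, and
    coordinates are at most the norms.\<close>
  have main: "\<bar>T w' \<bullet> span_proj v - Q v\<bar> \<le> norm w' * norm v * \<Delta>"
  proof -
    have "T w' \<bullet> span_proj v = \<kappa> * (\<Sum>i<n. (c i \<bullet> span_proj w') * (c i \<bullet> span_proj v))"
      using w'span_proj by (simp add: T_inner)
    also have "\<dots> = (\<Sum>i<n. \<Sum>j<J. \<Sum>k<J. \<kappa> * (w' \<bullet> \<phi> j) * (v \<bullet> \<phi> k) * ((c i \<bullet> \<phi> j) * (c i \<bullet> \<phi> k)))"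
      by (simp add: inner_commute[of _ "span_proj _"] proj_inner_left sum_product sum_distrib_left algebra_simps)
    also have "\<dots> = (\<Sum>j<J. \<Sum>k<J. \<Sum>i<n. \<kappa> * (w' \<bullet> \<phi> j) * (v \<bullet> \<phi> k) * ((c i \<bullet> \<phi> j) * (c i \<bullet> \<phi> k)))"
      by (subst sum.swap) (rule sum.cong, simp, rule sum.swap)
    also have "\<dots> = (\<Sum>j<J. \<Sum>k<J. (w' \<bullet> \<phi> j) * (v \<bullet> \<phi> k) * (\<kappa> * (\<Sum>i<n. (c i \<bullet> \<phi> j) * (c i \<bullet> \<phi> k))))"
      by (simp add: sum_distrib_left algebra_simps)
    finally have 1: "T w' \<bullet> span_proj v = \<dots>" .
    have 2: "Q v = (\<Sum>j<J. \<Sum>k<J. (w' \<bullet> \<phi> j) * (v \<bullet> \<phi> k) * (if j = k then lam j else 0))"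
      unfolding Q_def by (rule sum.cong) (auto simp: if_distrib cong: if_cong)
    define \<delta> where "\<delta> j k = \<kappa> * (\<Sum>i<n. (c i \<bullet> \<phi> j) * (c i \<bullet> \<phi> k)) - (if j = k then lam j else 0)" for j k
    have "T w' \<bullet> span_proj v - Q v = (\<Sum>j<J. \<Sum>k<J. (w' \<bullet> \<phi> j) * (v \<bullet> \<phi> k) * \<delta> j k)"
      unfolding 1 2 \<delta>_def by (simp only: sum_subtractf[symmetric] right_diff_distrib)
    also have "\<bar>\<dots>\<bar> \<le> (\<Sum>j<J. \<Sum>k<J. norm w' * norm v * \<bar>\<delta> j k\<bar>)"
    proof (intro order_trans[OF sum_abs] sum_mono)
      fix j k assume "j \<in> {..<J}" "k \<in> {..<J}"
      then show "\<bar>(w' \<bullet> \<phi> j) * (v \<bullet> \<phi> k) * \<delta> j k\<bar> \<le> norm w' * norm v * \<bar>\<delta> j k\<bar>"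
        unfolding abs_mult by (intro mult_right_mono mult_mono abs_inner_le) auto
    qed
    finally show ?thesis unfolding \<Delta>_def \<delta>_def[symmetric] by (simp add: sum_distrib_left)
  qed
  have norm_v: "norm v \<le> (norm (d - span_proj d) + norm d / \<alpha> * (\<Delta> + \<Gamma>)) / \<alpha>"
  proof -
    have nn: "0 \<le> \<Delta>" "0 \<le> \<Gamma>"
      by (auto simp: \<Delta>_def \<Gamma>_def intro!: sum_nonneg mult_nonneg_nonneg \<kappa>)
    have Twv: "T w \<bullet> v = T v \<bullet> v + T w' \<bullet> v"
      by (simp add: T_inner v_def inner_diff_right algebra_simps sum.distrib sum_subtractf)
    have "\<alpha> * (v \<bullet> v) = \<alpha> * (w \<bullet> v) - \<alpha> * (w' \<bullet> v)"
      by (simp add: v_def inner_diff_left algebra_simps)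
    also have "\<dots> = (d - span_proj d) \<bullet> v - T v \<bullet> v - (T w' \<bullet> span_proj v - Q v) - T w' \<bullet> (v - span_proj v)"
      using eqw[of v] eqw'[of v] Twv split by (simp add: inner_diff_left)
    also have "\<dots> \<le> norm (d - span_proj d) * norm v + norm w' * norm v * \<Delta> + norm w' * norm v * \<Gamma>"
      using Cauchy_Schwarz_ineq2[of "d - span_proj d" v] T_nonneg[of v] main tail by linarith
    also have "\<dots> = (norm (d - span_proj d) + norm w' * (\<Delta> + \<Gamma>)) * norm v"
      by (simp add: algebra_simps)
    also have "\<dots> \<le> (norm (d - span_proj d) + norm d / \<alpha> * (\<Delta> + \<Gamma>)) * norm v"
      using nn norm_w' by (intro mult_right_mono add_mono) auto
    finally have "\<alpha> * (norm v * norm v) \<le> (norm (d - span_proj d) + norm d / \<alpha> * (\<Delta> + \<Gamma>)) / \<alpha> * norm v * \<alpha>"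
      using \<alpha> by (simp add: power2_norm_eq_inner[symmetric] power2_eq_square)
    then show ?thesis
      by (rule cancel) (use \<alpha> nn in auto)
  qed
  have A: "\<kappa> * (\<Sum>i<n. (c i \<bullet> w)\<^sup>2) = d \<bullet> w - \<alpha> * (w \<bullet> w)"
    using eqw[of w] by (simp add: T_inner power2_eq_square)
  have "(\<Sum>j<J. lam j / (lam j + \<alpha>)\<^sup>2 * (d \<bullet> \<phi> j)\<^sup>2) = Q w'"
    unfolding Q_def by (rule sum.cong) (auto simp: w'j power2_eq_square)
  also have "\<dots> = d \<bullet> w' - \<alpha> * (w' \<bullet> w')"
    using eqw'[of w'] by (simp add: dw')
  finally have B: "(\<Sum>j<J. lam j / (lam j + \<alpha>)\<^sup>2 * (d \<bullet> \<phi> j)\<^sup>2) = d \<bullet> w' - \<alpha> * (w' \<bullet> w')" .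
  \<comment> \<open>Origin of the factor 3: \<open>d \<bullet> v\<close> contributes once and
    \<open>w + w'\<close> twice, because both solutions have norm at most
    \<open>norm d / \<alpha>\<close>.\<close>
  have "d \<bullet> w - \<alpha> * (w \<bullet> w) - (d \<bullet> w' - \<alpha> * (w' \<bullet> w')) = d \<bullet> v - \<alpha> * ((w + w') \<bullet> v)"
    by (simp add: v_def inner_diff_right inner_add_left inner_commute algebra_simps)
  also have "\<bar>\<dots>\<bar> \<le> norm d * norm v + \<alpha> * (norm (w + w') * norm v)"
    using Cauchy_Schwarz_ineq2[of d v] Cauchy_Schwarz_ineq2[of "w + w'" v] \<alpha>
    by (intro order_trans[OF abs_triangle_ineq4] add_mono) (auto simp: abs_mult)
  also have "\<dots> \<le> norm d * norm v + \<alpha> * ((norm d / \<alpha> + norm d / \<alpha>) * norm v)"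
    using norm_w norm_w' \<alpha>
    by (intro add_left_mono mult_left_mono mult_right_mono order_trans[OF norm_triangle_ineq] add_mono) auto
  also have "\<dots> = 3 * norm d * norm v"
    using \<alpha> by (simp add: field_simps)
  also have "\<dots> \<le> 3 * norm d * ((norm (d - span_proj d) + norm d / \<alpha> * (\<Delta> + \<Gamma>)) / \<alpha>)"
    by (intro mult_left_mono norm_v) auto
  finally show ?thesis
    unfolding A B \<Delta>_def[symmetric] \<Gamma>_def[symmetric] by (simp add: field_simps)
qed

section \<open>Centred samples and the rescaled mean\<close>

lemma span_proj_diff: "span_proj (f - g) = span_proj f - span_proj g"
  by (simp add: span_proj_def inner_diff_left scaleR_diff_left sum_subtractf)

lemma span_proj_scaleR: "span_proj (a *\<^sub>R f) = a *\<^sub>R span_proj f"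
  by (simp add: span_proj_def scaleR_sum_right)

lemma span_proj_sum: "span_proj (\<Sum>i\<in>I. f i) = (\<Sum>i\<in>I. span_proj (f i))"
  by (simp add: span_proj_def inner_sum_left scaleR_sum_left) (rule sum.swap)

text \<open>Expanding the square about the mean leaves the uncentred sum minus n times the squared
  norm of the mean.\<close>

lemma sum_norm_centered_le:
  fixes x :: "nat \<Rightarrow> 'h"
  assumes "n > 0"
  shows "(\<Sum>i<n. (norm (x i - (1 / real n) *\<^sub>R (\<Sum>i<n. x i)))\<^sup>2) \<le> (\<Sum>i<n. (norm (x i))\<^sup>2)"
proof -
  define y where "y = (1 / real n) *\<^sub>R (\<Sum>i<n. x i)"
  have y: "(\<Sum>i<n. x i) = real n *\<^sub>R y" using assms by (simp add: y_def)
  have "(\<Sum>i<n. (norm (x i - y))\<^sup>2) = (\<Sum>i<n. x i \<bullet> x i) - 2 * ((\<Sum>i<n. x i) \<bullet> y) + real n * (y \<bullet> y)"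
  proof -
    have "(norm (u - y))\<^sup>2 = u \<bullet> u - 2 * (u \<bullet> y) + y \<bullet> y" for u
      by (simp add: power2_norm_eq_inner inner_diff_left inner_diff_right inner_commute)
    then show ?thesis by (simp add: sum_subtractf sum.distrib inner_sum_left sum_distrib_left)
  qed
  also have "\<dots> = (\<Sum>i<n. (norm (x i))\<^sup>2) - real n * (y \<bullet> y)"
    by (simp add: y power2_norm_eq_inner)
  finally show ?thesis by (simp add: y_def)
qed

text \<open>The previous bound is quadratic in d, so multiplying by n turns d into D throughout.
  Passing from centred to uncentred data changes an entry of the empirical covariance only by a
  product of two coordinates of D over n. Products of norms are split because squared norms have
  computable expectations.\<close>

lemma centered_comparison:
  fixes z :: "nat \<Rightarrow> 'h" and D w :: 'h and lam :: "nat \<Rightarrow> real"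
  assumes lam: "\<And>j. j < J \<Longrightarrow> 0 \<le> lam j" and \<alpha>: "0 < \<alpha>" and n: "0 < n" and \<epsilon>: "0 < \<epsilon>"
  defines "d \<equiv> (1 / real n) *\<^sub>R (\<Sum>i<n. z i)" and "c \<equiv> \<lambda>i. z i - (1 / real n) *\<^sub>R (\<Sum>i<n. z i)"
  assumes D: "D = sqrt (real n) *\<^sub>R d"
    and w: "(1 / real n) *\<^sub>R (\<Sum>i<n. (c i \<bullet> w) *\<^sub>R c i) + \<alpha> *\<^sub>R w = d"
  shows "\<bar>(\<Sum>i<n. (c i \<bullet> w)\<^sup>2) - (\<Sum>j<J. lam j / (lam j + \<alpha>)\<^sup>2 * (D \<bullet> \<phi> j)\<^sup>2)\<bar>
    \<le> 3 / \<alpha> * ((\<epsilon> * (norm D)\<^sup>2 + (norm (D - span_proj D))\<^sup>2 / \<epsilon>) / 2 + (norm D)\<^sup>2 / \<alpha> *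
        ((\<Sum>j<J. \<Sum>k<J. \<bar>1 / real n * (\<Sum>i<n. (z i \<bullet> \<phi> j) * (z i \<bullet> \<phi> k)) - (if j = k then lam j else 0)\<bar>
            + 1 / real n * \<bar>(D \<bullet> \<phi> j) * (D \<bullet> \<phi> k)\<bar>)
         + (\<epsilon> * (1 / real n * (\<Sum>i<n. (norm (z i))\<^sup>2)) + 1 / real n * (\<Sum>i<n. (norm (z i - span_proj (z i)))\<^sup>2) / \<epsilon>) / 2))"
proof -
  define \<kappa> where "\<kappa> = 1 / real n"
  have \<kappa>: "\<kappa> > 0" "real n * \<kappa> = 1" using n by (auto simp: \<kappa>_def)
  define r where "r = sqrt (real n)"
  have r: "r > 0" "r * r = real n" using n by (auto simp: r_def)
  \<comment> \<open>The weight \<epsilon> goes to the factor that is merely bounded in mean, and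
    1/\<epsilon> to the residual that a large J makes small.\<close>
  have amgm: "a * b \<le> (\<epsilon> * a\<^sup>2 + b\<^sup>2 / \<epsilon>) / 2" for a b :: real
  proof -
    have "0 \<le> (\<epsilon> * a - b)\<^sup>2 / \<epsilon>" using \<epsilon> by simp
    also have "\<dots> = \<epsilon> * a\<^sup>2 + b\<^sup>2 / \<epsilon> - 2 * (a * b)"
      using \<epsilon> by (simp add: power2_eq_square field_simps)
    finally show ?thesis by simp
  qed
  define \<Delta> where "\<Delta> = (\<Sum>j<J. \<Sum>k<J. \<bar>\<kappa> * (\<Sum>i<n. (c i \<bullet> \<phi> j) * (c i \<bullet> \<phi> k)) - (if j = k then lam j else 0)\<bar>)"
  define \<Delta>' where "\<Delta>' = (\<Sum>j<J. \<Sum>k<J. \<bar>\<kappa> * (\<Sum>i<n. (z i \<bullet> \<phi> j) * (z i \<bullet> \<phi> k)) - (if j = k then lam j else 0)\<bar>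
            + \<kappa> * \<bar>(D \<bullet> \<phi> j) * (D \<bullet> \<phi> k)\<bar>)"
  define \<Gamma> where "\<Gamma> = \<kappa> * (\<Sum>i<n. norm (c i) * norm (c i - span_proj (c i)))"
  define \<Gamma>' where "\<Gamma>' = (\<epsilon> * (\<kappa> * (\<Sum>i<n. (norm (z i))\<^sup>2)) + \<kappa> * (\<Sum>i<n. (norm (z i - span_proj (z i)))\<^sup>2) / \<epsilon>) / 2"
  have c: "c i = z i - d" for i by (simp add: c_def d_def)
  have sumz: "(\<Sum>i<n. z i \<bullet> u) = real n * (d \<bullet> u)" for u
    using n by (simp add: d_def inner_sum_left)
  have expand: "(\<Sum>i<n. (a i - p) * (b i - q))
      = (\<Sum>i<n. a i * b i) - p * (\<Sum>i<n. b i) - (\<Sum>i<n. a i) * q + real n * (p * q)" for a b :: "nat \<Rightarrow> real" and p q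
    by (induction n) (simp_all add: algebra_simps)
  have triangle: "\<bar>\<kappa> * (x - y) - e\<bar> \<le> \<bar>\<kappa> * x - e\<bar> + \<kappa> * \<bar>y\<bar>" for x y e
  proof -
    have "\<kappa> * (x - y) - e = (\<kappa> * x - e) - \<kappa> * y" by (simp add: right_diff_distrib)
    also have "\<bar>\<dots>\<bar> \<le> \<bar>\<kappa> * x - e\<bar> + \<bar>\<kappa> * y\<bar>" by (rule abs_triangle_ineq4)
    finally show ?thesis using \<kappa>(1) by (simp add: abs_mult)
  qed
  have \<Delta>le: "\<Delta> \<le> \<Delta>'"
    unfolding \<Delta>_def \<Delta>'_def
  proof (intro sum_mono)
    fix j k
    have "(\<Sum>i<n. (c i \<bullet> \<phi> j) * (c i \<bullet> \<phi> k))
      = (\<Sum>i<n. (z i \<bullet> \<phi> j) * (z i \<bullet> \<phi> k)) - (d \<bullet> \<phi> j) * (\<Sum>i<n. z i \<bullet> \<phi> k)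
        - (\<Sum>i<n. z i \<bullet> \<phi> j) * (d \<bullet> \<phi> k) + real n * ((d \<bullet> \<phi> j) * (d \<bullet> \<phi> k))"
      unfolding c inner_diff_left by (rule expand)
    also have "\<dots> = (\<Sum>i<n. (z i \<bullet> \<phi> j) * (z i \<bullet> \<phi> k)) - (D \<bullet> \<phi> j) * (D \<bullet> \<phi> k)"
      unfolding sumz by (simp add: D)
    finally show "\<bar>\<kappa> * (\<Sum>i<n. (c i \<bullet> \<phi> j) * (c i \<bullet> \<phi> k)) - (if j = k then lam j else 0)\<bar>
      \<le> \<bar>\<kappa> * (\<Sum>i<n. (z i \<bullet> \<phi> j) * (z i \<bullet> \<phi> k)) - (if j = k then lam j else 0)\<bar> + \<kappa> * \<bar>(D \<bullet> \<phi> j) * (D \<bullet> \<phi> k)\<bar>"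
      using triangle by simp
  qed
  have \<Gamma>le: "\<Gamma> \<le> \<Gamma>'"
  proof -
    \<comment> \<open>Taking residuals commutes with centring, so residuals obey the same variance
      inequality.\<close>
    have proj_mean: "c i - span_proj (c i) = (z i - span_proj (z i)) - (1 / real n) *\<^sub>R (\<Sum>i<n. z i - span_proj (z i))" for i
      by (simp add: c d_def span_proj_diff span_proj_scaleR span_proj_sum sum_subtractf scaleR_diff_right)
    have 1: "(\<Sum>i<n. (norm (c i))\<^sup>2) \<le> (\<Sum>i<n. (norm (z i))\<^sup>2)"
      unfolding c_def by (rule sum_norm_centered_le[OF n])
    have 2: "(\<Sum>i<n. (norm (c i - span_proj (c i)))\<^sup>2) \<le> (\<Sum>i<n. (norm (z i - span_proj (z i)))\<^sup>2)"
      unfolding proj_mean by (rule sum_norm_centered_le[OF n])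
    have "\<Gamma> \<le> \<kappa> * (\<Sum>i<n. (\<epsilon> * (norm (c i))\<^sup>2 + (norm (c i - span_proj (c i)))\<^sup>2 / \<epsilon>) / 2)"
      unfolding \<Gamma>_def using \<kappa>(1) by (intro mult_left_mono sum_mono amgm) auto
    also have "\<dots> = \<kappa> * ((\<epsilon> * (\<Sum>i<n. (norm (c i))\<^sup>2) + (\<Sum>i<n. (norm (c i - span_proj (c i)))\<^sup>2) / \<epsilon>) / 2)"
      by (simp add: sum_divide_distrib[symmetric] sum.distrib sum_distrib_left)
    also have "\<dots> \<le> \<kappa> * ((\<epsilon> * (\<Sum>i<n. (norm (z i))\<^sup>2) + (\<Sum>i<n. (norm (z i - span_proj (z i)))\<^sup>2) / \<epsilon>) / 2)"
      using \<kappa>(1) \<epsilon> 1 2 by (intro mult_left_mono divide_right_mono add_mono) auto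
    also have "\<dots> = \<Gamma>'"
      by (simp add: \<Gamma>'_def algebra_simps add_divide_distrib)
    finally show ?thesis .
  qed
  have "\<bar>\<kappa> * (\<Sum>i<n. (c i \<bullet> w)\<^sup>2) - (\<Sum>j<J. lam j / (lam j + \<alpha>)\<^sup>2 * (d \<bullet> \<phi> j)\<^sup>2)\<bar>
    \<le> 3 / \<alpha> * norm d * (norm (d - span_proj d) + norm d / \<alpha> * (\<Delta> + \<Gamma>))"
    unfolding \<Delta>_def \<Gamma>_def using lam \<alpha> \<kappa>(1) w
    by (intro resolvent_comparison) (auto simp: \<kappa>_def)
  also have "\<dots> \<le> 3 / \<alpha> * norm d * (norm (d - span_proj d) + norm d / \<alpha> * (\<Delta>' + \<Gamma>'))"
    using \<alpha> \<Delta>le \<Gamma>le by (intro mult_left_mono add_left_mono add_mono) auto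
  finally have "real n * \<bar>\<kappa> * (\<Sum>i<n. (c i \<bullet> w)\<^sup>2) - (\<Sum>j<J. lam j / (lam j + \<alpha>)\<^sup>2 * (d \<bullet> \<phi> j)\<^sup>2)\<bar>
    \<le> (r * r) * (3 / \<alpha> * norm d * (norm (d - span_proj d) + norm d / \<alpha> * (\<Delta>' + \<Gamma>')))"
    unfolding r(2) by (intro mult_left_mono) auto
  also have "\<dots> = 3 / \<alpha> * (norm D * norm (D - span_proj D) + (norm D)\<^sup>2 / \<alpha> * (\<Delta>' + \<Gamma>'))"
  proof -
    have "D - span_proj D = r *\<^sub>R (d - span_proj d)" by (simp add: D r_def span_proj_scaleR scaleR_diff_right)
    then have "norm (D - span_proj D) = r * norm (d - span_proj d)" "norm D = r * norm d"
      using r(1) by (simp_all add: D r_def[symmetric])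
    then show ?thesis by (simp add: algebra_simps power2_eq_square)
  qed
  also have "\<dots> \<le> 3 / \<alpha> * ((\<epsilon> * (norm D)\<^sup>2 + (norm (D - span_proj D))\<^sup>2 / \<epsilon>) / 2 + (norm D)\<^sup>2 / \<alpha> * (\<Delta>' + \<Gamma>'))"
    using \<alpha> by (intro mult_left_mono add_right_mono amgm) auto
  also have "real n * \<bar>\<kappa> * (\<Sum>i<n. (c i \<bullet> w)\<^sup>2) - (\<Sum>j<J. lam j / (lam j + \<alpha>)\<^sup>2 * (d \<bullet> \<phi> j)\<^sup>2)\<bar>
      = \<bar>(\<Sum>i<n. (c i \<bullet> w)\<^sup>2) - (\<Sum>j<J. lam j / (lam j + \<alpha>)\<^sup>2 * (D \<bullet> \<phi> j)\<^sup>2)\<bar>"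
  proof -
    have "real n * \<bar>x\<bar> = \<bar>real n * x\<bar>" for x by (simp add: abs_mult)
    moreover have "real n * (\<kappa> * s) = s" for s using \<kappa>(2) by (simp add: mult.assoc[symmetric])
    moreover have "real n * (\<Sum>j<J. lam j / (lam j + \<alpha>)\<^sup>2 * (d \<bullet> \<phi> j)\<^sup>2) = (\<Sum>j<J. lam j / (lam j + \<alpha>)\<^sup>2 * (D \<bullet> \<phi> j)\<^sup>2)"
      by (simp add: D power_mult_distrib sum_distrib_left mult_ac)
    ultimately show ?thesis by (simp only: right_diff_distrib)
  qed
  finally show ?thesis by (simp only: \<Delta>'_def \<Gamma>'_def \<kappa>_def)
qed

end

section \<open>Square integrable functions on the unit interval\<close>

text \<open>The measure is a parameter because the same inner product calculus serves the unit
  interval and the sample space.\<close>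

definition square_int :: "'a measure \<Rightarrow> ('a \<Rightarrow> real) \<Rightarrow> bool" where
  "square_int M f \<longleftrightarrow> f \<in> borel_measurable M \<and> integrable M (\<lambda>x. (f x)\<^sup>2)"

lemma square_intI: "f \<in> borel_measurable M \<Longrightarrow> integrable M (\<lambda>x. (f x)\<^sup>2) \<Longrightarrow> square_int M f"
  by (simp add: square_int_def)

lemma square_int_measurable [measurable_dest]: "square_int M f \<Longrightarrow> f \<in> borel_measurable M"
  by (simp add: square_int_def)

lemma square_int_integrable: "square_int M f \<Longrightarrow> integrable M (\<lambda>x. (f x)\<^sup>2)"
  by (simp add: square_int_def)

lemma square_int_mult:
  assumes f: "square_int M f" and g: "square_int M g"
  shows "integrable M (\<lambda>x. f x * g x)"
proof (rule Bochner_Integration.integrable_bound)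
  note [measurable] = f[THEN square_int_measurable] g[THEN square_int_measurable]
  show "integrable M (\<lambda>x. (f x)\<^sup>2 + (g x)\<^sup>2)"
    using f g by (intro Bochner_Integration.integrable_add square_int_integrable)
  show "(\<lambda>x. f x * g x) \<in> borel_measurable M" by measurable
  have "\<bar>a * b\<bar> \<le> a\<^sup>2 + b\<^sup>2" for a b :: real
    using sum_squares_bound[of "\<bar>a\<bar>" "\<bar>b\<bar>"] abs_ge_zero[of "a * b"]
    unfolding abs_mult power2_abs by linarith
  then show "AE x in M. norm (f x * g x) \<le> norm ((f x)\<^sup>2 + (g x)\<^sup>2)"
    unfolding real_norm_def by (intro AE_I2) (metis abs_ge_self order_trans)
qed

lemma square_int_zero [simp]: "square_int M (\<lambda>x. 0)"
  by (simp add: square_int_def)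

lemma square_int_add:
  assumes f: "square_int M f" and g: "square_int M g"
  shows "square_int M (\<lambda>x. f x + g x)"
proof (rule square_intI)
  note [measurable] = f[THEN square_int_measurable] g[THEN square_int_measurable]
  show "(\<lambda>x. f x + g x) \<in> borel_measurable M" by measurable
  have "integrable M (\<lambda>x. (f x)\<^sup>2 + (g x)\<^sup>2 + 2 * (f x * g x))"
    using square_int_mult[OF f g] f g
    by (intro Bochner_Integration.integrable_add square_int_integrable integrable_mult_right) auto
  then show "integrable M (\<lambda>x. (f x + g x)\<^sup>2)" by (simp add: power2_sum mult.assoc)
qed

lemma square_int_cmult: "square_int M f \<Longrightarrow> square_int M (\<lambda>x. a * f x)"
  by (auto simp: square_int_def power_mult_distrib)

lemma square_int_diff:
  "square_int M f \<Longrightarrow> square_int M g \<Longrightarrow> square_int M (\<lambda>x. f x - g x)"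
  using square_int_add[of M f "\<lambda>x. (-1) * g x"] square_int_cmult[of M g "-1"] by simp

lemma square_int_sum:
  "(\<And>i. i \<in> I \<Longrightarrow> square_int M (f i)) \<Longrightarrow> square_int M (\<lambda>x. \<Sum>i\<in>I. f i x)"
  by (induction I rule: infinite_finite_induct) (auto intro: square_int_add)

lemma (in finite_measure) square_int_imp_integrable:
  assumes "square_int M f" shows "integrable M f"
  using square_int_mult[OF assms, of "\<lambda>_. 1"] by (simp add: square_int_def)

definition ip :: "'a measure \<Rightarrow> ('a \<Rightarrow> real) \<Rightarrow> ('a \<Rightarrow> real) \<Rightarrow> real" where
  "ip M f g = (\<integral>x. f x * g x \<partial>M)"

lemma ip_commute: "ip M f g = ip M g f"
  by (simp add: ip_def mult.commute)

lemma ip_cong: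
  "(\<And>x. x \<in> space M \<Longrightarrow> f x = f' x) \<Longrightarrow> (\<And>x. x \<in> space M \<Longrightarrow> g x = g' x) \<Longrightarrow> ip M f g = ip M f' g'"
  by (auto simp: ip_def intro!: Bochner_Integration.integral_cong)

lemma ip_self: "ip M f f = (\<integral>x. (f x)\<^sup>2 \<partial>M)"
  by (simp add: ip_def power2_eq_square)

lemma ip_self_nonneg: "0 \<le> ip M f f"
  by (simp add: ip_self)

lemma ip_add_left:
  "square_int M f \<Longrightarrow> square_int M g \<Longrightarrow> square_int M h \<Longrightarrow> ip M (\<lambda>x. f x + g x) h = ip M f h + ip M g h"
  by (simp add: ip_def distrib_right square_int_mult)

lemma ip_diff_left:
  "square_int M f \<Longrightarrow> square_int M g \<Longrightarrow> square_int M h \<Longrightarrow> ip M (\<lambda>x. f x - g x) h = ip M f h - ip M g h"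
  by (simp add: ip_def left_diff_distrib square_int_mult)

lemma ip_cmult_left: "ip M (\<lambda>x. a * f x) g = a * ip M f g"
  by (simp add: ip_def mult.assoc)

lemma ip_diff_right:
  "square_int M f \<Longrightarrow> square_int M g \<Longrightarrow> square_int M h \<Longrightarrow> ip M h (\<lambda>x. f x - g x) = ip M h f - ip M h g"
  by (simp add: ip_commute[of M h] ip_diff_left)

lemma ip_cmult_right: "ip M g (\<lambda>x. a * f x) = a * ip M g f"
  by (simp add: ip_commute[of M g] ip_cmult_left)

lemma square_int_lincomb:
  "(\<And>i. i \<in> I \<Longrightarrow> square_int M (f i)) \<Longrightarrow> square_int M (\<lambda>x. \<Sum>i\<in>I. a i * f i x)"
  by (intro square_int_sum square_int_cmult)

lemma ip_lincomb_left:
  "(\<And>i. i \<in> I \<Longrightarrow> square_int M (f i)) \<Longrightarrow> square_int M g \<Longrightarrow>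
   ip M (\<lambda>x. \<Sum>i\<in>I. a i * f i x) g = (\<Sum>i\<in>I. a i * ip M (f i) g)"
  by (simp add: ip_def sum_distrib_right square_int_mult mult.assoc)

lemma ip_lincomb_add_left:
  assumes "\<And>i. i \<in> I \<Longrightarrow> square_int M (f i)" "square_int M h" "square_int M g"
  shows "ip M (\<lambda>x. (\<Sum>i\<in>I. a i * f i x) + b * h x) g = (\<Sum>i\<in>I. a i * ip M (f i) g) + b * ip M h g"
  by (subst ip_add_left)
    (auto intro!: square_int_lincomb square_int_cmult assms simp: ip_lincomb_left[OF assms(1,3)] ip_cmult_left)

section \<open>The uniform measure on the unit interval\<close>

abbreviation U :: "real measure" where
  "U \<equiv> restrict_space lborel {0..1}"

lemma space_U [simp]: "space U = {0..1}"
  by (simp add: space_restrict_space)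

lemma measurable_U_eq: "borel_measurable U = borel_measurable (restrict_space borel {0..1})"
  by (intro measurable_cong_sets sets_restrict_space_cong) auto

lemma borel_measurable_U: "f \<in> borel_measurable borel \<Longrightarrow> f \<in> borel_measurable U"
  by (rule measurable_restrict_space1) simp

interpretation U: prob_space U
  by (rule prob_spaceI) (simp add: emeasure_restrict_space)

lemma continuous_measurable_U: "continuous_on {0..1} f \<Longrightarrow> f \<in> borel_measurable U"
  unfolding measurable_U_eq by (rule borel_measurable_continuous_on_restrict)

lemma square_int_continuous:
  fixes f :: "real \<Rightarrow> real"
  assumes "continuous_on {0..1} f" shows "square_int U f"
proof (rule square_intI)
  show "f \<in> borel_measurable U" using assms by (rule continuous_measurable_U)
  have "continuous_on {0..1} (\<lambda>x. (f x)\<^sup>2)" using assms by (intro continuous_intros)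
  then have "compact ((\<lambda>x. (f x)\<^sup>2) ` {0..1})" by (rule compact_continuous_image) simp
  then obtain B where "\<And>x. x \<in> {0..1} \<Longrightarrow> norm ((f x)\<^sup>2) \<le> B"
    by (metis compact_imp_bounded bounded_iff image_eqI)
  then show "integrable U (\<lambda>x. (f x)\<^sup>2)"
    by (intro U.integrable_const_bound[of _ B] AE_I2)
      (auto intro!: continuous_measurable_U continuous_intros assms)
qed

lemma LBINT_eq_U: "(LBINT t=0..1. f t) = (\<integral>t. f t \<partial>U)"
  using interval_integral_Icc[of 0 1 f]
  by (simp flip: zero_ereal_def one_ereal_def add: integral_restrict_space set_lebesgue_integral_def)

lemma AE_U_iff: "(AE t in U. P t) \<longleftrightarrow> (AE t in lborel. t \<in> {0..1} \<longrightarrow> P t)"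
  by (rule AE_restrict_space_iff) auto

lemma ip_self_eq_0_iff:
  assumes "square_int M f" shows "ip M f f = 0 \<longleftrightarrow> (AE x in M. f x = 0)"
  unfolding ip_self using integral_nonneg_eq_0_iff_AE[OF square_int_integrable[OF assms]] by simp

text \<open>An instance of \<^class>\<open>real_inner\<close> makes the Hilbert space algebra free of integrability side
  conditions.\<close>

quotient_type l2 = "real \<Rightarrow> real" / partial: "\<lambda>f g. square_int U f \<and> square_int U g \<and> (AE t in U. f t = g t)"
proof (rule part_equivpI)
  show "\<exists>f. square_int U f \<and> square_int U f \<and> (AE t in U. f t = f t)"
    by (rule exI[of _ "\<lambda>_. 0"]) simp
  show "symp (\<lambda>f g. square_int U f \<and> square_int U g \<and> (AE t in U. f t = g t))"
    by (auto intro!: sympI elim: AE_mp)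
  show "transp (\<lambda>f g. square_int U f \<and> square_int U g \<and> (AE t in U. f t = g t))"
    by (rule transpI) (auto elim: AE_mp)
qed

instantiation l2 :: real_inner
begin

lift_definition zero_l2 :: l2 is "\<lambda>_. 0" by simp

lift_definition plus_l2 :: "l2 \<Rightarrow> l2 \<Rightarrow> l2" is "\<lambda>f g t. f t + g t"
  by (auto intro: square_int_add)

lift_definition minus_l2 :: "l2 \<Rightarrow> l2 \<Rightarrow> l2" is "\<lambda>f g t. f t - g t"
  by (auto intro: square_int_diff)

lift_definition uminus_l2 :: "l2 \<Rightarrow> l2" is "\<lambda>f t. (-1) * f t"
  by (intro conjI square_int_cmult) auto

lift_definition scaleR_l2 :: "real \<Rightarrow> l2 \<Rightarrow> l2" is "\<lambda>a f t. a * f t"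
  by (auto intro: square_int_cmult)

lift_definition inner_l2 :: "l2 \<Rightarrow> l2 \<Rightarrow> real" is "ip U"
  unfolding ip_def by (rule integral_cong_AE) (auto dest: square_int_measurable elim: AE_mp)

definition norm_l2 :: "l2 \<Rightarrow> real" where "norm_l2 f = sqrt (inner f f)"
definition dist_l2 :: "l2 \<Rightarrow> l2 \<Rightarrow> real" where "dist_l2 f g = norm (f - g)"
definition sgn_l2 :: "l2 \<Rightarrow> l2" where "sgn_l2 f = scaleR (inverse (norm f)) f"
definition uniformity_l2 :: "(l2 \<times> l2) filter" where
  "uniformity_l2 = (INF e\<in>{0<..}. principal {(f, g). dist f g < e})"
definition open_l2 :: "l2 set \<Rightarrow> bool" where
  "open_l2 A = (\<forall>f\<in>A. eventually (\<lambda>(f', g). f' = f \<longrightarrow> g \<in> A) uniformity)"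

instance
proof
  fix a b c :: l2 and r s :: real
  show "a + b + c = a + (b + c)" by transfer (auto intro!: square_int_add simp: algebra_simps)
  show "a + b = b + a" by transfer (auto intro!: square_int_add simp: algebra_simps)
  show "0 + a = a" by transfer auto
  show "- a + a = 0" by transfer (auto intro!: square_int_add square_int_cmult[of _ _ "-1", simplified])
  show "a - b = a + - b" by transfer (auto intro!: square_int_add square_int_diff square_int_cmult[of _ _ "-1", simplified])
  show "r *\<^sub>R (a + b) = r *\<^sub>R a + r *\<^sub>R b"
    by transfer (auto intro!: square_int_add square_int_cmult simp: algebra_simps)
  show "(r + s) *\<^sub>R a = r *\<^sub>R a + s *\<^sub>R a"
    by transfer (auto intro!: square_int_add square_int_cmult simp: algebra_simps)
  show "r *\<^sub>R s *\<^sub>R a = (r * s) *\<^sub>R a"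
    by transfer (auto intro!: square_int_cmult simp: algebra_simps)
  show "1 *\<^sub>R a = a" by transfer auto
  show "a \<bullet> b = b \<bullet> a" by transfer (rule ip_commute)
  show "(a + b) \<bullet> c = a \<bullet> c + b \<bullet> c" by transfer (auto intro: ip_add_left)
  show "(r *\<^sub>R a) \<bullet> b = r * (a \<bullet> b)" by transfer (rule ip_cmult_left)
  show "0 \<le> a \<bullet> a" by transfer (rule ip_self_nonneg)
  show "a \<bullet> a = 0 \<longleftrightarrow> a = 0" by transfer (auto simp: ip_self_eq_0_iff)
qed (simp_all only: norm_l2_def dist_l2_def sgn_l2_def uniformity_l2_def open_l2_def)

end

lift_definition to_l2 :: "(real \<Rightarrow> real) \<Rightarrow> l2" is "\<lambda>f. if square_int U f then f else (\<lambda>_. 0)"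
  by auto

lemma inner_to_l2: "square_int U f \<Longrightarrow> square_int U g \<Longrightarrow> to_l2 f \<bullet> to_l2 g = ip U f g"
  by transfer simp

lemma norm_to_l2: "square_int U f \<Longrightarrow> (norm (to_l2 f))\<^sup>2 = ip U f f"
  by (simp add: power2_norm_eq_inner inner_to_l2)

lemma to_l2_add: "square_int U f \<Longrightarrow> square_int U g \<Longrightarrow> to_l2 (\<lambda>t. f t + g t) = to_l2 f + to_l2 g"
  by transfer (simp add: square_int_add)

lemma to_l2_cmult: "square_int U f \<Longrightarrow> to_l2 (\<lambda>t. a * f t) = a *\<^sub>R to_l2 f"
  by transfer (simp add: square_int_cmult)

lemma to_l2_zero: "to_l2 (\<lambda>t. 0) = 0"
  by transfer simp

lemma to_l2_sum:
  "(\<And>i. i \<in> I \<Longrightarrow> square_int U (f i)) \<Longrightarrow> to_l2 (\<lambda>t. \<Sum>i\<in>I. f i t) = (\<Sum>i\<in>I. to_l2 (f i))"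
  by (induction I rule: infinite_finite_induct) (auto simp: to_l2_zero to_l2_add square_int_sum)

lemma to_l2_cong:
  assumes "square_int U f" "square_int U g" "AE t in U. f t = g t" shows "to_l2 f = to_l2 g"
  using assms by transfer simp

lemma ip_cauchy_schwarz:
  assumes "square_int U f" "square_int U g"
  shows "(ip U f g)\<^sup>2 \<le> ip U f f * ip U g g"
  using Cauchy_Schwarz_ineq[of "to_l2 f" "to_l2 g"] assms by (simp add: inner_to_l2)

lemma ip_eq_0_if_null:
  "square_int U f \<Longrightarrow> square_int U g \<Longrightarrow> ip U f f = 0 \<Longrightarrow> ip U g f = 0"
  using ip_cauchy_schwarz[of g f] by simp

section \<open>The estimator on a fixed sample\<close>

text \<open>The resolvent of a finite rank operator, by Sherman-Morrison: the rank-one terms are added one at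
  a time, so that existence and joint measurability of the solution follow by induction.\<close>

primrec rsv :: "real \<Rightarrow> real \<Rightarrow> (nat \<Rightarrow> real \<Rightarrow> real) \<Rightarrow> nat \<Rightarrow> (real \<Rightarrow> real) \<Rightarrow> real \<Rightarrow> real" where
  "rsv \<alpha> \<kappa> c 0 f = (\<lambda>t. f t / \<alpha>)"
| "rsv \<alpha> \<kappa> c (Suc k) f = (\<lambda>t. rsv \<alpha> \<kappa> c k f t -
     \<kappa> * ip U (c k) (rsv \<alpha> \<kappa> c k f) / (1 + \<kappa> * ip U (c k) (rsv \<alpha> \<kappa> c k (c k))) * rsv \<alpha> \<kappa> c k (c k) t)"

lemma rsv_continuous:
  assumes "\<And>i. i < k \<Longrightarrow> continuous_on {0..1} (c i)" "\<alpha> > 0" "continuous_on {0..1} f"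
  shows "continuous_on {0..1} (rsv \<alpha> \<kappa> c k f)"
  using assms
proof (induction k arbitrary: f)
  case (Suc k)
  then show ?case
    unfolding rsv.simps by (intro continuous_on_diff continuous_on_mult_left) auto
qed (auto intro!: continuous_intros)

text \<open>The equation holds at every point of the interval, not only almost everywhere, as the
  definition of \<open>reg_sol\<close> demands.\<close>

lemma rsv_solves:
  assumes c: "\<And>i. i < k \<Longrightarrow> continuous_on {0..1} (c i)" and \<alpha>: "\<alpha> > 0" and \<kappa>: "\<kappa> \<ge> 0"
    and f: "continuous_on {0..1} f" and t: "t \<in> {0..1}"
  shows "\<kappa> * (\<Sum>i<k. ip U (c i) (rsv \<alpha> \<kappa> c k f) * c i t) + \<alpha> * rsv \<alpha> \<kappa> c k f t = f t"
  using c f t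
proof (induction k arbitrary: f t)
  case 0
  then show ?case using \<alpha> by simp
next
  case (Suc k)
  define g where "g = rsv \<alpha> \<kappa> c k f"
  define r where "r = rsv \<alpha> \<kappa> c k (c k)"
  have cont: "continuous_on {0..1} g" "continuous_on {0..1} r" "\<And>i. i \<le> k \<Longrightarrow> continuous_on {0..1} (c i)"
    unfolding g_def r_def using Suc.prems \<alpha> by (auto intro!: rsv_continuous)
  note sq = this[THEN square_int_continuous]
  have IHg: "\<kappa> * (\<Sum>i<k. ip U (c i) g * c i s) + \<alpha> * g s = f s" if "s \<in> {0..1}" for s
    unfolding g_def using Suc.prems that by (intro Suc.IH) auto
  have IHr: "\<kappa> * (\<Sum>i<k. ip U (c i) r * c i s) + \<alpha> * r s = c k s" if "s \<in> {0..1}" for s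
    unfolding r_def using Suc.prems that by (intro Suc.IH) auto
  \<comment> \<open>Testing the equation for \<open>r\<close> with \<open>r\<close> itself shows
    that the Sherman-Morrison denominator is at least 1.\<close>
  have "ip U (c k) r = ip U (\<lambda>s. (\<Sum>i<k. (\<kappa> * ip U (c i) r) * c i s) + \<alpha> * r s) r"
    by (rule ip_cong) (auto simp: IHr[symmetric] sum_distrib_left mult.assoc)
  also have "\<dots> = (\<Sum>i<k. \<kappa> * ip U (c i) r * ip U (c i) r) + \<alpha> * ip U r r"
    using sq by (intro ip_lincomb_add_left) auto
  also have "\<dots> \<ge> 0"
    using \<alpha> \<kappa> by (auto intro!: add_nonneg_nonneg sum_nonneg simp: mult.assoc ip_self_nonneg)
  finally have nn: "0 \<le> ip U (c k) r" .
  \<comment> \<open>The coefficient for which subtracting \<open>\<gamma> * r\<close> produces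
    exactly the new rank-one term: \<kappa> times the inner product of \<open>c k\<close> with the
    updated solution is \<gamma> again.\<close>
  define \<gamma> where "\<gamma> = \<kappa> * ip U (c k) g / (1 + \<kappa> * ip U (c k) r)"
  have "1 + \<kappa> * ip U (c k) r > 0" using nn \<kappa> by (simp add: add_pos_nonneg)
  then have "\<gamma> * (1 + \<kappa> * ip U (c k) r) = \<kappa> * ip U (c k) g"
    by (simp add: \<gamma>_def)
  then have \<gamma>: "\<gamma> + \<gamma> * (\<kappa> * ip U (c k) r) = \<kappa> * ip U (c k) g"
    by (simp add: distrib_left)
  have rec: "rsv \<alpha> \<kappa> c (Suc k) f = (\<lambda>s. g s - \<gamma> * r s)"
    by (simp add: g_def r_def \<gamma>_def)
  have ipc: "ip U (c i) (\<lambda>s. g s - \<gamma> * r s) = ip U (c i) g - \<gamma> * ip U (c i) r" if "i \<le> k" for i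
    using sq that by (simp add: ip_diff_right ip_cmult_right square_int_cmult)
  have "\<kappa> * (\<Sum>i<Suc k. ip U (c i) (rsv \<alpha> \<kappa> c (Suc k) f) * c i t) + \<alpha> * rsv \<alpha> \<kappa> c (Suc k) f t
    = \<kappa> * (\<Sum>i<Suc k. (ip U (c i) g - \<gamma> * ip U (c i) r) * c i t) + \<alpha> * (g t - \<gamma> * r t)"
    unfolding rec using ipc by simp
  also have "\<dots> = (\<kappa> * (\<Sum>i<k. ip U (c i) g * c i t) + \<alpha> * g t)
      - \<gamma> * (\<kappa> * (\<Sum>i<k. ip U (c i) r * c i t) + \<alpha> * r t)
      + (\<kappa> * ip U (c k) g - \<gamma> * (\<kappa> * ip U (c k) r)) * c k t"
    by (simp add: algebra_simps sum_subtractf sum_distrib_left)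
  also have "\<dots> = f t - \<gamma> * c k t + (\<kappa> * ip U (c k) g - \<gamma> * (\<kappa> * ip U (c k) r)) * c k t"
    using IHg IHr Suc.prems by simp
  also have "\<kappa> * ip U (c k) g - \<gamma> * (\<kappa> * ip U (c k) r) = \<gamma>" using \<gamma> by simp
  finally show ?case by simp
qed

lemma sq_int_square_int: "sq_int f \<Longrightarrow> square_int U f"
  by (auto simp: sq_int_def square_int_def integrable_restrict_space set_integrable_def
      intro: borel_measurable_U)

text \<open>Cutting off outside the interval secures the measurability on the whole line that
  \<open>sq_int\<close> asks for.\<close>

lemma sq_int_continuous:
  assumes "continuous_on {0..1} f"
  shows "sq_int (\<lambda>s. if s \<in> {0..1} then f s else 0)"
proof -
  have "(\<lambda>s. indicator {0..1} s *\<^sub>R f s) \<in> borel_measurable borel"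
    using assms by (rule borel_measurable_continuous_on_indicator[rotated]) auto
  also have "(\<lambda>s. indicator {0..1} s *\<^sub>R f s) = (\<lambda>s. if s \<in> {0..1} then f s else 0)"
    by (auto simp: indicator_def)
  finally have "(\<lambda>s. if s \<in> {0..1} then f s else 0) \<in> borel_measurable lborel" by simp
  moreover have "set_integrable lborel {0..1} (\<lambda>s. (f s)\<^sup>2)"
    using square_int_integrable[OF square_int_continuous[OF assms]]
    by (simp add: integrable_restrict_space set_integrable_def)
  then have "set_integrable lborel {0..1} (\<lambda>s. (if s \<in> {0..1} then f s else 0)\<^sup>2)"
    by (rule set_integrable_cong[THEN iffD1, rotated -1]) auto
  ultimately show ?thesis by (simp add: sq_int_def)
qed

text \<open>The feature vector of a finite combination: for a kernel of rank at most n,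
  \<open>pre_ip\<close> is \<kappa> times the dot product of the first n entries, which turns RKHS
  questions into questions about R^n.\<close>

definition coef :: "(nat \<Rightarrow> real \<Rightarrow> real) \<Rightarrow> (real \<times> real) list \<Rightarrow> nat \<Rightarrow> real" where
  "coef c as i = (\<Sum>p\<leftarrow>as. fst p * c i (snd p))"

lemma coef_simps [simp]: "coef c [] i = 0" "coef c (p # as) i = fst p * c i (snd p) + coef c as i"
  by (simp_all add: coef_def)

lemma coef_pre_diff: "coef c (pre_diff as bs) i = coef c as i - coef c bs i"
proof -
  have "coef c (map (\<lambda>(a, t). (- a, t)) bs) i = - coef c bs i"
    by (induction bs) auto
  moreover have "coef c (as @ bs) i = coef c as i + coef c bs i" for as bs
    by (simp add: coef_def)
  ultimately show ?thesis by (simp add: pre_diff_def)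
qed

lemma snd_pre_diff: "snd ` set (pre_diff as bs) = snd ` set as \<union> snd ` set bs"
  by (simp add: pre_diff_def image_Un image_image case_prod_beta)

section \<open>Kernels of finite rank: regularised solutions and RKHS\<close>

context
  fixes R :: "real \<Rightarrow> real \<Rightarrow> real" and c :: "nat \<Rightarrow> real \<Rightarrow> real" and n :: nat and \<kappa> :: real
  assumes c_cont: "\<And>i. i < n \<Longrightarrow> continuous_on {0..1} (c i)" and \<kappa>_pos: "\<kappa> > 0"
    and R: "\<And>s t. s \<in> {0..1} \<Longrightarrow> t \<in> {0..1} \<Longrightarrow> R s t = \<kappa> * (\<Sum>i<n. c i s * c i t)"
begin

lemma int_op_finite_rank:
  assumes u: "square_int U u" and s: "s \<in> {0..1}"
  shows "int_op R u s = \<kappa> * (\<Sum>i<n. ip U (c i) u * c i s)"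
proof -
  have "int_op R u s = ip U (\<lambda>t. \<Sum>i<n. (\<kappa> * c i s) * c i t) u"
    unfolding int_op_def LBINT_eq_U ip_def
    using s by (intro Bochner_Integration.integral_cong) (auto simp: R sum_distrib_left mult.assoc)
  also have "\<dots> = (\<Sum>i<n. \<kappa> * c i s * ip U (c i) u)"
    using u c_cont by (intro ip_lincomb_left) (auto intro: square_int_continuous)
  finally show ?thesis by (simp add: sum_distrib_left mult_ac)
qed

text \<open>If w solves \<open>T w + \<alpha> w = f\<close>, then \<open>T w\<close> is the
  regularised solution, since T commutes with its resolvent, and the equation for w gives
  \<open>T w = f - \<alpha> w\<close>.\<close>

lemma reg_sol_finite_rank:
  assumes f: "continuous_on {0..1} f" and \<alpha>: "\<alpha> > 0"
  shows "reg_sol R \<alpha> f = (\<lambda>s. if s \<in> {0..1} then f s - \<alpha> * rsv \<alpha> \<kappa> c n f s else 0)"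
proof -
  define w where "w = rsv \<alpha> \<kappa> c n f"
  define u where "u = (\<lambda>s. if s \<in> {0..1} then f s - \<alpha> * w s else 0)"
  have w: "continuous_on {0..1} w"
    unfolding w_def by (intro rsv_continuous c_cont f \<alpha>)
  note sq = square_int_continuous[OF f] square_int_continuous[OF w] square_int_continuous[OF c_cont]
  have weq: "\<kappa> * (\<Sum>i<n. ip U (c i) w * c i s) + \<alpha> * w s = f s" if "s \<in> {0..1}" for s
    unfolding w_def using \<kappa>_pos that by (intro rsv_solves c_cont f \<alpha>) auto
  have u: "sq_int u"
    unfolding u_def by (intro sq_int_continuous continuous_intros f w)
  have ipu: "ip U (c i) u = ip U (c i) f - \<alpha> * ip U (c i) w" if "i < n" for i
  proof -
    have "ip U (c i) u = ip U (c i) (\<lambda>s. f s - \<alpha> * w s)"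
      by (rule ip_cong) (auto simp: u_def)
    then show ?thesis using sq that by (simp add: ip_diff_right ip_cmult_right square_int_cmult)
  qed
  have sol: "int_op R u s + \<alpha> * u s = int_op R f s" if s: "s \<in> {0..1}" for s
  proof -
    have "int_op R u s = \<kappa> * (\<Sum>i<n. ip U (c i) f * c i s) - \<alpha> * (\<kappa> * (\<Sum>i<n. ip U (c i) w * c i s))"
      using int_op_finite_rank[OF sq_int_square_int[OF u] s] ipu
      by (simp add: algebra_simps sum_subtractf sum_distrib_left)
    also have "\<kappa> * (\<Sum>i<n. ip U (c i) w * c i s) = f s - \<alpha> * w s" using weq[OF s] by simp
    finally show ?thesis using int_op_finite_rank[OF sq(1) s] s by (simp add: u_def)
  qed
  \<comment> \<open>Two solutions differ by e with T e + \<alpha> e = 0. Testing with e shows that e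
    is null, so its inner products with the \<open>c i\<close> vanish, and the pointwise equation
    then forces e to be 0 at every point. This makes the definite description legitimate.\<close>
  have uniq: "v = u" if v: "sq_int v" "\<forall>s\<in>{0..1}. int_op R v s + \<alpha> * v s = int_op R f s"
      "\<forall>s. s \<notin> {0..1} \<longrightarrow> v s = 0" for v
  proof
    fix s
    define e where "e = (\<lambda>s. v s - u s)"
    note sv = sq_int_square_int[OF v(1)] sq_int_square_int[OF u]
    have e: "square_int U e" unfolding e_def by (intro square_int_diff sv)
    have ce: "ip U (c i) e = ip U (c i) v - ip U (c i) u" if "i < n" for i
      using sq that sv unfolding e_def
      by (simp add: ip_diff_right)
    have "\<kappa> * (\<Sum>i<n. ip U (c i) e * c i s)
        = \<kappa> * (\<Sum>i<n. ip U (c i) v * c i s) - \<kappa> * (\<Sum>i<n. ip U (c i) u * c i s)" for s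
      by (simp add: ce left_diff_distrib sum_subtractf right_diff_distrib)
    then have eq: "\<kappa> * (\<Sum>i<n. ip U (c i) e * c i s) + \<alpha> * e s = 0" if s: "s \<in> {0..1}" for s
      using v(2)[rule_format, OF s] sol[OF s] int_op_finite_rank[OF sv(1) s] int_op_finite_rank[OF sv(2) s]
      by (simp add: e_def right_diff_distrib)
    have "0 = ip U (\<lambda>s. 0) e" by (simp add: ip_def)
    also have "\<dots> = ip U (\<lambda>s. (\<Sum>i<n. (\<kappa> * ip U (c i) e) * c i s) + \<alpha> * e s) e"
    proof (rule ip_cong)
      fix s assume "s \<in> space U"
      then show "0 = (\<Sum>i<n. (\<kappa> * ip U (c i) e) * c i s) + \<alpha> * e s"
        using eq[of s] by (simp add: sum_distrib_left mult.assoc)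
    qed simp
    also have "\<dots> = (\<Sum>i<n. \<kappa> * (ip U (c i) e * ip U (c i) e)) + \<alpha> * ip U e e"
      using sq e by (subst ip_lincomb_add_left) (auto simp: mult.assoc)
    finally have "\<alpha> * ip U e e \<le> 0"
      using \<kappa>_pos sum_nonneg[of "{..<n}" "\<lambda>i. \<kappa> * (ip U (c i) e * ip U (c i) e)"] by auto
    then have "ip U e e = 0" using \<alpha> ip_self_nonneg[of U e] by (simp add: mult_le_0_iff)
    then have "ip U (c i) e = 0" if "i < n" for i using ip_eq_0_if_null[OF e sq(3)[OF that]] by simp
    then have "e s = 0" if "s \<in> {0..1}" using eq[OF that] \<alpha> by simp
    then show "v s = u s" using v(3) by (cases "s \<in> {0..1}") (auto simp: e_def u_def)
  qed
  have "reg_sol R \<alpha> f = u"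
    unfolding reg_sol_def
  proof (rule the_equality)
    have "\<forall>s. s \<notin> {0..1} \<longrightarrow> u s = 0" by (simp add: u_def)
    then show "sq_int u \<and> (\<forall>s\<in>{0..1}. int_op R u s + \<alpha> * u s = int_op R f s) \<and> (\<forall>s. s \<notin> {0..1} \<longrightarrow> u s = 0)"
      using u sol by blast
  qed (use uniq in blast)
  then show ?thesis unfolding u_def w_def .
qed

lemma pre_eval_coef:
  "snd ` set as \<subseteq> {0..1} \<Longrightarrow> x \<in> {0..1} \<Longrightarrow> pre_eval R as x = \<kappa> * (\<Sum>i<n. coef c as i * c i x)"
  by (induction as) (auto simp: pre_eval_def R sum.distrib sum_distrib_left algebra_simps)

lemma pre_ip_coef:
  assumes "snd ` set as \<subseteq> {0..1}" "snd ` set bs \<subseteq> {0..1}"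
  shows "pre_ip R as bs = \<kappa> * (\<Sum>i<n. coef c as i * coef c bs i)"
  using assms(1)
proof (induction as)
  case (Cons p as)
  have "(\<Sum>q\<leftarrow>bs. fst p * fst q * R (snd p) (snd q)) = \<kappa> * (\<Sum>i<n. fst p * c i (snd p) * coef c bs i)"
    using assms(2) Cons.prems
    by (induction bs) (auto simp: R sum.distrib sum_distrib_left algebra_simps)
  with Cons show ?case
    by (simp add: pre_ip_def sum.distrib algebra_simps)
qed (simp add: pre_ip_def)

text \<open>The coefficient vectors of a Cauchy sequence of finite combinations converge, and the limit
  lies in the closed span of the vectors (c i t), i < n; it is therefore determined by the limit
  function.\<close>

lemma rkhs_witness_limit:
  fixes hs :: "nat \<Rightarrow> (real \<times> real) list"
  assumes pts: "\<forall>k. snd ` set (hs k) \<subseteq> {0..1}"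
    and cauchy: "\<forall>\<epsilon>>0. \<exists>N. \<forall>j\<ge>N. \<forall>k\<ge>N. pre_ip R (pre_diff (hs j) (hs k)) (pre_diff (hs j) (hs k)) < \<epsilon>"
    and lim: "\<forall>x\<in>{0..1}. (\<lambda>k. pre_eval R (hs k) x) \<longlonglongrightarrow> h x"
    and norm_lim: "(\<lambda>k. sqrt (pre_ip R (hs k) (hs k))) \<longlonglongrightarrow> a"
  shows "\<exists>A. a = sqrt (\<kappa> * (\<Sum>i<n. (A i)\<^sup>2)) \<and> (\<forall>x\<in>{0..1}. h x = \<kappa> * (\<Sum>i<n. A i * c i x)) \<and>
    (\<forall>D. (\<forall>x\<in>{0..1}. (\<Sum>i<n. D i * c i x) = 0) \<longrightarrow> (\<Sum>i<n. D i * A i) = 0)"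
proof -
  \<comment> \<open>The Cauchy condition bounds \<kappa> times a sum of squared coordinate
    differences, hence every coordinate.\<close>
  have "convergent (\<lambda>k. coef c (hs k) i)" if "i < n" for i
  proof (rule Cauchy_convergent, rule CauchyI)
    fix e :: real assume e: "0 < e"
    then have "\<kappa> * e\<^sup>2 > 0" using \<kappa>_pos by simp
    then obtain N where N: "\<And>j k. j \<ge> N \<Longrightarrow> k \<ge> N \<Longrightarrow> pre_ip R (pre_diff (hs j) (hs k)) (pre_diff (hs j) (hs k)) < \<kappa> * e\<^sup>2"
      using cauchy by blast
    have "norm (coef c (hs j) i - coef c (hs k) i) < e" if "j \<ge> N" "k \<ge> N" for j k
    proof -
      have "\<kappa> * (\<Sum>i<n. (coef c (hs j) i - coef c (hs k) i)\<^sup>2) < \<kappa> * e\<^sup>2"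
        using N[OF that] pts by (subst (asm) pre_ip_coef) (auto simp: snd_pre_diff coef_pre_diff power2_eq_square)
      then have "(\<Sum>i<n. (coef c (hs j) i - coef c (hs k) i)\<^sup>2) < e\<^sup>2" using \<kappa>_pos by simp
      moreover have "(coef c (hs j) i - coef c (hs k) i)\<^sup>2 \<le> (\<Sum>i<n. (coef c (hs j) i - coef c (hs k) i)\<^sup>2)"
        using \<open>i < n\<close> by (intro member_le_sum) auto
      ultimately have "\<bar>coef c (hs j) i - coef c (hs k) i\<bar>\<^sup>2 < e\<^sup>2" by simp
      then show ?thesis using e power_less_imp_less_base[of _ 2 e] by force
    qed
    then show "\<exists>N. \<forall>j\<ge>N. \<forall>k\<ge>N. norm (coef c (hs j) i - coef c (hs k) i) < e" by blast
  qed
  then obtain A where A: "\<And>i. i < n \<Longrightarrow> (\<lambda>k. coef c (hs k) i) \<longlonglongrightarrow> A i"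
    unfolding convergent_def by metis
  have "(\<lambda>k. sqrt (\<kappa> * (\<Sum>i<n. (coef c (hs k) i)\<^sup>2))) \<longlonglongrightarrow> sqrt (\<kappa> * (\<Sum>i<n. (A i)\<^sup>2))"
    by (intro tendsto_intros A) auto
  also have "(\<lambda>k. sqrt (\<kappa> * (\<Sum>i<n. (coef c (hs k) i)\<^sup>2))) = (\<lambda>k. sqrt (pre_ip R (hs k) (hs k)))"
    using pts by (simp add: pre_ip_coef power2_eq_square)
  finally have 1: "a = sqrt (\<kappa> * (\<Sum>i<n. (A i)\<^sup>2))"
    using norm_lim by (rule LIMSEQ_unique[rotated])
  have 2: "h x = \<kappa> * (\<Sum>i<n. A i * c i x)" if x: "x \<in> {0..1}" for x
  proof (rule LIMSEQ_unique)
    show "(\<lambda>k. pre_eval R (hs k) x) \<longlonglongrightarrow> h x" using lim x by blast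
    have "(\<lambda>k. \<kappa> * (\<Sum>i<n. coef c (hs k) i * c i x)) \<longlonglongrightarrow> \<kappa> * (\<Sum>i<n. A i * c i x)"
      by (intro tendsto_intros A) auto
    then show "(\<lambda>k. pre_eval R (hs k) x) \<longlonglongrightarrow> \<kappa> * (\<Sum>i<n. A i * c i x)"
      using pts x by (simp add: pre_eval_coef)
  qed
  \<comment> \<open>Membership in the span is expressed by duality: the limit is orthogonal to every
    D that annihilates all the vectors (c i x).\<close>
  have 3: "(\<Sum>i<n. D i * A i) = 0" if D: "\<And>x. x \<in> {0..1} \<Longrightarrow> (\<Sum>i<n. D i * c i x) = 0" for D
  proof (rule LIMSEQ_unique)
    show "(\<lambda>k. \<Sum>i<n. D i * coef c (hs k) i) \<longlonglongrightarrow> (\<Sum>i<n. D i * A i)"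
      by (intro tendsto_intros A) auto
    have "(\<Sum>i<n. D i * coef c as i) = 0" if "snd ` set as \<subseteq> {0..1}" for as
      using that
    proof (induction as)
      case (Cons p as)
      have "(\<Sum>i<n. D i * coef c (p # as) i) = fst p * (\<Sum>i<n. D i * c i (snd p)) + (\<Sum>i<n. D i * coef c as i)"
        by (simp add: algebra_simps sum.distrib sum_distrib_left)
      then show ?case using Cons D by simp
    qed simp
    then show "(\<lambda>k. \<Sum>i<n. D i * coef c (hs k) i) \<longlonglongrightarrow> 0" using pts by simp
  qed
  show ?thesis using 1 2 3 by blast
qed

end

text \<open>Supplies finite combinations of kernel sections that approximate an integral. On each
  cell the mean value theorem for the antiderivative G turns the integral into a value of F, which
  uniform continuity compares with the value at the left end.\<close>

lemma riemann_sum_tendsto: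
  fixes F :: "real \<Rightarrow> real"
  assumes F: "continuous_on {0..1} F"
  shows "(\<lambda>k. \<Sum>j<Suc k. F (real j / real (Suc k)) / real (Suc k)) \<longlonglongrightarrow> (\<integral>t. F t \<partial>U)"
proof -
  define G where "G x = integral {0..x} F" for x
  have G: "(G has_real_derivative F t) (at t within {0..1})" if "t \<in> {0..1}" for t
    unfolding G_def using F that by (rule integral_has_real_derivative)
  have "set_integrable lborel {0..1} F"
    unfolding set_integrable_def using F by (intro borel_integrable_compact) auto
  then have "integral {0..1} F = (\<integral>t. F t \<partial>U)"
    using set_borel_integral_eq_integral(2)[of "{0..1}" F]
    by (simp add: set_lebesgue_integral_def integral_restrict_space)
  then have int: "(\<integral>t. F t \<partial>U) = G 1 - G 0" by (simp add: G_def)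
  show ?thesis
  proof (rule LIMSEQ_I)
    fix e :: real assume e: "0 < e"
    have "uniformly_continuous_on {0..1} F"
      using F by (rule compact_uniformly_continuous) simp
    then obtain d where d: "d > 0" "\<And>x y. x \<in> {0..1} \<Longrightarrow> y \<in> {0..1} \<Longrightarrow> dist y x < d \<Longrightarrow> dist (F y) (F x) < e / 2"
      unfolding uniformly_continuous_on_def using e by (metis half_gt_zero)
    obtain N where N: "1 / real (Suc N) < d" using d(1) nat_approx_posE by blast
    have "norm ((\<Sum>j<Suc k. F (real j / real (Suc k)) / real (Suc k)) - (\<integral>t. F t \<partial>U)) < e" if "k \<ge> N" for k
    proof -
      define K where "K = real (Suc k)"
      have K: "K > 0" "1 / K < d"
        using N that by (auto simp: K_def intro: order.strict_trans1[rotated] simp: frac_le)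
      have step: "\<bar>F (real j / K) / K - (G (real (Suc j) / K) - G (real j / K))\<bar> \<le> (e / 2) / K" if j: "j < Suc k" for j
      proof -
        let ?a = "real j / K" and ?b = "real (Suc j) / K"
        have ab: "?a < ?b" "0 \<le> ?a" "?b \<le> 1" "?b - ?a = 1 / K"
          using K(1) j by (auto simp: K_def divide_simps)
        have "\<exists>\<xi>\<in>{?a<..<?b}. G ?b - G ?a = (\<lambda>h. F \<xi> * h) (?b - ?a)"
        proof (rule mvt)
          show "continuous_on {?a..?b} G"
            unfolding continuous_on_eq_continuous_within
          proof
            fix x assume x: "x \<in> {?a..?b}"
            have "(G has_real_derivative F x) (at x within {?a..?b})"
              using ab x by (intro DERIV_subset[OF G]) auto
            then show "continuous (at x within {?a..?b}) G" by (rule DERIV_continuous)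
          qed
          fix x assume x: "?a < x" "x < ?b"
          have "(G has_real_derivative F x) (at x within {0..1})" using ab x by (intro G) auto
          moreover have "at x within {0..1} = at x" using ab x by (intro at_within_interior) auto
          ultimately show "(G has_derivative (\<lambda>h. F x * h)) (at x)"
            by (simp add: has_field_derivative_def)
        qed (use ab in auto)
        then obtain \<xi> where \<xi>: "?a < \<xi>" "\<xi> < ?b" "G ?b - G ?a = F \<xi> * (1 / K)" using ab by auto
        have "0 \<le> \<xi>" "\<xi> \<le> 1" "\<bar>?a - \<xi>\<bar> < d" using ab \<xi>(1,2) K(2) by linarith+
        then have "dist (F ?a) (F \<xi>) < e / 2"
          using ab by (intro d(2)) (auto simp: dist_real_def)
        then have "\<bar>F ?a - F \<xi>\<bar> / K \<le> (e / 2) / K" using K by (intro divide_right_mono) (auto simp: dist_real_def)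
        moreover have "F ?a / K - (G ?b - G ?a) = (F ?a - F \<xi>) / K"
          unfolding \<xi>(3) by (simp add: diff_divide_distrib)
        ultimately show ?thesis using K by (simp add: abs_divide)
      qed
      have "(\<Sum>j<Suc k. G (real (Suc j) / K) - G (real j / K)) = G 1 - G 0"
        using sum_lessThan_telescope[of "\<lambda>j. G (real j / K)" "Suc k"] K by (simp add: K_def)
      then have "(\<Sum>j<Suc k. F (real j / K) / K) - (\<integral>t. F t \<partial>U)
          = (\<Sum>j<Suc k. F (real j / K) / K - (G (real (Suc j) / K) - G (real j / K)))"
        unfolding int by (simp only: sum_subtractf)
      also have "\<bar>\<dots>\<bar> \<le> (\<Sum>j<Suc k. (e / 2) / K)"
        using step by (intro order_trans[OF sum_abs] sum_mono) auto
      also have "\<dots> = K * ((e / 2) / K)" by (simp add: K_def)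
      also have "\<dots> = e / 2" using K by simp
      finally show ?thesis using e by (simp add: K_def)
    qed
    then show "\<exists>N. \<forall>k\<ge>N. norm ((\<Sum>j<Suc k. F (real j / real (Suc k)) / real (Suc k)) - (\<integral>t. F t \<partial>U)) < e"
      by blast
  qed
qed

text \<open>Riemann sums of R(t, .) w(t) are a witness for h, because their feature vectors tend to
  the vector of inner products of the \<open>c i\<close> with w. Any other witness has a feature
  limit in the span of the vectors (c i x) that represents the same h, and such a limit is
  unique.\<close>

lemma rkhs_norm_finite_rank:
  fixes c :: "nat \<Rightarrow> real \<Rightarrow> real" and n :: nat
  assumes c_cont: "\<And>i. i < n \<Longrightarrow> continuous_on {0..1} (c i)" and \<kappa>_pos: "\<kappa> > 0"
    and R: "\<And>s t. s \<in> {0..1} \<Longrightarrow> t \<in> {0..1} \<Longrightarrow> R s t = \<kappa> * (\<Sum>i<n. c i s * c i t)"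
    and w: "continuous_on {0..1} w"
    and h: "\<And>s. s \<in> {0..1} \<Longrightarrow> h s = \<kappa> * (\<Sum>i<n. ip U (c i) w * c i s)"
  shows "rkhs_norm R h = sqrt (\<kappa> * (\<Sum>i<n. (ip U (c i) w)\<^sup>2))"
proof -
  note [simp del] = of_nat_Suc
  define hs where "hs k = map (\<lambda>j. (w (real j / real (Suc k)) / real (Suc k), real j / real (Suc k))) [0..<Suc k]" for k
  define cf where "cf = coef c"
  have pts: "snd ` set (hs k) \<subseteq> {0..1}" for k
    by (auto simp: hs_def divide_simps)
  have prei: "pre_ip R as bs = \<kappa> * (\<Sum>i<n. cf as i * cf bs i)"
    if "snd ` set as \<subseteq> {0..1}" "snd ` set bs \<subseteq> {0..1}" for as bs
    unfolding cf_def using c_cont \<kappa>_pos R that by (rule pre_ip_coef)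
  have pree: "pre_eval R as x = \<kappa> * (\<Sum>i<n. cf as i * c i x)"
    if "snd ` set as \<subseteq> {0..1}" "x \<in> {0..1}" for as x
    unfolding cf_def using c_cont \<kappa>_pos R that by (rule pre_eval_coef)
  have cfl: "(\<lambda>k. cf (hs k) i) \<longlonglongrightarrow> ip U (c i) w" if "i < n" for i
  proof -
    have "(\<lambda>k. \<Sum>j<Suc k. (c i (real j / real (Suc k)) * w (real j / real (Suc k))) / real (Suc k)) \<longlonglongrightarrow> (\<integral>t. c i t * w t \<partial>U)"
      using riemann_sum_tendsto[of "\<lambda>t. c i t * w t"] c_cont[OF that] w by (simp add: continuous_on_mult)
    moreover have "cf (hs k) i = (\<Sum>j<Suc k. (c i (real j / real (Suc k)) * w (real j / real (Suc k))) / real (Suc k))" for k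
      by (simp add: cf_def coef_def hs_def comp_def interv_sum_list_conv_sum_set_nat
          atLeast0LessThan mult.commute del: upt_Suc sum.lessThan_Suc)
    ultimately show ?thesis by (simp add: ip_def)
  qed
  have ex: "\<exists>hs. (\<forall>k. snd ` set (hs k) \<subseteq> {0..1}) \<and>
      (\<forall>\<epsilon>>0. \<exists>N. \<forall>j\<ge>N. \<forall>k\<ge>N. pre_ip R (pre_diff (hs j) (hs k)) (pre_diff (hs j) (hs k)) < \<epsilon>) \<and>
      (\<forall>x\<in>{0..1}. (\<lambda>k. pre_eval R (hs k) x) \<longlonglongrightarrow> h x) \<and>
      (\<lambda>k. sqrt (pre_ip R (hs k) (hs k))) \<longlonglongrightarrow> sqrt (\<kappa> * (\<Sum>i<n. (ip U (c i) w)\<^sup>2))"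
  proof (intro exI[of _ hs] conjI allI impI ballI)
    fix e :: real assume e: "0 < e"
    \<comment> \<open>Coordinates within \<open>e'\<close> of their limits differ by at most
      \<open>2 * e'\<close> from each other; n + 1 instead of n keeps the final inequality strict
      and the denominator positive.\<close>
    define e' where "e' = sqrt (e / (\<kappa> * (4 * (real n + 1))))"
    have e': "e' > 0" using e \<kappa>_pos by (simp add: e'_def)
    have "\<forall>i\<in>{..<n}. \<forall>\<^sub>F k in sequentially. dist (cf (hs k) i) (ip U (c i) w) < e'"
      using cfl e' tendstoD by blast
    then have "\<forall>\<^sub>F k in sequentially. \<forall>i\<in>{..<n}. dist (cf (hs k) i) (ip U (c i) w) < e'"
      by (intro eventually_ball_finite) auto
    then obtain N where N: "\<And>k i. k \<ge> N \<Longrightarrow> i < n \<Longrightarrow> dist (cf (hs k) i) (ip U (c i) w) < e'"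
      unfolding eventually_sequentially by auto
    have "pre_ip R (pre_diff (hs j) (hs k)) (pre_diff (hs j) (hs k)) < e" if "j \<ge> N" "k \<ge> N" for j k
    proof -
      have "(cf (hs j) i - cf (hs k) i)\<^sup>2 \<le> (2 * e')\<^sup>2" if "i < n" for i
        using N[OF \<open>j \<ge> N\<close> that] N[OF \<open>k \<ge> N\<close> that]
        by (intro power2_le_iff_abs_le[THEN iffD2]) (auto simp: dist_real_def)
      then have "(\<Sum>i<n. (cf (hs j) i - cf (hs k) i)\<^sup>2) \<le> (\<Sum>i<n. (2 * e')\<^sup>2)" by (intro sum_mono) auto
      then have "\<kappa> * (\<Sum>i<n. (cf (hs j) i - cf (hs k) i)\<^sup>2) \<le> \<kappa> * (real n * (2 * e')\<^sup>2)"
        using \<kappa>_pos by simp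
      also have "\<dots> < \<kappa> * ((real n + 1) * (2 * e')\<^sup>2)"
        using \<kappa>_pos e' by (intro mult_strict_left_mono mult_strict_right_mono) auto
      also have "\<dots> = e"
      proof -
        have "e'\<^sup>2 = e / (\<kappa> * (4 * (real n + 1)))" using e \<kappa>_pos by (simp add: e'_def)
        then have "\<kappa> * (4 * (real n + 1)) * e'\<^sup>2 = e" using \<kappa>_pos by simp
        then show ?thesis by (simp add: power_mult_distrib algebra_simps)
      qed
      finally show ?thesis
        using pts by (subst prei) (auto simp: snd_pre_diff
            coef_pre_diff cf_def power2_eq_square)
    qed
    then show "\<exists>N. \<forall>j\<ge>N. \<forall>k\<ge>N. pre_ip R (pre_diff (hs j) (hs k)) (pre_diff (hs j) (hs k)) < e" by blast
  next
    fix x :: real assume x: "x \<in> {0..1}"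
    have "(\<lambda>k. \<kappa> * (\<Sum>i<n. cf (hs k) i * c i x)) \<longlonglongrightarrow> \<kappa> * (\<Sum>i<n. ip U (c i) w * c i x)"
      by (intro tendsto_intros cfl) auto
    then show "(\<lambda>k. pre_eval R (hs k) x) \<longlonglongrightarrow> h x" using h[OF x] pts x by (simp only: pree)
  next
    have "(\<lambda>k. sqrt (\<kappa> * (\<Sum>i<n. (cf (hs k) i)\<^sup>2))) \<longlonglongrightarrow> sqrt (\<kappa> * (\<Sum>i<n. (ip U (c i) w)\<^sup>2))"
      by (intro tendsto_intros cfl) auto
    then show "(\<lambda>k. sqrt (pre_ip R (hs k) (hs k))) \<longlonglongrightarrow> sqrt (\<kappa> * (\<Sum>i<n. (ip U (c i) w)\<^sup>2))"
      using pts by (simp add: prei power2_eq_square)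
  qed (rule pts)
  show ?thesis
    unfolding rkhs_norm_def
  proof (rule the_equality, rule ex, elim exE conjE)
    fix a hs'
    assume hs': "\<forall>k. snd ` set (hs' k) \<subseteq> {0..1}"
      "\<forall>\<epsilon>>0. \<exists>N. \<forall>j\<ge>N. \<forall>k\<ge>N. pre_ip R (pre_diff (hs' j) (hs' k)) (pre_diff (hs' j) (hs' k)) < \<epsilon>"
      "\<forall>x\<in>{0..1}. (\<lambda>k. pre_eval R (hs' k) x) \<longlonglongrightarrow> h x"
      "(\<lambda>k. sqrt (pre_ip R (hs' k) (hs' k))) \<longlonglongrightarrow> a"
    have "\<exists>A. a = sqrt (\<kappa> * (\<Sum>i<n. (A i)\<^sup>2)) \<and> (\<forall>x\<in>{0..1}. h x = \<kappa> * (\<Sum>i<n. A i * c i x)) \<and>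
      (\<forall>D. (\<forall>x\<in>{0..1}. (\<Sum>i<n. D i * c i x) = 0) \<longrightarrow> (\<Sum>i<n. D i * A i) = 0)"
      using c_cont \<kappa>_pos R hs' by (rule rkhs_witness_limit)
    then obtain A where A: "a = sqrt (\<kappa> * (\<Sum>i<n. (A i)\<^sup>2))" "\<forall>x\<in>{0..1}. h x = \<kappa> * (\<Sum>i<n. A i * c i x)"
      "\<forall>D. (\<forall>x\<in>{0..1}. (\<Sum>i<n. D i * c i x) = 0) \<longrightarrow> (\<Sum>i<n. D i * A i) = 0"
      by (elim exE conjE)
    from ex obtain hs'' where hs'': "\<forall>k. snd ` set (hs'' k) \<subseteq> {0..1}"
      "\<forall>\<epsilon>>0. \<exists>N. \<forall>j\<ge>N. \<forall>k\<ge>N. pre_ip R (pre_diff (hs'' j) (hs'' k)) (pre_diff (hs'' j) (hs'' k)) < \<epsilon>"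
      "\<forall>x\<in>{0..1}. (\<lambda>k. pre_eval R (hs'' k) x) \<longlonglongrightarrow> h x"
      "(\<lambda>k. sqrt (pre_ip R (hs'' k) (hs'' k))) \<longlonglongrightarrow> sqrt (\<kappa> * (\<Sum>i<n. (ip U (c i) w)\<^sup>2))"
      by (elim exE conjE)
    have "\<exists>B. sqrt (\<kappa> * (\<Sum>i<n. (ip U (c i) w)\<^sup>2)) = sqrt (\<kappa> * (\<Sum>i<n. (B i)\<^sup>2)) \<and>
      (\<forall>x\<in>{0..1}. h x = \<kappa> * (\<Sum>i<n. B i * c i x)) \<and>
      (\<forall>D. (\<forall>x\<in>{0..1}. (\<Sum>i<n. D i * c i x) = 0) \<longrightarrow> (\<Sum>i<n. D i * B i) = 0)"
      using c_cont \<kappa>_pos R hs'' by (rule rkhs_witness_limit)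
    then obtain B where B: "sqrt (\<kappa> * (\<Sum>i<n. (ip U (c i) w)\<^sup>2)) = sqrt (\<kappa> * (\<Sum>i<n. (B i)\<^sup>2))"
      "\<forall>x\<in>{0..1}. h x = \<kappa> * (\<Sum>i<n. B i * c i x)"
      "\<forall>D. (\<forall>x\<in>{0..1}. (\<Sum>i<n. D i * c i x) = 0) \<longrightarrow> (\<Sum>i<n. D i * B i) = 0"
      by (elim exE conjE)
    have D: "\<forall>x\<in>{0..1}. (\<Sum>i<n. (A i - B i) * c i x) = 0"
    proof
      fix x :: real assume x: "x \<in> {0..1}"
      have "\<kappa> * (\<Sum>i<n. A i * c i x) = \<kappa> * (\<Sum>i<n. B i * c i x)"
        using A(2)[rule_format, OF x] B(2)[rule_format, OF x] by (rule trans[OF sym])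
      then show "(\<Sum>i<n. (A i - B i) * c i x) = 0"
        using \<kappa>_pos by (simp add: left_diff_distrib sum_subtractf)
    qed
    \<comment> \<open>\<open>A - B\<close> annihilates every vector (c i x), so it is orthogonal to
      A and to B and hence to itself.\<close>
    have "(\<Sum>i<n. (A i - B i)\<^sup>2) = (\<Sum>i<n. (A i - B i) * A i) - (\<Sum>i<n. (A i - B i) * B i)"
      by (simp add: sum_subtractf[symmetric] power2_eq_square right_diff_distrib)
    also have "\<dots> = 0" using A(3)[rule_format, OF D[rule_format]] B(3)[rule_format, OF D[rule_format]] by simp
    finally have "\<forall>i\<in>{..<n}. A i = B i" by (simp add: sum_nonneg_eq_0_iff)
    then show "a = sqrt (\<kappa> * (\<Sum>i<n. (ip U (c i) w)\<^sup>2))" unfolding A(1) B(1) by simp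
  qed
qed

text \<open>By linearity w solves the equation with right-hand side f - g. Both definite
  descriptions disappear from the estimator, leaving a formula that is visibly measurable in the
  sample.\<close>

lemma M_hat_eq:
  fixes x :: "nat \<Rightarrow> real \<Rightarrow> real"
  assumes x: "\<And>i. i < n \<Longrightarrow> continuous_on {0..1} (x i)" and n: "n > 0" and \<alpha>: "\<alpha> > 0"
    and f: "continuous_on {0..1} f" and g: "continuous_on {0..1} g"
  defines "c \<equiv> \<lambda>i t. x i t - xbar n x t"
  defines "w \<equiv> \<lambda>t. rsv \<alpha> (1 / real n) c n f t - rsv \<alpha> (1 / real n) c n g t"
  shows "M_hat \<alpha> n x f g = sqrt (1 / real n * (\<Sum>i<n. (ip U (c i) w)\<^sup>2))"
    and "continuous_on {0..1} w"
    and "\<And>s. s \<in> {0..1} \<Longrightarrow> 1 / real n * (\<Sum>i<n. ip U (c i) w * c i s) + \<alpha> * w s = f s - g s"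
proof -
  have c: "continuous_on {0..1} (c i)" if "i < n" for i
    unfolding c_def xbar_def using x that by (intro continuous_intros) auto
  have \<kappa>: "1 / real n > 0" using n by simp
  have R: "emp_cov n x s t = 1 / real n * (\<Sum>i<n. c i s * c i t)" for s t
    by (simp add: emp_cov_def c_def)
  have rf: "continuous_on {0..1} (rsv \<alpha> (1 / real n) c n h)" if "continuous_on {0..1} h" for h
    using c \<alpha> that by (rule rsv_continuous)
  have solves: "1 / real n * (\<Sum>i<n. ip U (c i) (rsv \<alpha> (1 / real n) c n h) * c i s)
      + \<alpha> * rsv \<alpha> (1 / real n) c n h s = h s" if "continuous_on {0..1} h" "s \<in> {0..1}" for h s
    using c \<alpha> less_imp_le[OF \<kappa>] that by (rule rsv_solves)
  have reg: "reg_sol (emp_cov n x) \<alpha> h s = h s - \<alpha> * rsv \<alpha> (1 / real n) c n h s"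
    if "continuous_on {0..1} h" "s \<in> {0..1}" for h s
    using reg_sol_finite_rank[OF c \<kappa> R that(1) \<alpha>] that(2) by simp
  show w: "continuous_on {0..1} w" unfolding w_def by (intro continuous_intros rf f g)
  note sq = square_int_continuous[OF rf[OF f]] square_int_continuous[OF rf[OF g]] square_int_continuous[OF c]
  have ipw: "ip U (c i) w = ip U (c i) (rsv \<alpha> (1 / real n) c n f) - ip U (c i) (rsv \<alpha> (1 / real n) c n g)"
    if "i < n" for i
    unfolding w_def using sq that by (simp add: ip_diff_right)
  show eq: "1 / real n * (\<Sum>i<n. ip U (c i) w * c i s) + \<alpha> * w s = f s - g s" if s: "s \<in> {0..1}" for s
  proof -
    have "f s - g s = (1 / real n * (\<Sum>i<n. ip U (c i) (rsv \<alpha> (1 / real n) c n f) * c i s) + \<alpha> * rsv \<alpha> (1 / real n) c n f s)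
      - (1 / real n * (\<Sum>i<n. ip U (c i) (rsv \<alpha> (1 / real n) c n g) * c i s) + \<alpha> * rsv \<alpha> (1 / real n) c n g s)"
      by (simp only: solves[OF f s] solves[OF g s])
    also have "\<dots> = 1 / real n * (\<Sum>i<n. ip U (c i) w * c i s) + \<alpha> * w s"
      using ipw by (simp add: w_def left_diff_distrib sum_subtractf right_diff_distrib diff_divide_distrib)
    finally show ?thesis by simp
  qed
  show "M_hat \<alpha> n x f g = sqrt (1 / real n * (\<Sum>i<n. (ip U (c i) w)\<^sup>2))"
    unfolding M_hat_def
  proof (rule rkhs_norm_finite_rank[OF c \<kappa> R w])
    fix s :: real assume s: "s \<in> {0..1}"
    have "reg_sol (emp_cov n x) \<alpha> f s - reg_sol (emp_cov n x) \<alpha> g s = f s - g s - \<alpha> * w s"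
      using s by (simp add: reg[OF f] reg[OF g] w_def right_diff_distrib)
    also have "\<dots> = 1 / real n * (\<Sum>i<n. ip U (c i) w * c i s)" using eq[OF s] by simp
    finally show "reg_sol (emp_cov n x) \<alpha> f s - reg_sol (emp_cov n x) \<alpha> g s = 1 / real n * (\<Sum>i<n. ip U (c i) w * c i s)" .
  qed
qed

section \<open>Continuous second-order processes\<close>

text \<open>Takes finitely many values on the unit interval, so that evaluating a path at
  \<open>grid k t\<close> involves finitely many coordinates only.\<close>

definition grid :: "nat \<Rightarrow> real \<Rightarrow> real" where
  "grid k t = real (nat \<lfloor>real (Suc k) * t\<rfloor>) / real (Suc k)"

lemma grid_range: "t \<in> {0..1} \<Longrightarrow> grid k t \<in> {0..1}"
proof -
  assume t: "t \<in> {0..1}"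
  then have "real (nat \<lfloor>real (Suc k) * t\<rfloor>) \<le> real (Suc k) * t" by simp
  also have "\<dots> \<le> real (Suc k)" using t by (simp add: mult_left_le)
  finally show ?thesis by (simp add: grid_def)
qed

lemma grid_tendsto:
  assumes t: "t \<in> {0..1}" shows "(\<lambda>k. grid k t) \<longlonglongrightarrow> t"
proof (rule real_tendsto_sandwich)
  have "t - 1 / real (Suc k) \<le> grid k t \<and> grid k t \<le> t" for k
  proof -
    have "real (nat \<lfloor>real (Suc k) * t\<rfloor>) = real_of_int \<lfloor>real (Suc k) * t\<rfloor>" using t by simp
    then have "real (nat \<lfloor>real (Suc k) * t\<rfloor>) \<le> real (Suc k) * t"
      "real (Suc k) * t - 1 \<le> real (nat \<lfloor>real (Suc k) * t\<rfloor>)" by linarith+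
    then have "real (nat \<lfloor>real (Suc k) * t\<rfloor>) / real (Suc k) \<le> (real (Suc k) * t) / real (Suc k)"
      "(real (Suc k) * t - 1) / real (Suc k) \<le> real (nat \<lfloor>real (Suc k) * t\<rfloor>) / real (Suc k)"
      by (intro divide_right_mono; simp)+
    then show ?thesis by (simp add: grid_def diff_divide_distrib del: of_nat_Suc)
  qed
  then show "\<forall>\<^sub>F k in sequentially. t - 1 / real (Suc k) \<le> grid k t"
    "\<forall>\<^sub>F k in sequentially. grid k t \<le> t" by auto
  show "(\<lambda>k. t - 1 / real (Suc k)) \<longlonglongrightarrow> t"
    using tendsto_diff[OF tendsto_const LIMSEQ_inverse_real_of_nat, of t] by (simp add: inverse_eq_divide)
qed simp

text \<open>The product sigma-algebra does not see path continuity, so functionals of a path such as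
  integrals are made measurable by recovering the path from its values on finite grids.\<close>

definition recover :: "(real \<Rightarrow> real) \<Rightarrow> real \<Rightarrow> real" where
  "recover x t = lim (\<lambda>k. x (grid k t))"

abbreviation paths :: "(real \<Rightarrow> real) measure" where
  "paths \<equiv> PiM {0..1} (\<lambda>_. borel)"

lemma recover_continuous:
  assumes "continuous_on {0..1} y" "t \<in> {0..1}"
  shows "recover (restrict y {0..1}) t = y t"
proof -
  have "(\<lambda>k. y (grid k t)) \<longlonglongrightarrow> y t"
    using assms by (intro continuous_on_tendsto_compose[OF assms(1)] grid_tendsto always_eventually allI grid_range) auto
  then show ?thesis using grid_range[OF assms(2)] by (simp add: recover_def limI)
qed

text \<open>For fixed k the grid index is a measurable function with countably many values, and on
  each of them the map is a coordinate evaluation. Joint measurability then passes to the limit in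
  k.\<close>

lemma measurable_recover: "(\<lambda>(x, t). recover x t) \<in> borel_measurable (paths \<Otimes>\<^sub>M U)"
proof -
  have [measurable]: "(\<lambda>p. fst p (grid k (snd p))) \<in> borel_measurable (paths \<Otimes>\<^sub>M U)" for k
  proof -
    have fl: "(\<lambda>p. nat \<lfloor>real (Suc k) * snd p\<rfloor>) \<in> measurable (paths \<Otimes>\<^sub>M U) (count_space UNIV)"
    proof -
      have [measurable]: "(\<lambda>p. snd p) \<in> borel_measurable (paths \<Otimes>\<^sub>M U)"
        by (rule measurable_compose[OF measurable_snd]) (simp add: borel_measurable_U)
      show ?thesis by measurable
    qed
    \<comment> \<open>The guard keeps the node inside the index set of the product; every index that
      is attained satisfies it.\<close>
    have "(\<lambda>p. (\<lambda>i p. if i \<le> Suc k then fst p (real i / real (Suc k)) else 0) (nat \<lfloor>real (Suc k) * snd p\<rfloor>) p)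
        \<in> borel_measurable (paths \<Otimes>\<^sub>M U)"
    proof (rule measurable_compose_countable[OF _ fl])
      fix i :: nat
      show "(\<lambda>p. if i \<le> Suc k then fst p (real i / real (Suc k)) else 0) \<in> borel_measurable (paths \<Otimes>\<^sub>M U)"
        by (cases "i \<le> Suc k")
          (auto intro!: measurable_compose[OF measurable_fst] measurable_component_singleton simp: divide_simps)
    qed
    then show ?thesis
    proof (rule measurable_cong[THEN iffD1, rotated])
      fix p :: "(real \<Rightarrow> real) \<times> real" assume "p \<in> space (paths \<Otimes>\<^sub>M U)"
      then have p: "snd p \<in> {0..1}" by (auto simp: space_pair_measure)
      then have "real (nat \<lfloor>real (Suc k) * snd p\<rfloor>) \<le> real (Suc k) * snd p" by simp
      also have "\<dots> \<le> real (Suc k)" using p by (simp add: mult_left_le)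
      finally have "nat \<lfloor>real (Suc k) * snd p\<rfloor> \<le> Suc k" by linarith
      then show "(\<lambda>i p. if i \<le> Suc k then fst p (real i / real (Suc k)) else 0) (nat \<lfloor>real (Suc k) * snd p\<rfloor>) p
          = fst p (grid k (snd p))"
        by (simp add: grid_def)
    qed
  qed
  show ?thesis unfolding recover_def split_beta by measurable
qed

text \<open>Measurability into the product space is coordinatewise; continuity of the paths upgrades
  it to the joint measurability that Fubini requires.\<close>

lemma measurable_process:
  assumes meas: "(\<lambda>\<omega>. restrict (Z \<omega>) {0..1}) \<in> measurable M paths"
    and cont: "\<And>\<omega>. \<omega> \<in> space M \<Longrightarrow> continuous_on {0..1} (Z \<omega>)"
  shows "(\<lambda>(\<omega>, t). Z \<omega> t) \<in> borel_measurable (M \<Otimes>\<^sub>M U)"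
proof -
  have "(\<lambda>(\<omega>, t). (restrict (Z \<omega>) {0..1}, t)) \<in> measurable (M \<Otimes>\<^sub>M U) (paths \<Otimes>\<^sub>M U)"
    unfolding split_beta
    by (intro measurable_Pair measurable_compose[OF measurable_fst meas] measurable_snd)
  from measurable_compose[OF this measurable_recover]
  have "(\<lambda>(\<omega>, t). recover (restrict (Z \<omega>) {0..1}) t) \<in> borel_measurable (M \<Otimes>\<^sub>M U)"
    by (simp add: split_beta)
  then show ?thesis
    by (rule measurable_cong[THEN iffD1, rotated]) (auto simp: space_pair_measure recover_continuous cont)
qed

text \<open>The inner product with f as a functional on path space, so that independence and
  equality of laws of paths pass to it by composition.\<close>

definition pairing :: "(real \<Rightarrow> real) \<Rightarrow> (real \<Rightarrow> real) \<Rightarrow> real" where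
  "pairing f x = (\<integral>t. recover x t * f t \<partial>U)"

lemma pairing_measurable:
  assumes f[measurable]: "f \<in> borel_measurable U" shows "pairing f \<in> borel_measurable paths"
proof -
  note measurable_recover[measurable]
  show ?thesis unfolding pairing_def[abs_def]
    by (rule U.borel_measurable_lebesgue_integral) measurable
qed

lemma pairing_restrict:
  "continuous_on {0..1} y \<Longrightarrow> pairing f (restrict y {0..1}) = ip U y f"
  unfolding pairing_def ip_def by (intro Bochner_Integration.integral_cong) (auto simp: recover_continuous)

lemma continuous_AE_zero:
  assumes f: "continuous_on {0..1} (f :: real \<Rightarrow> real)" and 0: "AE t in U. f t = 0" and t: "t \<in> {0..1}"
  shows "f t = 0"
proof -
  have c: "continuous_on {0..1} (\<lambda>t. (f t)\<^sup>2)" using f by (intro continuous_intros)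
  have "set_integrable lborel {0..1} (\<lambda>t. (f t)\<^sup>2)"
    unfolding set_integrable_def using c by (intro borel_integrable_compact) auto
  then have "integral {0..1} (\<lambda>t. (f t)\<^sup>2) = ip U f f"
    using set_borel_integral_eq_integral(2)[of "{0..1}" "\<lambda>t. (f t)\<^sup>2"]
    by (simp add: set_lebesgue_integral_def integral_restrict_space ip_self)
  also have "\<dots> = 0" using 0 by (simp add: ip_self_eq_0_iff square_int_continuous f)
  finally show ?thesis
    using integral_eq_0_iff[OF c] t by auto
qed

text \<open>Contains second-order information about one process and no independence, so that a
  single observation and the rescaled sample mean can both instantiate it.\<close>

locale process = prob_space M for M :: "'a measure" +
  fixes W :: "'a \<Rightarrow> real \<Rightarrow> real" and K :: "real \<Rightarrow> real \<Rightarrow> real"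
  assumes W_measurable: "(\<lambda>(\<omega>, t). W \<omega> t) \<in> borel_measurable (M \<Otimes>\<^sub>M U)"
    and W_continuous: "\<And>\<omega>. \<omega> \<in> space M \<Longrightarrow> continuous_on {0..1} (W \<omega>)"
    and W_square_int: "\<And>t. t \<in> {0..1} \<Longrightarrow> square_int M (\<lambda>\<omega>. W \<omega> t)"
    and W_mean: "\<And>t. t \<in> {0..1} \<Longrightarrow> expectation (\<lambda>\<omega>. W \<omega> t) = 0"
    and W_cov: "\<And>s t. s \<in> {0..1} \<Longrightarrow> t \<in> {0..1} \<Longrightarrow> expectation (\<lambda>\<omega>. W \<omega> s * W \<omega> t) = K s t"
    and K_continuous: "continuous_on ({0..1} \<times> {0..1}) (\<lambda>(s, t). K s t)"
begin

sublocale UM: pair_sigma_finite U M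
  by unfold_locales

lemma W_measurable_swap [measurable]: "(\<lambda>(t, \<omega>). W \<omega> t) \<in> borel_measurable (U \<Otimes>\<^sub>M M)"
  using measurable_compose[OF measurable_pair_swap' W_measurable] by (simp add: split_beta)

lemma K_bounded: "\<exists>C\<ge>0. \<forall>s\<in>{0..1}. \<forall>t\<in>{0..1}. \<bar>K s t\<bar> \<le> C"
proof -
  have "compact ((\<lambda>(s, t). K s t) ` ({0..1} \<times> {0..1}))"
    by (intro compact_continuous_image K_continuous compact_Times) auto
  then have "bounded ((\<lambda>(s, t). K s t) ` ({0..1} \<times> {0..1}))" by (rule compact_imp_bounded)
  then obtain C where C: "\<forall>s\<in>{0..1}. \<forall>t\<in>{0..1}. \<bar>K s t\<bar> \<le> C"
    by (auto simp: bounded_iff)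
  then have "0 \<le> C" using order_trans[OF abs_ge_zero, of "K 0 0" C] by simp
  with C show ?thesis by blast
qed

lemma K_section: "s \<in> {0..1} \<Longrightarrow> continuous_on {0..1} (K s)"
  using continuous_on_compose2[OF K_continuous, of "{0..1}" "\<lambda>t. (s, t)"]
  by (simp add: continuous_on_Pair image_subset_iff)

lemma K_diag_nonneg: "s \<in> {0..1} \<Longrightarrow> 0 \<le> K s s"
  by (simp add: W_cov[symmetric])

lemma K_diag: "continuous_on {0..1} (\<lambda>s. K s s)"
  using continuous_on_compose2[OF K_continuous, of "{0..1}" "\<lambda>t. (t, t)"]
  by (simp add: continuous_on_Pair image_subset_iff)

lemma W_path: "\<omega> \<in> space M \<Longrightarrow> square_int U (W \<omega>)"
  by (intro square_int_continuous W_continuous)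

lemma norm_W:
  shows "integrable M (\<lambda>\<omega>. ip U (W \<omega>) (W \<omega>))" and "expectation (\<lambda>\<omega>. ip U (W \<omega>) (W \<omega>)) = (\<integral>t. K t t \<partial>U)"
proof -
  have int: "integrable (U \<Otimes>\<^sub>M M) (\<lambda>(t, \<omega>). W \<omega> t * W \<omega> t)"
  proof (rule UM.Fubini_integrable)
    show "AE t in U. integrable M (\<lambda>\<omega>. case (t, \<omega>) of (t, \<omega>) \<Rightarrow> W \<omega> t * W \<omega> t)"
      using W_square_int by (intro AE_I2) (auto intro: square_int_mult)
    have "integrable U (\<lambda>t. K t t)"
      using square_int_continuous[OF K_diag] by (rule U.square_int_imp_integrable)
    then show "integrable U (\<lambda>t. \<integral>\<omega>. norm (case (t, \<omega>) of (t, \<omega>) \<Rightarrow> W \<omega> t * W \<omega> t) \<partial>M)"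
      by (rule Bochner_Integration.integrable_cong[THEN iffD1, rotated -1]) (auto simp: W_cov[symmetric])
  qed measurable
  show "integrable M (\<lambda>\<omega>. ip U (W \<omega>) (W \<omega>))"
    unfolding ip_def using UM.integrable_snd[OF int] by simp
  show "expectation (\<lambda>\<omega>. ip U (W \<omega>) (W \<omega>)) = (\<integral>t. K t t \<partial>U)"
    unfolding ip_def using UM.Fubini_integral[OF int]
    by (auto simp: W_cov intro!: Bochner_Integration.integral_cong)
qed

lemma ip_W_square_int:
  assumes f: "square_int U f" shows "square_int M (\<lambda>\<omega>. ip U (W \<omega>) f)"
proof (rule square_intI)
  note [measurable] = f[THEN square_int_measurable]
  show m [measurable]: "(\<lambda>\<omega>. ip U (W \<omega>) f) \<in> borel_measurable M"
    unfolding ip_def by (rule U.borel_measurable_lebesgue_integral) (use W_measurable in measurable)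
  show "integrable M (\<lambda>\<omega>. (ip U (W \<omega>) f)\<^sup>2)"
  proof (rule Bochner_Integration.integrable_bound)
    show "integrable M (\<lambda>\<omega>. ip U (W \<omega>) (W \<omega>) * ip U f f)"
      using norm_W(1) by (rule integrable_mult_left)
    show "AE \<omega> in M. norm ((ip U (W \<omega>) f)\<^sup>2) \<le> norm (ip U (W \<omega>) (W \<omega>) * ip U f f)"
      using ip_cauchy_schwarz[OF W_path f] by (intro AE_I2) (auto intro: order_trans[OF _ abs_ge_self])
  qed measurable
qed

text \<open>The exchange of integrals behind all mixed moments: V is constant for the mean, a point
  value of W for the operator with kernel K, and another pairing for the bilinear form.\<close>

lemma expectation_times_ip:
  assumes V: "square_int M V" and f: "square_int U f"
  shows "expectation (\<lambda>\<omega>. V \<omega> * ip U (W \<omega>) f) = (\<integral>t. expectation (\<lambda>\<omega>. V \<omega> * W \<omega> t) * f t \<partial>U)"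
proof -
  note [measurable] = f[THEN square_int_measurable] V[THEN square_int_measurable]
  obtain C where C: "0 \<le> C" "\<And>s t. s \<in> {0..1} \<Longrightarrow> t \<in> {0..1} \<Longrightarrow> \<bar>K s t\<bar> \<le> C"
    using K_bounded by blast
  \<comment> \<open>Bounds the expectation of |V W_t| uniformly in t, by 2 |V W_t| \<le> V^2 + W_t^2
    and \<open>K t t\<close> \<le> C.\<close>
  define B where "B = (expectation (\<lambda>\<omega>. (V \<omega>)\<^sup>2) + C) / 2"
  have int: "integrable (U \<Otimes>\<^sub>M M) (\<lambda>(t, \<omega>). V \<omega> * W \<omega> t * f t)"
  proof (rule UM.Fubini_integrable)
    show "AE t in U. integrable M (\<lambda>\<omega>. case (t, \<omega>) of (t, \<omega>) \<Rightarrow> V \<omega> * W \<omega> t * f t)"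
      using W_square_int by (intro AE_I2) (auto intro!: square_int_mult V)
    show "integrable U (\<lambda>t. \<integral>\<omega>. norm (case (t, \<omega>) of (t, \<omega>) \<Rightarrow> V \<omega> * W \<omega> t * f t) \<partial>M)"
    proof (rule Bochner_Integration.integrable_bound)
      show "integrable U (\<lambda>t. B * f t)"
        using f by (intro integrable_mult_right U.square_int_imp_integrable)
      show "(\<lambda>t. \<integral>\<omega>. norm (case (t, \<omega>) of (t, \<omega>) \<Rightarrow> V \<omega> * W \<omega> t * f t) \<partial>M) \<in> borel_measurable U"
        by measurable
      show "AE t in U. norm (\<integral>\<omega>. norm (case (t, \<omega>) of (t, \<omega>) \<Rightarrow> V \<omega> * W \<omega> t * f t) \<partial>M) \<le> norm (B * f t)"
      proof (rule AE_I2)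
        fix t assume "t \<in> space U"
        then have t: "t \<in> {0..1}" by simp
        have "expectation (\<lambda>\<omega>. \<bar>V \<omega> * W \<omega> t\<bar>) \<le> expectation (\<lambda>\<omega>. ((V \<omega>)\<^sup>2 + (W \<omega> t)\<^sup>2) / 2)"
        proof (rule integral_mono)
          show "integrable M (\<lambda>\<omega>. \<bar>V \<omega> * W \<omega> t\<bar>)"
            using square_int_mult[OF V W_square_int[OF t]] by simp
          show "integrable M (\<lambda>\<omega>. ((V \<omega>)\<^sup>2 + (W \<omega> t)\<^sup>2) / 2)"
            using V W_square_int[OF t] by (auto simp: square_int_def)
          show "\<bar>V \<omega> * W \<omega> t\<bar> \<le> ((V \<omega>)\<^sup>2 + (W \<omega> t)\<^sup>2) / 2" for \<omega>
            using sum_squares_bound[of "\<bar>V \<omega>\<bar>" "\<bar>W \<omega> t\<bar>"] by (simp add: abs_mult)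
        qed
        also have "\<dots> = (expectation (\<lambda>\<omega>. (V \<omega>)\<^sup>2) + K t t) / 2"
          using V W_square_int[OF t] W_cov[OF t t] by (simp add: square_int_def power2_eq_square)
        also have "\<dots> \<le> B" using C(2)[OF t t] by (simp add: B_def)
        finally have "expectation (\<lambda>\<omega>. \<bar>V \<omega> * W \<omega> t\<bar>) * \<bar>f t\<bar> \<le> B * \<bar>f t\<bar>" by (intro mult_right_mono) auto
        also have "\<dots> \<le> \<bar>B * f t\<bar>" by (simp add: abs_mult mult_right_mono)
        finally show "norm (\<integral>\<omega>. norm (case (t, \<omega>) of (t, \<omega>) \<Rightarrow> V \<omega> * W \<omega> t * f t) \<partial>M) \<le> norm (B * f t)"
          by (simp add: abs_mult integral_nonneg_AE)
      qed
    qed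
  qed measurable
  have "expectation (\<lambda>\<omega>. V \<omega> * ip U (W \<omega>) f) = expectation (\<lambda>\<omega>. \<integral>t. V \<omega> * W \<omega> t * f t \<partial>U)"
    by (simp add: ip_def mult.assoc)
  also have "\<dots> = (\<integral>t. \<integral>\<omega>. V \<omega> * W \<omega> t * f t \<partial>M \<partial>U)"
    by (rule UM.Fubini_integral[OF int])
  finally show ?thesis by simp
qed

lemma expectation_ip: "square_int U f \<Longrightarrow> expectation (\<lambda>\<omega>. ip U (W \<omega>) f) = 0"
  using expectation_times_ip[of "\<lambda>_. 1" f]
    Bochner_Integration.integral_cong[of U U "\<lambda>t. expectation (\<lambda>\<omega>. W \<omega> t) * f t" "\<lambda>t. 0"]
  by (simp add: square_int_def W_mean)

lemma int_op_eq: "int_op K f s = ip U (K s) f"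
  by (simp add: int_op_def LBINT_eq_U ip_def)

lemma expectation_point_ip:
  "s \<in> {0..1} \<Longrightarrow> square_int U f \<Longrightarrow> expectation (\<lambda>\<omega>. W \<omega> s * ip U (W \<omega>) f) = int_op K f s"
  unfolding int_op_eq ip_def[of U "K s"]
  by (subst expectation_times_ip[OF W_square_int]) (auto simp: W_cov intro!: Bochner_Integration.integral_cong)

lemma expectation_ip_ip:
  assumes "square_int U f" "square_int U g"
  shows "expectation (\<lambda>\<omega>. ip U (W \<omega>) f * ip U (W \<omega>) g) = ip U (int_op K f) g"
proof -
  have "expectation (\<lambda>\<omega>. ip U (W \<omega>) f * W \<omega> t) = int_op K f t" if "t \<in> {0..1}" for t
    using expectation_point_ip[OF that assms(1)] by (simp add: mult.commute)
  then show ?thesis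
    unfolding expectation_times_ip[OF ip_W_square_int[OF assms(1)] assms(2)] ip_def[of U "int_op K f"]
    by (intro Bochner_Integration.integral_cong) auto
qed

lemma int_op_continuous:
  assumes f: "square_int U f" shows "continuous_on {0..1} (int_op K f)"
proof -
  obtain C where C: "0 \<le> C" "\<And>s t. s \<in> {0..1} \<Longrightarrow> t \<in> {0..1} \<Longrightarrow> \<bar>K s t\<bar> \<le> C"
    using K_bounded by blast
  note [measurable] = f[THEN square_int_measurable]
  have "(\<lambda>n. int_op K f (x n)) \<longlonglongrightarrow> int_op K f a"
    if a: "a \<in> {0..1}" and x: "\<forall>n. x n \<in> {0..1}" "x \<longlonglongrightarrow> a" for x a
    unfolding int_op_eq ip_def
  proof (rule integral_dominated_convergence[where w="\<lambda>t. C * \<bar>f t\<bar>"])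
    show "(\<lambda>t. K a t * f t) \<in> borel_measurable U"
      using continuous_measurable_U[OF K_section[OF a]] by measurable
    show "(\<lambda>t. K (x n) t * f t) \<in> borel_measurable U" for n
    proof -
      have [measurable]: "K (x n) \<in> borel_measurable U"
        using x(1) by (intro continuous_measurable_U K_section) auto
      show ?thesis by measurable
    qed
    show "integrable U (\<lambda>t. C * \<bar>f t\<bar>)"
      using U.square_int_imp_integrable[OF f] by auto
    show "AE t in U. (\<lambda>n. K (x n) t * f t) \<longlonglongrightarrow> K a t * f t"
    proof (rule AE_I2)
      fix t assume "t \<in> space U"
      then have t: "t \<in> {0..1}" by simp
      have "(\<lambda>n. (x n, t)) \<longlonglongrightarrow> (a, t)" by (intro tendsto_intros x)
      from continuous_on_tendsto_compose[OF K_continuous this] show "(\<lambda>n. K (x n) t * f t) \<longlonglongrightarrow> K a t * f t"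
        using a t x by (intro tendsto_intros) auto
    qed
    show "AE t in U. norm (K (x n) t * f t) \<le> C * \<bar>f t\<bar>" for n
      using C(2) x(1) by (intro AE_I2) (auto simp: abs_mult intro!: mult_right_mono)
  qed
  then show ?thesis unfolding continuous_on_sequentially by (auto simp: comp_def)
qed

end

section \<open>Mercer expansion of the covariance\<close>

locale spectral_process = process +
  fixes \<phi> :: "nat \<Rightarrow> real \<Rightarrow> real" and lam :: "nat \<Rightarrow> real"
  assumes \<phi>_sq: "\<And>j. sq_int (\<phi> j)"
    and \<phi>_orthonormal: "\<And>i j. ip U (\<phi> i) (\<phi> j) = (if i = j then 1 else 0)"
    and \<phi>_eigen: "\<And>j. AE s in U. int_op K (\<phi> j) s = lam j * \<phi> j s"
    and \<phi>_complement: "\<And>f. sq_int f \<Longrightarrow> (\<And>j. ip U (\<phi> j) f = 0) \<Longrightarrow> AE s in U. int_op K f s = 0"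
begin

lemma \<phi>_square_int: "square_int U (\<phi> j)"
  by (rule sq_int_square_int[OF \<phi>_sq])

lemma \<phi>_measurable [measurable]: "\<phi> j \<in> borel_measurable U"
  using \<phi>_square_int by (rule square_int_measurable)

text \<open>A continuous version of \<open>lam j * \<phi> j\<close>. Eigenfunctions are determined
  only up to null sets, so pointwise expansions are written with \<psi>, and the Mercer term at s
  becomes the square of \<open>\<psi> j s\<close> over \<open>lam j\<close>.\<close>

abbreviation \<psi> :: "nat \<Rightarrow> real \<Rightarrow> real" where "\<psi> j \<equiv> int_op K (\<phi> j)"

text \<open>The unnormalised Karhunen-Loeve coefficients.\<close>

abbreviation \<xi> :: "nat \<Rightarrow> 'a \<Rightarrow> real" where "\<xi> j \<equiv> \<lambda>\<omega>. ip U (W \<omega>) (\<phi> j)"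

lemma \<psi>_continuous: "continuous_on {0..1} (\<psi> j)"
  by (intro int_op_continuous \<phi>_square_int)

lemma \<psi>_square_int: "square_int U (\<psi> j)"
  by (intro square_int_continuous \<psi>_continuous)

lemma ip_\<psi>: "square_int U f \<Longrightarrow> ip U (\<psi> j) f = lam j * ip U (\<phi> j) f"
proof -
  assume f: "square_int U f"
  note [measurable] = square_int_measurable[OF f] square_int_measurable[OF \<psi>_square_int]
  have "ip U (\<psi> j) f = ip U (\<lambda>s. lam j * \<phi> j s) f"
    unfolding ip_def by (rule integral_cong_AE) (use \<phi>_eigen[of j] in auto)
  then show ?thesis by (simp add: ip_cmult_left)
qed

lemma \<xi>_square_int: "square_int M (\<xi> j)"
  by (intro ip_W_square_int \<phi>_square_int)

lemma \<xi>_cov: "expectation (\<lambda>\<omega>. \<xi> i \<omega> * \<xi> j \<omega>) = (if i = j then lam i else 0)"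
  by (simp add: expectation_ip_ip \<phi>_square_int ip_\<psi> \<phi>_orthonormal)

lemma ip_\<xi>: "ip M (\<xi> i) (\<xi> j) = (if i = j then lam i else 0)"
  unfolding ip_def[of M] by (rule \<xi>_cov)

lemma \<xi>_mean: "expectation (\<xi> j) = 0"
  by (intro expectation_ip \<phi>_square_int)

lemma lam_nonneg: "0 \<le> lam j"
  using \<xi>_cov[of j j] integral_nonneg_AE[of "\<lambda>\<omega>. \<xi> j \<omega> * \<xi> j \<omega>" M] by simp

text \<open>A coefficient of variance 0 vanishes almost surely, and so does its covariance with the
  value at s. Thus the convention x / 0 = 0 gives the right value in series with
  \<open>lam j\<close> in the denominator.\<close>

lemma \<psi>_null: assumes "lam j = 0" "s \<in> {0..1}" shows "\<psi> j s = 0"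
proof -
  note [measurable] = square_int_measurable[OF \<xi>_square_int] square_int_measurable[OF W_square_int]
  have "ip M (\<xi> j) (\<xi> j) = 0" using assms by (simp add: ip_\<xi>)
  then have "AE \<omega> in M. \<xi> j \<omega> = 0" using ip_self_eq_0_iff[OF \<xi>_square_int] by simp
  then have "expectation (\<lambda>\<omega>. W \<omega> s * \<xi> j \<omega>) = expectation (\<lambda>\<omega>. 0)"
    using assms by (intro integral_cong_AE) auto
  then show ?thesis using expectation_point_ip[OF assms(2) \<phi>_square_int] by simp
qed

text \<open>The gap between the two sides is the mean square error of predicting the value at s
  linearly from the first J coefficients.\<close>

lemma bessel_diag:
  assumes s: "s \<in> {0..1}" shows "(\<Sum>j<J. (\<psi> j s)\<^sup>2 / lam j) \<le> K s s"
proof -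
  define a where "a j = \<psi> j s / lam j" for j
  define f where "f = (\<lambda>\<omega>. W \<omega> s)"
  define g where "g = (\<lambda>\<omega>. \<Sum>j<J. a j * \<xi> j \<omega>)"
  have f: "square_int M f" unfolding f_def by (rule W_square_int[OF s])
  have g: "square_int M g" unfolding g_def by (intro square_int_lincomb \<xi>_square_int)
  have ipf: "ip M (\<xi> j) f = \<psi> j s" for j
    using expectation_point_ip[OF s \<phi>_square_int] by (simp add: ip_def f_def mult.commute)
  have aj: "a j * \<psi> j s = (\<psi> j s)\<^sup>2 / lam j" for j by (simp add: a_def power2_eq_square)
  have fg: "ip M g f = (\<Sum>j<J. (\<psi> j s)\<^sup>2 / lam j)"
    unfolding g_def by (subst ip_lincomb_left[OF \<xi>_square_int f]) (simp add: ipf aj)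
  have gg: "ip M g g = (\<Sum>j<J. (\<psi> j s)\<^sup>2 / lam j)"
  proof -
    have "ip M (\<xi> j) g = a j * lam j" if "j < J" for j
    proof -
      have "ip M (\<xi> j) g = ip M g (\<xi> j)" by (rule ip_commute)
      also have "\<dots> = (\<Sum>i<J. a i * (if i = j then lam i else 0))"
        unfolding g_def by (subst ip_lincomb_left[OF \<xi>_square_int \<xi>_square_int]) (simp add: ip_\<xi>)
      also have "\<dots> = a j * lam j" using that by (simp add: if_distrib cong: if_cong)
      finally show ?thesis .
    qed
    then have "ip M g g = (\<Sum>j<J. a j * (a j * lam j))"
      by (subst (1) g_def) (subst ip_lincomb_left[OF \<xi>_square_int g], simp)
    also have "\<dots> = (\<Sum>j<J. (\<psi> j s)\<^sup>2 / lam j)"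
      by (rule sum.cong) (auto simp: a_def power2_eq_square)
    finally show ?thesis .
  qed
  have "0 \<le> ip M (\<lambda>\<omega>. f \<omega> - g \<omega>) (\<lambda>\<omega>. f \<omega> - g \<omega>)" by (rule ip_self_nonneg)
  also have "\<dots> = ip M f f - ip M f g - (ip M g f - ip M g g)"
    using f g by (simp add: ip_diff_left ip_diff_right square_int_diff)
  also have "\<dots> = K s s - (\<Sum>j<J. (\<psi> j s)\<^sup>2 / lam j)"
    using W_cov[OF s s] by (simp add: ip_commute[of M f g] fg gg) (simp add: ip_def f_def)
  finally show ?thesis by simp
qed

lemma mercer_summable: "s \<in> {0..1} \<Longrightarrow> summable (\<lambda>j. (\<psi> j s)\<^sup>2 / lam j)"
  using bessel_diag lam_nonneg by (intro summableI_nonneg_bounded) auto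

text \<open>The two points play different roles: at the fixed point s the tails of the series are
  small, while at t its sum is only bounded. Giving \<epsilon> to t makes the convergence uniform in
  t.\<close>

lemma mercer_abs_le:
  assumes \<epsilon>: "\<epsilon> > 0"
  shows "\<bar>\<psi> j s * \<psi> j t / lam j\<bar> \<le> ((\<psi> j s)\<^sup>2 / lam j) / (2 * \<epsilon>) + \<epsilon> / 2 * ((\<psi> j t)\<^sup>2 / lam j)"
proof -
  have "\<bar>x * y\<bar> \<le> x\<^sup>2 / (2 * \<epsilon>) + \<epsilon> / 2 * y\<^sup>2" for x y :: real
  proof -
    have "0 \<le> (\<bar>x\<bar> - \<epsilon> * \<bar>y\<bar>)\<^sup>2" by simp
    then have "2 * \<epsilon> * \<bar>x * y\<bar> \<le> x\<^sup>2 + \<epsilon>\<^sup>2 * y\<^sup>2"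
      by (simp add: power2_diff power_mult_distrib abs_mult mult_ac)
    then show ?thesis using \<epsilon> by (simp add: field_simps power2_eq_square)
  qed
  from divide_right_mono[OF this[of "\<psi> j s" "\<psi> j t"] lam_nonneg[of j]] show ?thesis
    using lam_nonneg[of j] by (simp add: abs_divide add_divide_distrib mult_ac)
qed

text \<open>For fixed s the series defines a continuous g, and f = \<open>K s\<close> - g is
  orthogonal to every eigenfunction. Completeness then gives that the operator annihilates f, so f
  is orthogonal to \<open>K s\<close>; it is orthogonal to g as a limit of combinations of
  eigenfunctions, and hence to itself. Continuity permits evaluation at t = s.\<close>

lemma mercer_diag:
  assumes s: "s \<in> {0..1}" shows "(\<lambda>j. (\<psi> j s)\<^sup>2 / lam j) sums K s s"
proof -
  obtain C where C: "0 \<le> C" "\<And>s t. s \<in> {0..1} \<Longrightarrow> t \<in> {0..1} \<Longrightarrow> \<bar>K s t\<bar> \<le> C"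
    using K_bounded by blast
  define b where "b t j = (\<psi> j t)\<^sup>2 / lam j" for t j
  define x where "x t j = \<psi> j s * \<psi> j t / lam j" for t j
  define g where "g t = (\<Sum>j. x t j)" for t
  have b_nn: "0 \<le> b t j" for t j using lam_nonneg by (simp add: b_def)
  have b_le: "(\<Sum>j<n. b t j) \<le> C" if "t \<in> {0..1}" for t n
    unfolding b_def using bessel_diag[OF that, of n] C(2)[OF that that] by linarith
  have b_sum: "summable (b t)" if "t \<in> {0..1}" for t
    unfolding b_def[abs_def] by (rule mercer_summable[OF that])
  have b_suminf: "(\<Sum>j. b t j) \<le> C" if "t \<in> {0..1}" for t
    using b_le[OF that] b_sum[OF that] by (intro suminf_le_const) auto
  have x_le: "\<bar>x t j\<bar> \<le> b s j / (2 * \<epsilon>) + \<epsilon> / 2 * b t j" if "\<epsilon> > 0" for \<epsilon> t j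
    unfolding x_def b_def using mercer_abs_le[OF that, of j s t] .
  have x_sum: "summable (\<lambda>j. \<bar>x t j\<bar>)" if "t \<in> {0..1}" for t
  proof (rule summable_comparison_test')
    show "summable (\<lambda>j. b s j / (2 * 1) + 1 / 2 * b t j)"
      by (intro summable_add summable_mult summable_divide b_sum that s)
    show "norm \<bar>x t j\<bar> \<le> b s j / (2 * 1) + 1 / 2 * b t j" if "0 \<le> j" for j
      using x_le[of 1 t j] by simp
  qed
  have partial_le: "\<bar>\<Sum>j<n. x t j\<bar> \<le> C" if t: "t \<in> {0..1}" for t n
  proof -
    have "\<bar>\<Sum>j<n. x t j\<bar> \<le> (\<Sum>j<n. b s j / (2 * 1) + 1 / 2 * b t j)"
      by (intro order_trans[OF sum_abs] sum_mono x_le) auto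
    also have "\<dots> = (\<Sum>j<n. b s j) / 2 + (\<Sum>j<n. b t j) / 2"
      by (simp add: sum.distrib sum_divide_distrib)
    finally show ?thesis using b_le[OF s, of n] b_le[OF t, of n] by linarith
  qed
  have unif: "uniform_limit {0..1} (\<lambda>n t. \<Sum>j<n. x t j) g sequentially"
  proof (rule uniform_limitI)
    fix e :: real assume e: "0 < e"
    \<comment> \<open>Using C + 1 keeps the denominator of \<epsilon> positive when C = 0 and leaves
      the contribution of the bounded factor strictly below e / 2.\<close>
    define D where "D = C + 1"
    define \<epsilon> where "\<epsilon> = e / (2 * D)"
    have D: "D > 0" using C(1) by (simp add: D_def)
    have pos: "\<epsilon> > 0" using e D by (simp add: \<epsilon>_def)
    have "\<epsilon> * D = e / 2" using D by (simp add: \<epsilon>_def)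
    then have "\<epsilon> / 2 * C = (e / 2 - \<epsilon>) / 2" by (simp add: D_def distrib_left)
    with e pos have \<epsilon>: "\<epsilon> > 0" "\<epsilon> / 2 * C < e / 2" by simp_all
    have "(\<lambda>n. (\<Sum>j. b s (j + n)) / (2 * \<epsilon>)) \<longlonglongrightarrow> 0 / (2 * \<epsilon>)"
      using \<epsilon> by (intro tendsto_divide tendsto_const suminf_exist_split2[OF b_sum[OF s]]) auto
    then have "\<forall>\<^sub>F n in sequentially. (\<Sum>j. b s (j + n)) / (2 * \<epsilon>) < e / 2"
      using e by (intro order_tendstoD(2)[of _ 0]) auto
    then show "\<forall>\<^sub>F n in sequentially. \<forall>t\<in>{0..1}. dist (\<Sum>j<n. x t j) (g t) < e"
    proof (eventually_elim, safe)
      fix n t assume n: "(\<Sum>j. b s (j + n)) / (2 * \<epsilon>) < e / 2" and t: "t \<in> {0..1::real}"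
      have sx: "summable (\<lambda>j. \<bar>x t (j + n)\<bar>)"
        using x_sum[OF t] by (subst summable_iff_shift)
      have sbs: "summable (\<lambda>j. b s (j + n))" and sbt: "summable (\<lambda>j. b t (j + n))"
        using b_sum[OF s] b_sum[OF t] by (simp_all only: summable_iff_shift)
      have "g t - (\<Sum>j<n. x t j) = (\<Sum>j. x t (j + n))"
        unfolding g_def using suminf_minus_initial_segment[OF summable_rabs_cancel[OF x_sum[OF t]], of n] by simp
      then have "dist (\<Sum>j<n. x t j) (g t) = \<bar>\<Sum>j. x t (j + n)\<bar>"
        by (simp add: dist_real_def abs_minus_commute)
      also have "\<dots> \<le> (\<Sum>j. \<bar>x t (j + n)\<bar>)" by (rule summable_rabs[OF sx])
      also have "\<dots> \<le> (\<Sum>j. b s (j + n) / (2 * \<epsilon>) + \<epsilon> / 2 * b t (j + n))"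
        by (intro suminf_le x_le \<epsilon>(1) sx summable_add summable_mult summable_divide sbs sbt)
      also have "\<dots> = (\<Sum>j. b s (j + n)) / (2 * \<epsilon>) + \<epsilon> / 2 * (\<Sum>j. b t (j + n))"
        by (rule sums_unique[symmetric]) (intro sums_add sums_divide sums_mult summable_sums sbs sbt)
      finally have le: "dist (\<Sum>j<n. x t j) (g t) \<le> (\<Sum>j. b s (j + n)) / (2 * \<epsilon>) + \<epsilon> / 2 * (\<Sum>j. b t (j + n))" .
      have "(\<Sum>j. b t (j + n)) = (\<Sum>j. b t j) - (\<Sum>j<n. b t j)"
        using suminf_minus_initial_segment[OF b_sum[OF t]] .
      also have "\<dots> \<le> C"
        using b_suminf[OF t] sum_nonneg[of "{..<n}" "b t"] b_nn[of t] by auto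
      finally have "\<epsilon> / 2 * (\<Sum>j. b t (j + n)) \<le> \<epsilon> / 2 * C"
        using \<epsilon>(1) by (intro mult_left_mono) auto
      then show "dist (\<Sum>j<n. x t j) (g t) < e"
        using le n \<epsilon>(2) by linarith
    qed
  qed
  have x_cont: "continuous_on {0..1} (\<lambda>t. \<Sum>j<n. x t j)" for n
    unfolding x_def divide_inverse by (intro continuous_intros \<psi>_continuous)
  have g_cont: "continuous_on {0..1} g"
    by (rule uniform_limit_theorem[OF _ unif]) (intro always_eventually allI x_cont, simp)
  define f where "f = (\<lambda>t. if t \<in> {0..1} then K s t - g t else 0)"
  have f: "sq_int f" unfolding f_def by (intro sq_int_continuous continuous_intros K_section s g_cont)
  have f': "square_int U f" by (rule sq_int_square_int[OF f])
  have ip_g: "(\<lambda>n. \<Sum>j<n. \<psi> j s / lam j * (lam j * ip U (\<phi> j) h)) \<longlonglongrightarrow> ip U g h" if h: "square_int U h" for h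
  proof -
    note [measurable] = square_int_measurable[OF h]
    have "(\<lambda>n. ip U (\<lambda>t. \<Sum>j<n. x t j) h) \<longlonglongrightarrow> ip U g h"
      unfolding ip_def
    proof (rule integral_dominated_convergence[where w="\<lambda>t. C * \<bar>h t\<bar>"])
      show "(\<lambda>t. g t * h t) \<in> borel_measurable U"
        using continuous_measurable_U[OF g_cont] by measurable
      show "(\<lambda>t. (\<Sum>j<n. x t j) * h t) \<in> borel_measurable U" for n
        using continuous_measurable_U[OF x_cont] by measurable
      show "integrable U (\<lambda>t. C * \<bar>h t\<bar>)"
        using U.square_int_imp_integrable[OF h] by auto
      show "AE t in U. (\<lambda>n. (\<Sum>j<n. x t j) * h t) \<longlonglongrightarrow> g t * h t"
      proof (rule AE_I2)
        fix t assume "t \<in> space U"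
        then have "(\<lambda>n. \<Sum>j<n. x t j) \<longlonglongrightarrow> g t"
          by (intro tendsto_uniform_limitI[OF unif]) auto
        then show "(\<lambda>n. (\<Sum>j<n. x t j) * h t) \<longlonglongrightarrow> g t * h t" by (intro tendsto_intros)
      qed
      show "AE t in U. norm ((\<Sum>j<n. x t j) * h t) \<le> C * \<bar>h t\<bar>" for n
        using partial_le by (intro AE_I2) (auto simp: abs_mult intro!: mult_right_mono)
    qed
    moreover have "ip U (\<lambda>t. \<Sum>j<n. x t j) h = (\<Sum>j<n. \<psi> j s / lam j * (lam j * ip U (\<phi> j) h))" for n
    proof -
      have "ip U (\<lambda>t. \<Sum>j<n. x t j) h = ip U (\<lambda>t. \<Sum>j<n. (\<psi> j s / lam j) * \<psi> j t) h"
        by (simp add: x_def)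
      also have "\<dots> = (\<Sum>j<n. \<psi> j s / lam j * (lam j * ip U (\<phi> j) h))"
        by (subst ip_lincomb_left[OF \<psi>_square_int h]) (simp only: ip_\<psi>[OF h])
      finally show ?thesis .
    qed
    ultimately show ?thesis by simp
  qed
  have ip_f: "ip U (\<phi> k) f = 0" for k
  proof -
    have "(\<lambda>n. \<Sum>j<n. \<psi> j s / lam j * (lam j * ip U (\<phi> j) (\<phi> k))) \<longlonglongrightarrow> \<psi> k s"
    proof (rule tendsto_eventually, rule eventually_sequentiallyI[of "Suc k"])
      fix n assume "Suc k \<le> n"
      \<comment> \<open>If \<open>lam k = 0\<close>, the quotient is 0 and so is
        \<open>\<psi> k s\<close>, so the term j = k has the stated value in both cases.\<close>
      have "(\<Sum>j<n. \<psi> j s / lam j * (lam j * ip U (\<phi> j) (\<phi> k))) = (\<Sum>j<n. if j = k then \<psi> k s else 0)"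
        using \<psi>_null[OF _ s] by (intro sum.cong) (auto simp: \<phi>_orthonormal)
      also have "\<dots> = \<psi> k s" using \<open>Suc k \<le> n\<close> by simp
      finally show "(\<Sum>j<n. \<psi> j s / lam j * (lam j * ip U (\<phi> j) (\<phi> k))) = \<psi> k s" .
    qed
    then have "ip U g (\<phi> k) = \<psi> k s"
      by (rule LIMSEQ_unique[OF ip_g[OF \<phi>_square_int]])
    moreover have "ip U f (\<phi> k) = ip U (\<lambda>t. K s t - g t) (\<phi> k)"
      by (rule ip_cong) (auto simp: f_def)
    ultimately show ?thesis
      using s by (subst ip_commute) (simp add: ip_diff_left square_int_continuous K_section g_cont \<phi>_square_int int_op_eq)
  qed
  \<comment> \<open>The image of f is continuous, so it vanishes at s itself, and its value there is
    the inner product of \<open>K s\<close> with f.\<close>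
  have "AE t in U. int_op K f t = 0" by (rule \<phi>_complement[OF f ip_f])
  then have "int_op K f s = 0" by (rule continuous_AE_zero[OF int_op_continuous[OF f'] _ s])
  then have "ip U (K s) f = 0" by (simp add: int_op_eq)
  moreover have "ip U g f = 0"
    using ip_g[OF f'] by (simp add: ip_f LIMSEQ_const_iff)
  moreover have "ip U f f = ip U (\<lambda>t. K s t - g t) f"
    by (rule ip_cong) (auto simp: f_def)
  ultimately have "ip U f f = 0"
    using s by (simp add: ip_diff_left square_int_continuous K_section g_cont f')
  then have ae: "AE t in U. f t = 0" using ip_self_eq_0_iff[OF f'] by simp
  have "continuous_on {0..1} f"
    using continuous_on_diff[OF K_section[OF s] g_cont]
    by (rule continuous_on_cong[THEN iffD1, rotated -1]) (auto simp: f_def)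
  from continuous_AE_zero[OF this ae s] have "K s s = g s" using s by (simp add: f_def)
  moreover have "(\<lambda>j. x s j) sums g s"
    unfolding g_def by (intro summable_sums summable_rabs_cancel[OF x_sum[OF s]])
  ultimately show ?thesis by (simp add: x_def power2_eq_square)
qed

text \<open>Mercer's expansion on the diagonal, integrated term by term: the squared norm of
  \<open>\<psi> j\<close> is the square of \<open>lam j\<close>, so each term contributes
  \<open>lam j\<close>, also when that is 0.\<close>

lemma trace_sums: "lam sums (\<integral>t. K t t \<partial>U)"
proof -
  obtain C where C: "0 \<le> C" "\<And>s t. s \<in> {0..1} \<Longrightarrow> t \<in> {0..1} \<Longrightarrow> \<bar>K s t\<bar> \<le> C"
    using K_bounded by blast
  have cont: "continuous_on {0..1} (\<lambda>t. \<Sum>j<n. (\<psi> j t)\<^sup>2 / lam j)" for n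
    unfolding divide_inverse by (intro continuous_intros \<psi>_continuous)
  have "(\<lambda>n. \<integral>t. (\<Sum>j<n. (\<psi> j t)\<^sup>2 / lam j) \<partial>U) \<longlonglongrightarrow> (\<integral>t. K t t \<partial>U)"
  proof (rule integral_dominated_convergence[where w="\<lambda>t. C"])
    show "(\<lambda>t. K t t) \<in> borel_measurable U" by (rule continuous_measurable_U[OF K_diag])
    show "(\<lambda>t. \<Sum>j<n. (\<psi> j t)\<^sup>2 / lam j) \<in> borel_measurable U" for n
      by (rule continuous_measurable_U[OF cont])
    show "AE t in U. (\<lambda>n. \<Sum>j<n. (\<psi> j t)\<^sup>2 / lam j) \<longlonglongrightarrow> K t t"
      using mercer_diag by (intro AE_I2) (auto simp: sums_def)
    show "AE t in U. norm (\<Sum>j<n. (\<psi> j t)\<^sup>2 / lam j) \<le> C" for n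
    proof (rule AE_I2)
      fix t assume "t \<in> space U"
      then have t: "t \<in> {0..1}" by simp
      have "0 \<le> (\<Sum>j<n. (\<psi> j t)\<^sup>2 / lam j)" using lam_nonneg by (intro sum_nonneg) auto
      then show "norm (\<Sum>j<n. (\<psi> j t)\<^sup>2 / lam j) \<le> C"
        using bessel_diag[OF t, of n] C(2)[OF t t] by simp
    qed
  qed simp
  moreover have "(\<integral>t. (\<Sum>j<n. (\<psi> j t)\<^sup>2 / lam j) \<partial>U) = (\<Sum>j<n. lam j)" for n
  proof -
    have "(\<integral>t. (\<psi> j t)\<^sup>2 / lam j \<partial>U) = lam j" for j
    proof -
      have "(\<integral>t. (\<psi> j t)\<^sup>2 / lam j \<partial>U) = ip U (\<psi> j) (\<psi> j) / lam j" by (simp add: ip_self)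
      also have "ip U (\<psi> j) (\<psi> j) = lam j * lam j"
        using ip_commute[of U "\<phi> j" "\<psi> j"] by (simp add: ip_\<psi> \<psi>_square_int \<phi>_square_int \<phi>_orthonormal)
      finally show ?thesis by simp
    qed
    then show ?thesis
      by (subst Bochner_Integration.integral_sum) (auto intro: square_int_integrable[OF \<psi>_square_int])
  qed
  ultimately show ?thesis by (simp add: sums_def)
qed

end

section \<open>Pathwise comparison and a weak law of large numbers\<close>

text \<open>The centred observations and the difference of the sample mean and m depend on the
  \<open>z i\<close> alone, so the Hilbert space comparison applies to their classes. Squared
  residual norms are written as a squared norm minus squared coordinates, ready for
  expectations.\<close>

lemma pathwise_comparison:
  fixes x z \<phi> :: "nat \<Rightarrow> real \<Rightarrow> real" and m :: "real \<Rightarrow> real"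
  assumes z: "\<And>i. i < n \<Longrightarrow> continuous_on {0..1} (z i)" and m: "continuous_on {0..1} m"
    and x: "\<And>i t. i < n \<Longrightarrow> t \<in> {0..1} \<Longrightarrow> x i t = z i t + m t"
    and \<phi>: "\<And>j. square_int U (\<phi> j)"
    and orth: "\<And>j k. ip U (\<phi> j) (\<phi> k) = (if j = k then 1 else 0)"
    and lam: "\<And>j. 0 \<le> lam j" and \<alpha>: "0 < \<alpha>" and n: "0 < n" and \<epsilon>: "0 < \<epsilon>"
  defines "D \<equiv> \<lambda>t. (\<Sum>i<n. z i t) / sqrt (real n)"
  shows "\<bar>real n * (M_hat \<alpha> n x (xbar n x) m)\<^sup>2 - (\<Sum>j<J. lam j / (lam j + \<alpha>)\<^sup>2 * (ip U D (\<phi> j))\<^sup>2)\<bar>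
    \<le> 3 / \<alpha> * ((\<epsilon> * ip U D D + (ip U D D - (\<Sum>j<J. (ip U D (\<phi> j))\<^sup>2)) / \<epsilon>) / 2 + ip U D D / \<alpha> *
        ((\<Sum>j<J. \<Sum>k<J. \<bar>1 / real n * (\<Sum>i<n. ip U (z i) (\<phi> j) * ip U (z i) (\<phi> k)) - (if j = k then lam j else 0)\<bar>
            + 1 / real n * \<bar>ip U D (\<phi> j) * ip U D (\<phi> k)\<bar>)
         + (\<epsilon> * (1 / real n * (\<Sum>i<n. ip U (z i) (z i)))
            + 1 / real n * (\<Sum>i<n. ip U (z i) (z i) - (\<Sum>j<J. (ip U (z i) (\<phi> j))\<^sup>2)) / \<epsilon>) / 2))"
proof -
  define c where "c = (\<lambda>i t. x i t - xbar n x t)"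
  define w where "w = (\<lambda>t. rsv \<alpha> (1 / real n) c n (xbar n x) t - rsv \<alpha> (1 / real n) c n m t)"
  define z' where "z' i = to_l2 (z i)" for i
  define d' where "d' = (1 / real n) *\<^sub>R (\<Sum>i<n. z' i)"
  define dm where "dm = (\<lambda>t. (1 / real n) * (\<Sum>i<n. z i t))"
  have x_cont: "continuous_on {0..1} (x i)" if "i < n" for i
    using continuous_on_add[OF z[OF that] m]
    by (rule continuous_on_cong[THEN iffD1, rotated -1]) (auto simp: x that)
  have xb: "xbar n x t = dm t + m t" if "t \<in> {0..1}" for t
    using n that by (simp add: xbar_def dm_def x sum.distrib distrib_left)
  have xbar_cont: "continuous_on {0..1} (xbar n x)"
    unfolding xbar_def by (intro continuous_intros x_cont) auto
  have M: "M_hat \<alpha> n x (xbar n x) m = sqrt (1 / real n * (\<Sum>i<n. (ip U (c i) w)\<^sup>2))"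
    unfolding w_def c_def by (rule M_hat_eq(1)[OF x_cont n \<alpha> xbar_cont m])
  have w_cont: "continuous_on {0..1} w"
    unfolding w_def c_def by (rule M_hat_eq(2)[OF x_cont n \<alpha> xbar_cont m])
  have w_eq: "1 / real n * (\<Sum>i<n. ip U (c i) w * c i s) + \<alpha> * w s = xbar n x s - m s" if "s \<in> {0..1}" for s
    unfolding w_def c_def by (rule M_hat_eq(3)[OF x_cont n \<alpha> xbar_cont m that])
  have dm_cont: "continuous_on {0..1} dm" unfolding dm_def by (intro continuous_intros z) auto
  have c_eq: "c i t = z i t - dm t" if "i < n" "t \<in> {0..1}" for i t
    using that by (simp add: c_def x xb)
  have zs: "square_int U (z i)" if "i < n" for i by (rule square_int_continuous[OF z[OF that]])
  have dms: "square_int U dm" by (rule square_int_continuous[OF dm_cont])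
  have ws: "square_int U w" by (rule square_int_continuous[OF w_cont])
  have cs: "square_int U (c i)" if "i < n" for i
    unfolding c_def by (intro square_int_continuous continuous_on_diff x_cont xbar_cont that)
  have dm': "to_l2 dm = d'"
    unfolding dm_def d'_def z'_def
    by (subst to_l2_cmult, intro square_int_sum zs, simp) (subst to_l2_sum, auto intro: zs)
  have c': "to_l2 (c i) = z' i - (1 / real n) *\<^sub>R (\<Sum>i<n. z' i)" if "i < n" for i
  proof -
    have "to_l2 (c i) = to_l2 (\<lambda>t. z i t + (-1) * dm t)"
      using that by (intro to_l2_cong cs square_int_add square_int_cmult dms zs AE_I2) (auto simp: c_eq)
    also have "\<dots> = to_l2 (z i) + (-1) *\<^sub>R to_l2 dm"
      using that by (simp only: to_l2_add to_l2_cmult zs dms square_int_cmult)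
    finally show ?thesis by (simp add: dm' z'_def[symmetric] d'_def)
  qed
  have D: "to_l2 D = sqrt (real n) *\<^sub>R d'"
  proof -
    have "D = (\<lambda>t. sqrt (real n) * dm t)"
      using n by (auto simp: D_def dm_def field_simps)
    then show ?thesis by (simp add: to_l2_cmult dms dm')
  qed
  have Ds: "square_int U D"
    unfolding D_def divide_inverse by (intro square_int_continuous continuous_intros z) auto
  have cw: "to_l2 (c i) \<bullet> to_l2 w = ip U (c i) w" if "i < n" for i
    by (intro inner_to_l2 cs ws that)
  have weq: "(1 / real n) *\<^sub>R (\<Sum>i<n. ((z' i - (1 / real n) *\<^sub>R (\<Sum>i<n. z' i)) \<bullet> to_l2 w) *\<^sub>R (z' i - (1 / real n) *\<^sub>R (\<Sum>i<n. z' i)))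
      + \<alpha> *\<^sub>R to_l2 w = d'"
  proof -
    have "d' = to_l2 (\<lambda>s. 1 / real n * (\<Sum>i<n. ip U (c i) w * c i s) + \<alpha> * w s)"
      unfolding dm'[symmetric]
      by (intro to_l2_cong dms square_int_add square_int_cmult square_int_lincomb cs ws AE_I2)
        (auto simp: w_eq[simplified] xb)
    also have "\<dots> = (1 / real n) *\<^sub>R (\<Sum>i<n. ip U (c i) w *\<^sub>R to_l2 (c i)) + \<alpha> *\<^sub>R to_l2 w"
    proof -
      have lin: "square_int U (\<lambda>s. \<Sum>i<n. ip U (c i) w * c i s)" by (intro square_int_lincomb cs) simp
      have "to_l2 (\<lambda>s. \<Sum>i<n. ip U (c i) w * c i s) = (\<Sum>i<n. to_l2 (\<lambda>s. ip U (c i) w * c i s))"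
        by (intro to_l2_sum square_int_cmult cs) simp
      also have "\<dots> = (\<Sum>i<n. ip U (c i) w *\<^sub>R to_l2 (c i))"
        by (intro sum.cong refl to_l2_cmult cs) simp
      finally show ?thesis
        by (simp only: to_l2_add to_l2_cmult lin ws square_int_cmult)
    qed
    also have "(\<Sum>i<n. ip U (c i) w *\<^sub>R to_l2 (c i))
        = (\<Sum>i<n. ((z' i - (1 / real n) *\<^sub>R (\<Sum>i<n. z' i)) \<bullet> to_l2 w) *\<^sub>R (z' i - (1 / real n) *\<^sub>R (\<Sum>i<n. z' i)))"
      by (rule sum.cong) (auto simp: cw[symmetric] c')
    finally show ?thesis by simp
  qed
  have orth': "to_l2 (\<phi> j) \<bullet> to_l2 (\<phi> k) = (if j = k then 1 else 0)" for j k
    by (simp add: inner_to_l2 \<phi> orth)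
  note comparison = centered_comparison[of J "\<lambda>j. to_l2 (\<phi> j)" lam \<alpha> n \<epsilon> "to_l2 D" z' "to_l2 w",
      OF orth' lam \<alpha> n \<epsilon> D[unfolded d'_def] weq[unfolded d'_def]]
  note proj = norm_diff_proj[of J "\<lambda>j. to_l2 (\<phi> j)", OF orth']
  have 1: "(\<Sum>i<n. ((z' i - (1 / real n) *\<^sub>R (\<Sum>i<n. z' i)) \<bullet> to_l2 w)\<^sup>2) = real n * (M_hat \<alpha> n x (xbar n x) m)\<^sup>2"
  proof -
    have "(M_hat \<alpha> n x (xbar n x) m)\<^sup>2 = 1 / real n * (\<Sum>i<n. (ip U (c i) w)\<^sup>2)"
      unfolding M by (simp add: sum_nonneg)
    then show ?thesis using n by (simp add: cw[symmetric] c')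
  qed
  have 2: "to_l2 D \<bullet> to_l2 (\<phi> j) = ip U D (\<phi> j)" for j by (intro inner_to_l2 Ds \<phi>)
  have 3: "(norm (to_l2 D))\<^sup>2 = ip U D D" by (intro norm_to_l2 Ds)
  have 4: "z' i \<bullet> to_l2 (\<phi> j) = ip U (z i) (\<phi> j)" if "i < n" for i j
    unfolding z'_def by (intro inner_to_l2 zs \<phi> that)
  have 5: "(norm (z' i))\<^sup>2 = ip U (z i) (z i)" if "i < n" for i
    unfolding z'_def by (intro norm_to_l2 zs that)
  have 6: "(\<Sum>i<n. (z' i \<bullet> to_l2 (\<phi> j)) * (z' i \<bullet> to_l2 (\<phi> k))) = (\<Sum>i<n. ip U (z i) (\<phi> j) * ip U (z i) (\<phi> k))" for j k
    by (rule sum.cong) (auto simp: 4)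
  have 7: "(\<Sum>i<n. (norm (z' i))\<^sup>2) = (\<Sum>i<n. ip U (z i) (z i))"
    by (rule sum.cong) (auto simp: 5)
  have 8: "(\<Sum>i<n. (norm (z' i))\<^sup>2 - (\<Sum>j<J. (z' i \<bullet> to_l2 (\<phi> j))\<^sup>2))
      = (\<Sum>i<n. ip U (z i) (z i) - (\<Sum>j<J. (ip U (z i) (\<phi> j))\<^sup>2))"
    by (rule sum.cong) (auto simp: 4 5)
  show ?thesis
    using comparison unfolding proj 1 2 6 8 unfolding 3 7 .
qed

section \<open>A weak law in mean under a first moment\<close>

lemma (in prob_space) indep_expectation_mult:
  assumes indep: "indep_vars (\<lambda>_. borel) V UNIV" and V: "\<And>i. integrable M (V i :: 'a \<Rightarrow> real)" and "i \<noteq> k"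
  shows "expectation (\<lambda>\<omega>. V i \<omega> * V k \<omega>) = expectation (V i) * expectation (V k)"
proof -
  have "expectation (\<lambda>\<omega>. \<Prod>l\<in>{i, k}. V l \<omega>) = (\<Prod>l\<in>{i, k}. expectation (V l))"
    by (intro indep_vars_lebesgue_integral indep_vars_subset[OF indep] V) auto
  then show ?thesis using \<open>i \<noteq> k\<close> by simp
qed

lemma ip_add_right:
  "square_int M f \<Longrightarrow> square_int M g \<Longrightarrow> square_int M h \<Longrightarrow> ip M h (\<lambda>x. f x + g x) = ip M h f + ip M h g"
  by (simp add: ip_commute[of M h] ip_add_left)

lemma ip_sum_orthogonal:
  assumes Y: "\<And>i. square_int M (Y i)" and orth: "\<And>i k. i \<noteq> k \<Longrightarrow> ip M (Y i) (Y k) = 0"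
  shows "ip M (\<lambda>\<omega>. \<Sum>i<n. Y i \<omega>) (\<lambda>\<omega>. \<Sum>i<(n::nat). Y i \<omega>) = (\<Sum>i<n. ip M (Y i) (Y i))"
proof (induction n)
  case (Suc n)
  define S where "S = (\<lambda>\<omega>. \<Sum>i<n. Y i \<omega>)"
  have S: "square_int M S" unfolding S_def by (intro square_int_sum Y)
  have 0: "ip M S (Y n) = 0"
  proof -
    have "ip M S (Y n) = ip M (\<lambda>\<omega>. \<Sum>i<n. 1 * Y i \<omega>) (Y n)" by (simp add: S_def)
    also have "\<dots> = (\<Sum>i<n. 1 * ip M (Y i) (Y n))" by (intro ip_lincomb_left Y)
    finally show ?thesis using orth by simp
  qed
  have "ip M (\<lambda>\<omega>. S \<omega> + Y n \<omega>) (\<lambda>\<omega>. S \<omega> + Y n \<omega>) = ip M S S + 2 * ip M S (Y n) + ip M (Y n) (Y n)"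
    using S Y[of n] ip_commute[of M "Y n" S] by (simp add: ip_add_left ip_add_right square_int_add)
  then show ?case using Suc 0 by (simp add: S_def)
qed (simp add: ip_def)

text \<open>The intended V are products of two coefficients, for which no second moment is at hand,
  so V is truncated at R: the bounded part has variance at most R^2 and the remainder has small
  mean. Convergence in mean is the mode needed, because the averages enter a bound on an
  expectation.\<close>

lemma (in prob_space) L1_weak_law:
  fixes V :: "nat \<Rightarrow> 'a \<Rightarrow> real"
  assumes indep: "indep_vars (\<lambda>_. borel) V UNIV" and int: "integrable M (V 0)"
    and law: "\<And>i. distr M borel (V i) = distr M borel (V 0)"
  shows "(\<lambda>n. expectation (\<lambda>\<omega>. \<bar>1 / real n * (\<Sum>i<n. V i \<omega>) - expectation (V 0)\<bar>)) \<longlonglongrightarrow> 0"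
proof -
  define tr where "tr R v = (if \<bar>v\<bar> \<le> R then v else 0)" for R v :: real
  have tr_meas [measurable]: "tr R \<in> borel_measurable borel" for R unfolding tr_def[abs_def] by measurable
  have V_meas [measurable]: "V i \<in> borel_measurable M" for i
    using indep by (simp add: indep_vars_def)
  have transfer: "expectation (\<lambda>\<omega>. h (V i \<omega>)) = expectation (\<lambda>\<omega>. h (V 0 \<omega>))"
    if [measurable]: "h \<in> borel_measurable borel" for h :: "real \<Rightarrow> real" and i
    using integral_distr[OF V_meas[of i] that] integral_distr[OF V_meas[of 0] that] law[of i] by simp
  have V_int: "integrable M (V i)" for i
    using integrable_distr_eq[OF V_meas[of i], of "\<lambda>v. v"] integrable_distr_eq[OF V_meas[of 0], of "\<lambda>v. v"] law[of i] int
    by simp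
  have tr_le: "\<bar>tr R v\<bar> \<le> R" if "0 \<le> R" for R v using that by (simp add: tr_def)
  have tr_sq: "(tr R v)\<^sup>2 \<le> R\<^sup>2" if "0 \<le> R" for R v
    using power_mono[OF tr_le[OF that, of v], of 2] by simp
  have T_int: "integrable M (\<lambda>\<omega>. tr R (V i \<omega>))" if "0 \<le> R" for R i
    using tr_le[OF that] by (intro integrable_const_bound[of _ R]) auto
  define a where "a R = expectation (\<lambda>\<omega>. \<bar>V 0 \<omega> - tr R (V 0 \<omega>)\<bar>)" for R
  have a_lim: "(\<lambda>k. a (real k)) \<longlonglongrightarrow> 0"
  proof -
    have "(\<lambda>k. a (real k)) \<longlonglongrightarrow> expectation (\<lambda>\<omega>. 0)"
      unfolding a_def
    proof (rule integral_dominated_convergence[where w="\<lambda>\<omega>. \<bar>V 0 \<omega>\<bar>"])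
      show "AE \<omega> in M. (\<lambda>k. \<bar>V 0 \<omega> - tr (real k) (V 0 \<omega>)\<bar>) \<longlonglongrightarrow> 0"
      proof (rule AE_I2)
        fix \<omega>
        obtain N where N: "\<bar>V 0 \<omega>\<bar> \<le> real N" using real_arch_simple by blast
        show "(\<lambda>k. \<bar>V 0 \<omega> - tr (real k) (V 0 \<omega>)\<bar>) \<longlonglongrightarrow> 0"
          using N by (intro tendsto_eventually eventually_sequentiallyI[of N]) (auto simp: tr_def)
      qed
      show "AE \<omega> in M. norm \<bar>V 0 \<omega> - tr (real k) (V 0 \<omega>)\<bar> \<le> \<bar>V 0 \<omega>\<bar>" for k
        by (intro AE_I2) (simp add: tr_def)
    qed (use int in auto)
    then show ?thesis by simp
  qed
  \<comment> \<open>The first term bounds the mean deviation of the truncated average;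
    \<open>a R\<close> appears once for truncating the average and once for truncating the
    mean.\<close>
  have bound: "expectation (\<lambda>\<omega>. \<bar>1 / real n * (\<Sum>i<n. V i \<omega>) - expectation (V 0)\<bar>) \<le> R / sqrt (real n) + 2 * a R"
    if R: "0 \<le> R" and n: "n > 0" for R n
  proof -
    define \<mu> where "\<mu> = expectation (\<lambda>\<omega>. tr R (V 0 \<omega>))"
    define Y where "Y i \<omega> = tr R (V i \<omega>) - \<mu>" for i \<omega>
    have Y_meas [measurable]: "Y i \<in> borel_measurable M" for i unfolding Y_def[abs_def] by measurable
    have T_mean: "expectation (\<lambda>\<omega>. tr R (V i \<omega>)) = \<mu>" for i unfolding \<mu>_def by (rule transfer) simp
    have mean_Y: "expectation (Y i) = 0" for i
      unfolding Y_def[abs_def] using T_int[OF R, of i] T_mean[of i] by (simp add: prob_space)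
    have T_sq: "integrable M (\<lambda>\<omega>. (tr R (V i \<omega>))\<^sup>2)" for i
      using tr_sq[OF R] by (intro integrable_const_bound[of _ "R\<^sup>2"]) auto
    have Y_sq: "square_int M (Y i)" for i
      unfolding Y_def[abs_def] using T_sq by (intro square_int_diff square_intI) auto
    have indepY: "indep_vars (\<lambda>_. borel) Y UNIV"
      unfolding Y_def[abs_def]
      using indep_vars_compose2[OF indep, of "\<lambda>i v. tr R v - \<mu>" "\<lambda>_. borel"] by simp
    have Y_orth: "ip M (Y i) (Y k) = 0" if "i \<noteq> k" for i k
      using indep_expectation_mult[OF indepY square_int_imp_integrable[OF Y_sq] that]
      by (simp add: ip_def mean_Y)
    have Y_var: "ip M (Y i) (Y i) \<le> R\<^sup>2" for i
    proof -
      have "ip M (Y i) (Y i) = variance (\<lambda>\<omega>. tr R (V i \<omega>))"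
        by (simp add: ip_self Y_def T_mean)
      also have "\<dots> = expectation (\<lambda>\<omega>. (tr R (V i \<omega>))\<^sup>2) - \<mu>\<^sup>2"
        using T_int[OF R, of i] T_sq[of i] by (subst variance_eq) (auto simp: T_mean)
      also have "\<dots> \<le> expectation (\<lambda>\<omega>. (tr R (V i \<omega>))\<^sup>2)" by simp
      also have "\<dots> \<le> R\<^sup>2"
        using tr_sq[OF R] T_sq[of i] by (intro integral_le_const AE_I2) auto
      finally show ?thesis .
    qed
    define S where "S = (\<lambda>\<omega>. \<Sum>i<n. Y i \<omega>)"
    have S: "square_int M S" unfolding S_def by (intro square_int_sum Y_sq)
    \<comment> \<open>Jensen's inequality, read off from the nonnegative variance of the absolute
      value.\<close>
    have "(expectation (\<lambda>\<omega>. \<bar>S \<omega>\<bar>))\<^sup>2 \<le> ip M S S"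
      using variance_eq[of "\<lambda>\<omega>. \<bar>S \<omega>\<bar>"] variance_positive[of "\<lambda>\<omega>. \<bar>S \<omega>\<bar>"]
        square_int_imp_integrable[OF S] square_int_integrable[OF S] by (simp add: ip_self)
    also have "\<dots> = (\<Sum>i<n. ip M (Y i) (Y i))"
      unfolding S_def by (rule ip_sum_orthogonal[OF Y_sq Y_orth])
    also have "\<dots> \<le> real n * R\<^sup>2"
      using sum_mono[of "{..<n}" "\<lambda>i. ip M (Y i) (Y i)" "\<lambda>_. R\<^sup>2"] Y_var by simp
    also have "\<dots> = (sqrt (real n) * R)\<^sup>2" by (simp add: power_mult_distrib)
    finally have ES: "expectation (\<lambda>\<omega>. \<bar>S \<omega>\<bar>) \<le> sqrt (real n) * R"
      by (rule power2_le_imp_le) (use R in auto)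
    have a_i: "expectation (\<lambda>\<omega>. \<bar>V i \<omega> - tr R (V i \<omega>)\<bar>) = a R" for i
      unfolding a_def by (rule transfer[of "\<lambda>v. \<bar>v - tr R v\<bar>"]) measurable
    have \<mu>_diff: "\<bar>\<mu> - expectation (V 0)\<bar> \<le> a R"
    proof -
      have "\<mu> - expectation (V 0) = expectation (\<lambda>\<omega>. tr R (V 0 \<omega>) - V 0 \<omega>)"
        unfolding \<mu>_def using T_int[OF R] int by simp
      also have "\<bar>\<dots>\<bar> \<le> expectation (\<lambda>\<omega>. \<bar>tr R (V 0 \<omega>) - V 0 \<omega>\<bar>)" by (rule integral_abs_bound)
      finally show ?thesis by (simp add: a_def abs_minus_commute)
    qed
    have pt: "\<bar>1 / real n * (\<Sum>i<n. V i \<omega>) - expectation (V 0)\<bar>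
        \<le> 1 / real n * \<bar>S \<omega>\<bar> + 1 / real n * (\<Sum>i<n. \<bar>V i \<omega> - tr R (V i \<omega>)\<bar>) + a R" for \<omega>
    proof -
      have "(\<Sum>i<n. V i \<omega>) = S \<omega> + (\<Sum>i<n. V i \<omega> - tr R (V i \<omega>)) + real n * \<mu>"
        by (simp add: S_def Y_def sum_subtractf)
      then have "1 / real n * (\<Sum>i<n. V i \<omega>) - expectation (V 0)
        = 1 / real n * S \<omega> + 1 / real n * (\<Sum>i<n. V i \<omega> - tr R (V i \<omega>)) + (\<mu> - expectation (V 0))"
        using n by (simp add: add_divide_distrib)
      also have "\<bar>\<dots>\<bar> \<le> \<bar>1 / real n * S \<omega>\<bar> + \<bar>1 / real n * (\<Sum>i<n. V i \<omega> - tr R (V i \<omega>))\<bar> + \<bar>\<mu> - expectation (V 0)\<bar>"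
        by linarith
      also have "\<dots> \<le> 1 / real n * \<bar>S \<omega>\<bar> + 1 / real n * (\<Sum>i<n. \<bar>V i \<omega> - tr R (V i \<omega>)\<bar>) + a R"
        using \<mu>_diff by (intro add_mono) (auto simp: abs_mult intro!: divide_right_mono sum_abs)
      finally show ?thesis .
    qed
    have "expectation (\<lambda>\<omega>. \<bar>1 / real n * (\<Sum>i<n. V i \<omega>) - expectation (V 0)\<bar>)
      \<le> expectation (\<lambda>\<omega>. 1 / real n * \<bar>S \<omega>\<bar> + 1 / real n * (\<Sum>i<n. \<bar>V i \<omega> - tr R (V i \<omega>)\<bar>) + a R)"
      using V_int T_int[OF R] square_int_imp_integrable[OF S]
      by (intro integral_mono pt integrable_abs Bochner_Integration.integrable_add Bochner_Integration.integrable_diff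
          integrable_mult_right Bochner_Integration.integrable_sum) auto
    also have "\<dots> = 1 / real n * expectation (\<lambda>\<omega>. \<bar>S \<omega>\<bar>) + 1 / real n * (\<Sum>i<n. a R) + a R"
      using V_int T_int[OF R] square_int_imp_integrable[OF S] a_i by (simp add: prob_space)
    also have "\<dots> \<le> 1 / real n * (sqrt (real n) * R) + 1 / real n * (\<Sum>i<n. a R) + a R"
      using ES by (intro add_right_mono mult_left_mono) auto
    also have "\<dots> = R / sqrt (real n) + 2 * a R"
    proof -
      have "1 / real n * (sqrt (real n) * R) = R / sqrt (real n)"
      proof -
        have "1 / real n * (sqrt (real n) * R) = (sqrt (real n) * R) / (sqrt (real n) * sqrt (real n))" by simp
        also have "\<dots> = R / sqrt (real n)" using n by (intro mult_divide_mult_cancel_left) simp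
        finally show ?thesis .
      qed
      then show ?thesis using n by simp
    qed
    finally show ?thesis .
  qed
  show ?thesis
  proof (rule LIMSEQ_I)
    fix e :: real assume e: "0 < e"
    have "\<forall>\<^sub>F k in sequentially. a (real k) < e / 4"
      using a_lim e by (intro order_tendstoD(2)[of _ 0]) auto
    then obtain k where k: "a (real k) < e / 4" by (auto simp: eventually_sequentially)
    have "(\<lambda>n. real k / sqrt (real n)) \<longlonglongrightarrow> 0"
      by (rule real_tendsto_divide_at_top[OF tendsto_const filterlim_compose[OF sqrt_at_top filterlim_real_sequentially]])
    then have "\<forall>\<^sub>F n in sequentially. real k / sqrt (real n) < e / 2"
      using e by (intro order_tendstoD(2)[of _ 0]) auto
    then obtain N where N: "\<And>n. n \<ge> N \<Longrightarrow> real k / sqrt (real n) < e / 2"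
      by (auto simp: eventually_sequentially)
    show "\<exists>N. \<forall>n\<ge>N. norm (expectation (\<lambda>\<omega>. \<bar>1 / real n * (\<Sum>i<n. V i \<omega>) - expectation (V 0)\<bar>) - 0) < e"
    proof (intro exI[of _ "Suc N"] allI impI)
      fix n assume n: "Suc N \<le> n"
      have nn: "0 \<le> expectation (\<lambda>\<omega>. \<bar>1 / real n * (\<Sum>i<n. V i \<omega>) - expectation (V 0)\<bar>)"
        by (intro integral_nonneg_AE) auto
      show "norm (expectation (\<lambda>\<omega>. \<bar>1 / real n * (\<Sum>i<n. V i \<omega>) - expectation (V 0)\<bar>) - 0) < e"
        unfolding diff_0_right real_norm_def abs_of_nonneg[OF nn]
        using bound[of "real k" n] N[of n] k n by linarith
    qed
  qed
qed

section \<open>Laplace transforms and weighted chi-square series\<close>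

text \<open>Laplace transforms at the positive integers are moments of exp (- X), so by the Weierstrass
  approximation theorem on [0,1] their convergence forces weak convergence.\<close>

lemma laplace_imp_weak_conv_sqrt:
  fixes X :: "nat \<Rightarrow> 'a \<Rightarrow> real" and Y :: "'b \<Rightarrow> real"
  assumes M: "prob_space M" and N: "prob_space N"
    and X [measurable]: "\<And>n. X n \<in> borel_measurable M" and Y [measurable]: "Y \<in> borel_measurable N"
    and X_nonneg: "\<And>n. AE \<omega> in M. 0 \<le> X n \<omega>" and Y_nonneg: "AE \<omega> in N. 0 \<le> Y \<omega>"
    and laplace: "\<And>k :: nat. (\<lambda>n. \<integral>\<omega>. exp (- real k * X n \<omega>) \<partial>M) \<longlonglongrightarrow> (\<integral>\<omega>. exp (- real k * Y \<omega>) \<partial>N)"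
  shows "weak_conv_m (\<lambda>n. distr M borel (\<lambda>\<omega>. sqrt (X n \<omega>))) (distr N borel (\<lambda>\<omega>. sqrt (Y \<omega>)))"
proof (rule integral_cts_step_conv_imp_weak_conv)
  interpret M: prob_space M by fact
  interpret N: prob_space N by fact
  show "real_distribution (distr M borel (\<lambda>\<omega>. sqrt (X n \<omega>)))" for n
    by (intro M.real_distribution_distr) measurable
  show "real_distribution (distr N borel (\<lambda>\<omega>. sqrt (Y \<omega>)))"
    by (intro N.real_distribution_distr) measurable
  fix a b :: real assume ab: "a < b"
  have step_cont: "continuous_on S (cts_step a b)" for S
    using uniformly_continuous_imp_continuous[OF cts_step_uniformly_continuous[OF ab]]
    by (rule continuous_on_subset) simp
  have step_meas [measurable]: "cts_step a b \<in> borel_measurable borel"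
    by (intro borel_measurable_continuous_onI step_cont)
  \<comment> \<open>The step function vanishes from B on, so clamping u from below at exp (- B^2)
    changes no value while it removes the singularity of ln at 0. This makes h continuous on the
    closed interval.\<close>
  define B where "B = max b 0"
  define h where "h u = cts_step a b (sqrt (- ln (max u (exp (- B\<^sup>2)))))" for u
  have h_cont: "continuous_on {0..1} h"
    unfolding h_def
    by (intro continuous_on_compose2[OF step_cont[of UNIV]] continuous_intros) (auto simp: max_def)
  have h_exp: "h (exp (- x)) = cts_step a b (sqrt x)" if "0 \<le> x" for x
  proof (cases "x \<le> B\<^sup>2")
    case True
    then have "max (exp (- x)) (exp (- B\<^sup>2)) = exp (- x)" by simp
    then show ?thesis by (simp add: h_def)
  next
    case False
    have "0 \<le> B" by (simp add: B_def)
    then have "B \<le> sqrt x" using False real_le_rsqrt[of B x] by simp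
    then have "cts_step a b (sqrt x) = 0" "cts_step a b B = 0"
      using ab by (auto simp: cts_step_def B_def)
    moreover have "max (exp (- x)) (exp (- B\<^sup>2)) = exp (- B\<^sup>2)" using False by simp
    ultimately show ?thesis using \<open>0 \<le> B\<close> by (simp add: h_def)
  qed
  have h_meas [measurable]: "h \<in> borel_measurable borel" unfolding h_def[abs_def] by measurable
  have X_eq: "integral\<^sup>L (distr M borel (\<lambda>\<omega>. sqrt (X n \<omega>))) (cts_step a b) = M.expectation (\<lambda>\<omega>. h (exp (- X n \<omega>)))" for n
    by (subst integral_distr) (use X_nonneg[of n] h_exp in \<open>auto intro!: integral_cong_AE\<close>)
  have Y_eq: "integral\<^sup>L (distr N borel (\<lambda>\<omega>. sqrt (Y \<omega>))) (cts_step a b) = N.expectation (\<lambda>\<omega>. h (exp (- Y \<omega>)))"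
    by (subst integral_distr) (use Y_nonneg h_exp in \<open>auto intro!: integral_cong_AE\<close>)
  have X_ae: "AE \<omega> in M. exp (- X n \<omega>) \<in> {0..1}" for n using X_nonneg[of n] by eventually_elim simp
  have Y_ae: "AE \<omega> in N. exp (- Y \<omega>) \<in> {0..1}" using Y_nonneg by eventually_elim simp
  have "(\<lambda>n. M.expectation (\<lambda>\<omega>. h (exp (- X n \<omega>)))) \<longlonglongrightarrow> N.expectation (\<lambda>\<omega>. h (exp (- Y \<omega>)))"
  proof (rule LIMSEQ_I)
    fix e :: real assume e: "0 < e"
    then have e3: "0 < e / 3" by simp
    obtain p where p: "real_polynomial_function p" "\<And>u. u \<in> {0..1} \<Longrightarrow> \<bar>h u - p u\<bar> < e / 3"
      using Stone_Weierstrass_real_polynomial_function[OF compact_Icc h_cont e3] by blast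
    obtain c d where pc: "p = (\<lambda>u. \<Sum>i\<le>d. c i * u ^ i)"
      using p(1) unfolding real_polynomial_function_iff_sum by blast
    have p_meas [measurable]: "p \<in> borel_measurable borel" unfolding pc by measurable
    have pow: "(exp (- x)) ^ i = exp (- real i * x)" for x :: real and i
      by (simp add: exp_of_nat_mult[symmetric])
    have X_int: "integrable M (\<lambda>\<omega>. exp (- real i * X n \<omega>))" for i n
      using X_nonneg[of n] by (intro M.integrable_const_bound[of _ 1]) (auto elim!: eventually_mono)
    have Y_int: "integrable N (\<lambda>\<omega>. exp (- real i * Y \<omega>))" for i
      using Y_nonneg by (intro N.integrable_const_bound[of _ 1]) (auto elim!: eventually_mono)
    have pX: "M.expectation (\<lambda>\<omega>. p (exp (- X n \<omega>))) = (\<Sum>i\<le>d. c i * M.expectation (\<lambda>\<omega>. exp (- real i * X n \<omega>)))" for n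
      unfolding pc pow using X_int by (subst Bochner_Integration.integral_sum) auto
    have pY: "N.expectation (\<lambda>\<omega>. p (exp (- Y \<omega>))) = (\<Sum>i\<le>d. c i * N.expectation (\<lambda>\<omega>. exp (- real i * Y \<omega>)))"
      unfolding pc pow using Y_int by (subst Bochner_Integration.integral_sum) auto
    have "(\<lambda>n. M.expectation (\<lambda>\<omega>. p (exp (- X n \<omega>)))) \<longlonglongrightarrow> N.expectation (\<lambda>\<omega>. p (exp (- Y \<omega>)))"
      unfolding pX pY by (intro tendsto_intros laplace)
    then obtain n0 where n0: "\<And>n. n \<ge> n0 \<Longrightarrow>
        \<bar>M.expectation (\<lambda>\<omega>. p (exp (- X n \<omega>))) - N.expectation (\<lambda>\<omega>. p (exp (- Y \<omega>)))\<bar> < e / 3"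
      using LIMSEQ_D[OF _ e3] by (metis real_norm_def)
    have h_bound: "\<bar>h u\<bar> \<le> 1" for u unfolding h_def cts_step_def using ab by (auto simp: field_simps)
    have Xp: "\<bar>M.expectation (\<lambda>\<omega>. h (exp (- X n \<omega>))) - M.expectation (\<lambda>\<omega>. p (exp (- X n \<omega>)))\<bar> \<le> e / 3" for n
    proof -
      have ip: "integrable M (\<lambda>\<omega>. p (exp (- X n \<omega>)))" unfolding pc pow using X_int by auto
      have ih: "integrable M (\<lambda>\<omega>. h (exp (- X n \<omega>)))"
        by (intro M.integrable_const_bound[of _ 1] AE_I2) (auto simp: h_bound)
      have "\<bar>M.expectation (\<lambda>\<omega>. h (exp (- X n \<omega>)) - p (exp (- X n \<omega>)))\<bar> \<le> M.expectation (\<lambda>\<omega>. \<bar>h (exp (- X n \<omega>)) - p (exp (- X n \<omega>))\<bar>)"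
        by (rule integral_abs_bound)
      also have "\<dots> \<le> e / 3"
        using ih ip X_ae[of n] p(2) by (intro M.integral_le_const) (auto elim!: eventually_mono intro: less_imp_le)
      finally show ?thesis using ih ip by simp
    qed
    have Yp: "\<bar>N.expectation (\<lambda>\<omega>. h (exp (- Y \<omega>))) - N.expectation (\<lambda>\<omega>. p (exp (- Y \<omega>)))\<bar> \<le> e / 3"
    proof -
      have ip: "integrable N (\<lambda>\<omega>. p (exp (- Y \<omega>)))" unfolding pc pow using Y_int by auto
      have ih: "integrable N (\<lambda>\<omega>. h (exp (- Y \<omega>)))"
        by (intro N.integrable_const_bound[of _ 1] AE_I2) (auto simp: h_bound)
      have "\<bar>N.expectation (\<lambda>\<omega>. h (exp (- Y \<omega>)) - p (exp (- Y \<omega>)))\<bar> \<le> N.expectation (\<lambda>\<omega>. \<bar>h (exp (- Y \<omega>)) - p (exp (- Y \<omega>))\<bar>)"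
        by (rule integral_abs_bound)
      also have "\<dots> \<le> e / 3"
        using ih ip Y_ae p(2) by (intro N.integral_le_const) (auto elim!: eventually_mono intro: less_imp_le)
      finally show ?thesis using ih ip by simp
    qed
    have "norm (M.expectation (\<lambda>\<omega>. h (exp (- X n \<omega>))) - N.expectation (\<lambda>\<omega>. h (exp (- Y \<omega>)))) < e" if "n \<ge> n0" for n
      using n0[OF that] Xp[of n] Yp unfolding real_norm_def by linarith
    then show "\<exists>n0. \<forall>n\<ge>n0. norm (M.expectation (\<lambda>\<omega>. h (exp (- X n \<omega>))) - N.expectation (\<lambda>\<omega>. h (exp (- Y \<omega>)))) < e"
      by blast
  qed
  then show "(\<lambda>n. integral\<^sup>L (distr M borel (\<lambda>\<omega>. sqrt (X n \<omega>))) (cts_step a b))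
      \<longlonglongrightarrow> integral\<^sup>L (distr N borel (\<lambda>\<omega>. sqrt (Y \<omega>))) (cts_step a b)"
    unfolding X_eq Y_eq .
qed

text \<open>The Gamma integral after the substitution t = c x. It is applied with p = 1/2 for the
  Laplace transform and with p = 3/2 for the mean of a chi-square variable.\<close>

lemma nn_integral_powr_exp:
  fixes p c :: real
  assumes p: "p > 0" and c: "c > 0"
  shows "(\<integral>\<^sup>+x. ennreal (indicator {0<..} x * x powr (p - 1) * exp (- c * x)) \<partial>lborel) = ennreal (Gamma p / c powr p)"
proof -
  let ?f = "\<lambda>t. ennreal (indicator {0..} t * t powr (p - 1) / exp t)"
  let ?g = "\<lambda>x. ennreal (indicator {0<..} x * x powr (p - 1) * exp (- c * x))"
  have "ennreal (Gamma p) = (\<integral>\<^sup>+t. ?f t \<partial>lborel)" by (rule Gamma_conv_nn_integral_real[OF p])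
  also have "\<dots> = ennreal \<bar>c\<bar> * (\<integral>\<^sup>+x. ?f (0 + c * x) \<partial>lborel)"
    using c by (intro nn_integral_real_affine) auto
  also have "(\<lambda>x. ?f (0 + c * x)) = (\<lambda>x. ennreal (c powr (p - 1)) * ?g x)"
  proof
    fix x :: real
    show "?f (0 + c * x) = ennreal (c powr (p - 1)) * ?g x"
    proof (cases "x > 0")
      case True
      then show ?thesis using c
        by (simp add: ennreal_mult'[symmetric] powr_mult exp_minus field_simps zero_le_mult_iff)
    next
      case False
      then show ?thesis using c by (cases "x = 0") (auto simp: indicator_def zero_le_mult_iff)
    qed
  qed
  also have "ennreal \<bar>c\<bar> * (\<integral>\<^sup>+x. ennreal (c powr (p - 1)) * ?g x \<partial>lborel) = ennreal (c powr p) * (\<integral>\<^sup>+x. ?g x \<partial>lborel)"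
    using c by (subst nn_integral_cmult)
      (auto simp: mult.assoc[symmetric] ennreal_mult'[symmetric] powr_diff)
  finally have eq: "ennreal (c powr p) * (\<integral>\<^sup>+x. ?g x \<partial>lborel) = ennreal (Gamma p)" by simp
  have "(\<integral>\<^sup>+x. ?g x \<partial>lborel) = ennreal (1 / c powr p) * (ennreal (c powr p) * (\<integral>\<^sup>+x. ?g x \<partial>lborel))"
    using c by (simp add: mult.assoc[symmetric] ennreal_mult'[symmetric])
  also have "\<dots> = ennreal (Gamma p / c powr p)"
    unfolding eq using c p by (simp add: ennreal_mult'[symmetric])
  finally show ?thesis .
qed

context prob_space
begin

lemma chi2_AE_pos:
  assumes Y: "distributed M lborel Y (\<lambda>x. ennreal (chi2_1_density x))"
  shows "AE \<omega> in M. 0 \<le> Y \<omega>"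
proof -
  have [measurable]: "Y \<in> borel_measurable M" using distributed_measurable[OF Y] by simp
  have "(\<integral>\<^sup>+\<omega>. indicator {..<0} (Y \<omega>) \<partial>M) = (\<integral>\<^sup>+x. ennreal (chi2_1_density x) * indicator {..<0} x \<partial>lborel)"
    by (rule distributed_nn_integral[OF Y, symmetric]) simp
  also have "\<dots> = (\<integral>\<^sup>+x. 0 \<partial>(lborel :: real measure))"
    by (rule nn_integral_cong) (auto simp: chi2_1_density_def indicator_def)
  finally have "(\<integral>\<^sup>+\<omega>. indicator {..<0} (Y \<omega>) \<partial>M) = 0" by simp
  then have "AE \<omega> in M. indicator {..<0} (Y \<omega>) = (0 :: ennreal)"
    by (subst (asm) nn_integral_0_iff_AE) auto
  then show ?thesis by eventually_elim (simp add: indicator_eq_0_iff not_less)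
qed

text \<open>The density times exp (- s x) is a Gamma integrand of shape 1/2 and rate s +
  1/2.\<close>

lemma chi2_laplace:
  assumes Y: "distributed M lborel Y (\<lambda>x. ennreal (chi2_1_density x))" and s: "0 \<le> s"
  shows "expectation (\<lambda>\<omega>. exp (- s * Y \<omega>)) = 1 / sqrt (1 + 2 * s)"
proof -
  have [measurable]: "Y \<in> borel_measurable M" using distributed_measurable[OF Y] by simp
  have eq: "ennreal (chi2_1_density x) * ennreal (exp (- s * x)) =
    ennreal (1 / sqrt (2 * pi)) * ennreal (indicator {0<..} x * x powr (1/2 - 1) * exp (- (s + 1/2) * x))" for x
  proof (cases "x > 0")
    case True
    have "x powr (1/2 - 1) = 1 / sqrt x"
    proof -
      have "x powr (1/2 - 1) = x powr - (1/2)" by simp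
      also have "\<dots> = inverse (x powr (1/2))" by (rule powr_minus)
      finally show ?thesis using True by (simp add: powr_half_sqrt inverse_eq_divide)
    qed
    moreover have "exp (- x / 2) * exp (- s * x) = exp (- (s + 1/2) * x)"
      by (simp add: exp_add[symmetric] field_simps)
    ultimately show ?thesis using True
      by (simp add: chi2_1_density_def ennreal_mult'[symmetric] real_sqrt_mult)
  qed (simp add: chi2_1_density_def)
  have "(\<integral>\<^sup>+\<omega>. ennreal (exp (- s * Y \<omega>)) \<partial>M) = (\<integral>\<^sup>+x. ennreal (chi2_1_density x) * ennreal (exp (- s * x)) \<partial>lborel)"
    by (rule distributed_nn_integral[OF Y, symmetric]) simp
  also have "\<dots> = ennreal (1 / sqrt (2 * pi)) * ennreal (Gamma (1/2) / (s + 1/2) powr (1/2))"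
    unfolding eq using s by (subst nn_integral_cmult, simp) (subst nn_integral_powr_exp, auto)
  also have "\<dots> = ennreal (1 / sqrt (1 + 2 * s))"
  proof -
    have "1 / sqrt (2 * pi) * (Gamma (1/2) / (s + 1/2) powr (1/2)) = 1 / (sqrt 2 * sqrt (s + 1/2))"
      using s by (simp add: Gamma_one_half_real powr_half_sqrt real_sqrt_mult)
    also have "sqrt 2 * sqrt (s + 1/2) = sqrt (1 + 2 * s)"
      unfolding real_sqrt_mult[symmetric] by (simp add: algebra_simps)
    finally show ?thesis by (simp add: ennreal_mult'[symmetric])
  qed
  finally show ?thesis by (subst integral_eq_nn_integral) (use s in auto)
qed

text \<open>The purpose is finiteness: a finite mean makes the weighted chi-square series converge
  almost surely.\<close>

lemma chi2_finite_mean: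
  assumes Y: "distributed M lborel Y (\<lambda>x. ennreal (chi2_1_density x))"
  shows "(\<integral>\<^sup>+\<omega>. ennreal (Y \<omega>) \<partial>M) = ennreal (1 / sqrt (2 * pi)) * ennreal (Gamma (3/2) / (1/2) powr (3/2))"
proof -
  have eq: "ennreal (chi2_1_density x) * ennreal x =
    ennreal (1 / sqrt (2 * pi)) * ennreal (indicator {0<..} x * x powr (3/2 - 1) * exp (- (1/2) * x))" for x
  proof (cases "x > 0")
    case True
    have "exp (- x / 2) / sqrt (2 * pi * x) * x = exp (- x / 2) / sqrt (2 * pi) * (x / sqrt x)"
      by (simp add: real_sqrt_mult)
    also have "x / sqrt x = x powr (3/2 - 1)" using True by (simp add: powr_half_sqrt real_div_sqrt)
    finally have "exp (- x / 2) / sqrt (2 * pi * x) * x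
      = 1 / sqrt (2 * pi) * (x powr (3/2 - 1) * exp (- (1/2) * x))" by (simp add: mult.commute)
    then show ?thesis using True
      by (simp only: chi2_1_density_def ennreal_mult'[symmetric] if_True indicator_simps greaterThan_iff mult_1_left)
        (simp add: ennreal_mult'[symmetric])
  qed (simp add: chi2_1_density_def)
  have "(\<integral>\<^sup>+\<omega>. ennreal (Y \<omega>) \<partial>M) = (\<integral>\<^sup>+x. ennreal (chi2_1_density x) * ennreal x \<partial>lborel)"
    by (rule distributed_nn_integral[OF Y, symmetric]) simp
  also have "\<dots> = ennreal (1 / sqrt (2 * pi)) * ennreal (Gamma (3/2) / (1/2) powr (3/2))"
    unfolding eq by (subst nn_integral_cmult) (simp_all only: nn_integral_powr_exp, simp_all)
  finally show ?thesis .
qed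

text \<open>The expected sum is finite, so the series converges off a null set; there the partial
  sums tend to the value of the infinite sum. Laplace integrands lie between 0 and 1 almost surely,
  which justifies the limit under the expectation.\<close>

lemma chi2_series_laplace:
  fixes Y :: "nat \<Rightarrow> 'a \<Rightarrow> real" and \<mu> :: "nat \<Rightarrow> real"
  assumes indep: "indep_vars (\<lambda>_. borel) Y UNIV"
    and Y: "\<And>j. distributed M lborel (Y j) (\<lambda>x. ennreal (chi2_1_density x))"
    and \<mu>: "\<And>j. 0 \<le> \<mu> j" "summable \<mu>"
  shows "AE \<omega> in M. 0 \<le> (\<Sum>j. \<mu> j * Y j \<omega>)"
    and "0 \<le> s \<Longrightarrow> (\<lambda>J. \<Prod>j<J. 1 / sqrt (1 + 2 * (s * \<mu> j))) \<longlonglongrightarrow> expectation (\<lambda>\<omega>. exp (- s * (\<Sum>j. \<mu> j * Y j \<omega>)))"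
proof -
  have Y_meas [measurable]: "Y j \<in> borel_measurable M" for j using distributed_measurable[OF Y] by simp
  have pos: "AE \<omega> in M. \<forall>j. 0 \<le> Y j \<omega>"
    unfolding AE_all_countable using chi2_AE_pos[OF Y] by blast
  define E where "E = ennreal (1 / sqrt (2 * pi)) * ennreal (Gamma (3/2) / (1/2) powr (3/2))"
  have "(\<integral>\<^sup>+\<omega>. (\<Sum>j. ennreal (\<mu> j) * ennreal (Y j \<omega>)) \<partial>M) = (\<Sum>j. \<integral>\<^sup>+\<omega>. ennreal (\<mu> j) * ennreal (Y j \<omega>) \<partial>M)"
    by (rule nn_integral_suminf) measurable
  also have "\<dots> = (\<Sum>j. ennreal (\<mu> j) * E)"
    by (subst nn_integral_cmult) (auto simp: chi2_finite_mean[OF Y] E_def)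
  also have "\<dots> = (\<Sum>j. ennreal (\<mu> j)) * E" by (rule ennreal_suminf_multc)
  also have "(\<Sum>j. ennreal (\<mu> j)) = ennreal (\<Sum>j. \<mu> j)" using \<mu> by (intro suminf_ennreal2) auto
  also have "ennreal (\<Sum>j. \<mu> j) * E \<noteq> \<infinity>"
    unfolding E_def by (simp add: ennreal_mult_eq_top_iff)
  finally have "AE \<omega> in M. (\<Sum>j. ennreal (\<mu> j) * ennreal (Y j \<omega>)) \<noteq> \<infinity>"
    by (intro nn_integral_PInf_AE) auto
  with pos have summ: "AE \<omega> in M. summable (\<lambda>j. \<mu> j * Y j \<omega>)"
  proof eventually_elim
    case (elim \<omega>)
    then have "(\<Sum>j. ennreal (\<mu> j * Y j \<omega>)) \<noteq> \<infinity>" using \<mu> by (simp add: ennreal_mult')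
    then show ?case using elim \<mu> by (intro summable_suminf_not_top) auto
  qed
  show "AE \<omega> in M. 0 \<le> (\<Sum>j. \<mu> j * Y j \<omega>)"
    using pos summ by eventually_elim (auto intro!: suminf_nonneg mult_nonneg_nonneg \<mu>)
  assume s: "0 \<le> s"
  have "(\<lambda>J. expectation (\<lambda>\<omega>. exp (- s * (\<Sum>j<J. \<mu> j * Y j \<omega>)))) \<longlonglongrightarrow> expectation (\<lambda>\<omega>. exp (- s * (\<Sum>j. \<mu> j * Y j \<omega>)))"
  proof (rule integral_dominated_convergence[where w="\<lambda>_. 1"])
    show "AE \<omega> in M. (\<lambda>J. exp (- s * (\<Sum>j<J. \<mu> j * Y j \<omega>))) \<longlonglongrightarrow> exp (- s * (\<Sum>j. \<mu> j * Y j \<omega>))"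
      using summ by eventually_elim (intro tendsto_intros summable_LIMSEQ)
    show "AE \<omega> in M. norm (exp (- s * (\<Sum>j<J. \<mu> j * Y j \<omega>))) \<le> 1" for J
      using pos by eventually_elim (auto intro!: mult_nonneg_nonneg s sum_nonneg \<mu>)
  qed auto
  moreover have "expectation (\<lambda>\<omega>. exp (- s * (\<Sum>j<J. \<mu> j * Y j \<omega>))) = (\<Prod>j<J. 1 / sqrt (1 + 2 * (s * \<mu> j)))" for J
  proof (cases "J = 0")
    case False
    have i: "indep_vars (\<lambda>_. borel) (\<lambda>j \<omega>. exp (- (s * \<mu> j) * Y j \<omega>)) {..<J}"
      using indep_vars_compose2[OF indep_vars_subset[OF indep], of "{..<J}" "\<lambda>j y. exp (- (s * \<mu> j) * y)" "\<lambda>_. borel"] by simp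
    have int: "integrable M (\<lambda>\<omega>. exp (- (s * \<mu> j) * Y j \<omega>))" for j
      using pos by (intro integrable_const_bound[of _ 1]) (auto elim!: eventually_mono simp: s \<mu>)
    have "expectation (\<lambda>\<omega>. exp (- s * (\<Sum>j<J. \<mu> j * Y j \<omega>))) = expectation (\<lambda>\<omega>. \<Prod>j<J. exp (- (s * \<mu> j) * Y j \<omega>))"
      by (simp add: exp_sum[symmetric] sum_distrib_left mult_ac sum_negf)
    also have "\<dots> = (\<Prod>j<J. expectation (\<lambda>\<omega>. exp (- (s * \<mu> j) * Y j \<omega>)))"
      using False by (intro indep_vars_lebesgue_integral i int) auto
    also have "\<dots> = (\<Prod>j<J. 1 / sqrt (1 + 2 * (s * \<mu> j)))"
      by (intro prod.cong refl chi2_laplace Y mult_nonneg_nonneg s \<mu>)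
    finally show ?thesis .
  qed (simp add: prob_space)
  ultimately show "(\<lambda>J. \<Prod>j<J. 1 / sqrt (1 + 2 * (s * \<mu> j))) \<longlonglongrightarrow> expectation (\<lambda>\<omega>. exp (- s * (\<Sum>j. \<mu> j * Y j \<omega>)))"
    by simp
qed

end

section \<open>Quadratic forms and the central limit theorem\<close>

text \<open>The integrand against Lebesgue measure is \<sigma> times the centred normal density of
  variance 1 / (1 + 2 c), whose mass is 1.\<close>

lemma std_normal_exp_square:
  assumes c: "0 \<le> c"
  shows "(\<integral>g. exp (- c * g\<^sup>2) \<partial>std_normal_distribution) = 1 / sqrt (1 + 2 * c)"
proof -
  define \<sigma> where "\<sigma> = 1 / sqrt (1 + 2 * c)"
  have \<sigma>: "\<sigma> > 0" "\<sigma>\<^sup>2 = 1 / (1 + 2 * c)" using c by (auto simp: \<sigma>_def power_divide)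
  have "std_normal_density g * exp (- c * g\<^sup>2) = \<sigma> * normal_density 0 \<sigma> g" for g
  proof -
    have e: "exp (- g\<^sup>2 / 2) * exp (- c * g\<^sup>2) = exp (- (g - 0)\<^sup>2 / (2 * \<sigma>\<^sup>2))"
      using c unfolding exp_add[symmetric] \<sigma>(2) by (simp add: field_simps)
    have q: "1 / sqrt (2 * pi) = \<sigma> * (1 / sqrt (2 * pi * \<sigma>\<^sup>2))"
      using \<sigma>(1) by (simp add: real_sqrt_mult)
    have "std_normal_density g * exp (- c * g\<^sup>2) = 1 / sqrt (2 * pi) * (exp (- g\<^sup>2 / 2) * exp (- c * g\<^sup>2))"
      by (simp add: std_normal_density_def)
    also have "\<dots> = \<sigma> * normal_density 0 \<sigma> g"
      unfolding e q normal_density_def by (simp only: mult.assoc)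
    finally show ?thesis .
  qed
  then have "(\<integral>g. exp (- c * g\<^sup>2) \<partial>std_normal_distribution) = (\<integral>g. \<sigma> * normal_density 0 \<sigma> g \<partial>lborel)"
    by (subst integral_density) auto
  also have "\<dots> = \<sigma>" using \<sigma>(1) by (simp add: integral_normal_density)
  finally show ?thesis by (simp add: \<sigma>_def)
qed

text \<open>The Hubbard-Stratonovich identity; the frequency is \<open>sqrt (2 * a)\<close> because
  the normal characteristic function halves its square.\<close>

lemma std_normal_iexp:
  assumes "0 \<le> a"
  shows "(CLINT g|std_normal_distribution. iexp (sqrt (2 * a) * g * y)) = exp (- a * y\<^sup>2)"
proof -
  have "(CLINT g|std_normal_distribution. iexp (sqrt (2 * a) * g * y)) = char std_normal_distribution (sqrt (2 * a) * y)"
    unfolding char_def by (simp add: mult_ac)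
  also have "\<dots> = exp (- a * y\<^sup>2)"
    using assms by (simp add: char_std_normal_distribution power_mult_distrib)
  finally show ?thesis .
qed

text \<open>Each factor exp (- a y^2) is a Gaussian average of characters in y, so that the one-dimensional
  central limit theorem for linear combinations suffices to treat quadratic forms.\<close>

lemma (in prob_space) gaussian_linearisation:
  fixes \<eta> :: "nat \<Rightarrow> nat \<Rightarrow> 'a \<Rightarrow> real" and a l :: "nat \<Rightarrow> real"
  assumes \<eta> [measurable]: "\<And>n j. \<eta> n j \<in> borel_measurable M"
    and a: "\<And>j. 0 \<le> a j" and l: "\<And>j. 0 \<le> l j"
    and clt: "\<And>\<theta>. (\<lambda>n. CLINT \<omega>|M. iexp (\<Sum>j<J. \<theta> j * \<eta> n j \<omega>)) \<longlonglongrightarrow> exp (- (\<Sum>j<J. (\<theta> j)\<^sup>2 * l j) / 2)"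
  shows "(\<lambda>n. expectation (\<lambda>\<omega>. exp (- (\<Sum>j<J. a j * (\<eta> n j \<omega>)\<^sup>2)))) \<longlonglongrightarrow> (\<Prod>j<J. 1 / sqrt (1 + 2 * (a j * l j)))"
proof -
  interpret G: prob_space std_normal_distribution
    by (rule real_distribution.axioms(1)[OF real_dist_normal_dist])
  interpret GM: pair_prob_space std_normal_distribution M ..
  define E where "E k n \<omega> = exp (- (\<Sum>j<k. a j * (\<eta> n j \<omega>)\<^sup>2))" for k n \<omega>
  have E_meas [measurable]: "E k n \<in> borel_measurable M" for k n unfolding E_def[abs_def] by measurable
  have E_bound: "0 \<le> E k n \<omega>" "E k n \<omega> \<le> 1" for k n \<omega>
    unfolding E_def by (auto intro!: sum_nonneg mult_nonneg_nonneg a)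
  \<comment> \<open>Intermediate stage of the induction: the coordinates below k already enter
    quadratically, the others still linearly. The frequencies \<theta> stay arbitrary because the
    next step inserts a random one at position k.\<close>
  have main: "(\<lambda>n. CLINT \<omega>|M. iexp (\<Sum>j=k..<J. \<theta> j * \<eta> n j \<omega>) * E k n \<omega>)
      \<longlonglongrightarrow> complex_of_real (exp (- (\<Sum>j=k..<J. (\<theta> j)\<^sup>2 * l j) / 2) * (\<Prod>j<k. 1 / sqrt (1 + 2 * (a j * l j))))"
    if "k \<le> J" for k and \<theta> :: "nat \<Rightarrow> real"
    using that
  proof (induction k arbitrary: \<theta>)
    case 0
    then show ?case using clt[of \<theta>] by (simp add: E_def atLeast0LessThan)
  next
    case (Suc k)
    then have k: "k < J" by simp
    define \<theta>' where "\<theta>' g = \<theta>(k := sqrt (2 * a k) * g)" for g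
    define f where "f n g \<omega> = iexp (\<Sum>j=k..<J. \<theta>' g j * \<eta> n j \<omega>) * E k n \<omega>" for n g \<omega>
    have split: "(\<Sum>j=k..<J. h j) = h k + (\<Sum>j=Suc k..<J. h j)" for h :: "nat \<Rightarrow> real"
      using k by (rule sum.atLeast_Suc_lessThan)
    have rest: "(\<Sum>j=Suc k..<J. h (\<theta>' g j) j) = (\<Sum>j=Suc k..<J. h (\<theta> j) j)" for h :: "real \<Rightarrow> nat \<Rightarrow> real" and g
      by (rule sum.cong) (auto simp: \<theta>'_def)
    have f_eq: "f n g \<omega> = iexp (sqrt (2 * a k) * g * \<eta> n k \<omega>) * (iexp (\<Sum>j=Suc k..<J. \<theta> j * \<eta> n j \<omega>) * E k n \<omega>)" for n g \<omega>
      unfolding f_def split rest[of "\<lambda>x j. x * \<eta> n j \<omega>"]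
      by (simp add: \<theta>'_def distrib_left exp_add mult.assoc)
    have f_meas [measurable]: "(\<lambda>(g, \<omega>). f n g \<omega>) \<in> borel_measurable (std_normal_distribution \<Otimes>\<^sub>M M)" for n
      unfolding f_eq by measurable
    have f_norm: "norm (f n g \<omega>) \<le> 1" for n g \<omega>
      unfolding f_def using E_bound by (simp add: norm_mult)
    have f_int: "integrable (std_normal_distribution \<Otimes>\<^sub>M M) (\<lambda>(g, \<omega>). f n g \<omega>)" for n
      using f_norm by (intro GM.P.integrable_const_bound[of _ 1]) auto
    have swap: "(CLINT \<omega>|M. iexp (\<Sum>j=Suc k..<J. \<theta> j * \<eta> n j \<omega>) * E (Suc k) n \<omega>)
        = (CLINT g|std_normal_distribution. CLINT \<omega>|M. f n g \<omega>)" for n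
    proof -
      have "(CLINT g|std_normal_distribution. f n g \<omega>) = iexp (\<Sum>j=Suc k..<J. \<theta> j * \<eta> n j \<omega>) * E (Suc k) n \<omega>" for \<omega>
      proof -
        have "(CLINT g|std_normal_distribution. f n g \<omega>)
          = complex_of_real (exp (- a k * (\<eta> n k \<omega>)\<^sup>2)) * (iexp (\<Sum>j=Suc k..<J. \<theta> j * \<eta> n j \<omega>) * E k n \<omega>)"
          unfolding f_eq by (subst integral_mult_left_zero) (simp only: std_normal_iexp[OF a])
        moreover have "E (Suc k) n \<omega> = exp (- a k * (\<eta> n k \<omega>)\<^sup>2) * E k n \<omega>"
          unfolding E_def exp_add[symmetric] by (simp add: algebra_simps)
        ultimately show ?thesis by (simp add: mult_ac)
      qed
      then show ?thesis using GM.Fubini_integral[OF f_int[of n]] by simp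
    qed
    define L where "L g = complex_of_real (exp (- (\<Sum>j=k..<J. (\<theta>' g j)\<^sup>2 * l j) / 2) * (\<Prod>j<k. 1 / sqrt (1 + 2 * (a j * l j))))" for g
    define C where "C = exp (- (\<Sum>j=Suc k..<J. (\<theta> j)\<^sup>2 * l j) / 2) * (\<Prod>j<k. 1 / sqrt (1 + 2 * (a j * l j)))"
    have L_eq: "L g = complex_of_real (exp (- (a k * l k) * g\<^sup>2) * C)" for g
    proof -
      have "(\<Sum>j=k..<J. (\<theta>' g j)\<^sup>2 * l j) = 2 * (a k * l k) * g\<^sup>2 + (\<Sum>j=Suc k..<J. (\<theta> j)\<^sup>2 * l j)"
        unfolding split rest[of "\<lambda>x j. x\<^sup>2 * l j"] using a[of k] by (simp add: \<theta>'_def power_mult_distrib)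
      then have "exp (- (\<Sum>j=k..<J. (\<theta>' g j)\<^sup>2 * l j) / 2) = exp (- (a k * l k) * g\<^sup>2) * exp (- (\<Sum>j=Suc k..<J. (\<theta> j)\<^sup>2 * l j) / 2)"
        unfolding exp_add[symmetric] by (simp add: field_simps)
      then show ?thesis by (simp add: L_def C_def)
    qed
    \<comment> \<open>For each fixed g the induction hypothesis applies with frequencies
      \<open>\<theta>' g\<close>; the bound 1 allows integration over g.\<close>
    have "(\<lambda>n. CLINT g|std_normal_distribution. CLINT \<omega>|M. f n g \<omega>) \<longlonglongrightarrow> (CLINT g|std_normal_distribution. L g)"
    proof (rule integral_dominated_convergence[where w="\<lambda>_. 1"])
      show "L \<in> borel_measurable std_normal_distribution" unfolding L_eq[abs_def] by measurable
      show "(\<lambda>g. CLINT \<omega>|M. f n g \<omega>) \<in> borel_measurable std_normal_distribution" for n by measurable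
      show "AE g in std_normal_distribution. (\<lambda>n. CLINT \<omega>|M. f n g \<omega>) \<longlonglongrightarrow> L g"
        unfolding f_def L_def using k by (intro AE_I2 Suc.IH) simp
      show "AE g in std_normal_distribution. norm (CLINT \<omega>|M. f n g \<omega>) \<le> 1" for n
      proof (rule AE_I2)
        fix g
        have "norm (CLINT \<omega>|M. f n g \<omega>) \<le> expectation (\<lambda>\<omega>. norm (f n g \<omega>))" by (rule integral_norm_bound)
        also have "\<dots> \<le> expectation (\<lambda>\<omega>. 1)"
          using f_norm by (intro integral_mono' AE_I2) auto
        finally show "norm (CLINT \<omega>|M. f n g \<omega>) \<le> 1" by (simp add: prob_space)
      qed
    qed auto
    moreover have "(CLINT g|std_normal_distribution. L g)
        = complex_of_real (exp (- (\<Sum>j=Suc k..<J. (\<theta> j)\<^sup>2 * l j) / 2) * (\<Prod>j<Suc k. 1 / sqrt (1 + 2 * (a j * l j))))"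
    proof -
      have "(CLINT g|std_normal_distribution. L g) = complex_of_real (\<integral>g. exp (- (a k * l k) * g\<^sup>2) * C \<partial>std_normal_distribution)"
        unfolding L_eq by (rule integral_complex_of_real)
      also have "(\<integral>g. exp (- (a k * l k) * g\<^sup>2) * C \<partial>std_normal_distribution) = 1 / sqrt (1 + 2 * (a k * l k)) * C"
        using a l by (subst integral_mult_left_zero) (simp only: std_normal_exp_square mult_nonneg_nonneg)
      finally show ?thesis by (simp add: C_def)
    qed
    ultimately show ?case unfolding swap by simp
  qed
  have "(\<lambda>n. CLINT \<omega>|M. complex_of_real (E J n \<omega>)) \<longlonglongrightarrow> complex_of_real (\<Prod>j<J. 1 / sqrt (1 + 2 * (a j * l j)))"
    using main[of J] by simp
  then have "(\<lambda>n. complex_of_real (expectation (E J n))) \<longlonglongrightarrow> complex_of_real (\<Prod>j<J. 1 / sqrt (1 + 2 * (a j * l j)))"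
    by simp
  then show ?thesis unfolding tendsto_of_real_iff E_def .
qed

text \<open>Evaluating the limiting characteristic function at \<sigma> undoes the normalisation.
  Degenerate linear combinations do occur; for variance 0 the sums vanish almost surely and the
  central limit theorem is bypassed.\<close>

lemma (in prob_space) clt_char:
  fixes V :: "nat \<Rightarrow> 'a \<Rightarrow> real"
  assumes indep: "indep_vars (\<lambda>_. borel) V UNIV"
    and mean: "\<And>i. expectation (V i) = 0" and sq: "\<And>i. square_int M (V i)" and var: "\<And>i. ip M (V i) (V i) = v"
    and law: "\<And>i. distr M borel (V i) = distr M borel (V 0)"
  shows "(\<lambda>n. CLINT \<omega>|M. iexp ((\<Sum>i<n. V i \<omega>) / sqrt (real n))) \<longlonglongrightarrow> exp (- v / 2)"
proof (cases "v = 0")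
  case True
  have [measurable]: "V i \<in> borel_measurable M" for i using sq by (rule square_int_measurable)
  have "AE \<omega> in M. V i \<omega> = 0" for i
    using ip_self_eq_0_iff[OF sq[of i]] var[of i] True by simp
  then have "AE \<omega> in M. \<forall>i. V i \<omega> = 0" by (simp add: AE_all_countable)
  then have ae: "AE \<omega> in M. iexp ((\<Sum>i<n. V i \<omega>) / sqrt (real n)) = 1" for n
    by eventually_elim simp
  have "(CLINT \<omega>|M. iexp ((\<Sum>i<n. V i \<omega>) / sqrt (real n))) = (CLINT \<omega>|M. 1)" for n
    using ae[of n] by (intro integral_cong_AE) auto
  then show ?thesis using True by (simp add: prob_space)
next
  case False
  have [measurable]: "V i \<in> borel_measurable M" for i using sq by (rule square_int_measurable)
  have "v > 0" using False var[of 0] ip_self_nonneg[of M "V 0"] by simp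
  define \<sigma> where "\<sigma> = sqrt v"
  have \<sigma>: "\<sigma> > 0" "\<sigma>\<^sup>2 = v" using \<open>v > 0\<close> by (auto simp: \<sigma>_def)
  have "weak_conv_m (\<lambda>n. distr M borel (\<lambda>x. (\<Sum>i<n. V i x) / sqrt (real n * \<sigma>\<^sup>2))) std_normal_distribution"
  proof (rule central_limit_theorem_zero_mean[OF indep mean \<sigma>(1) square_int_integrable[OF sq] _ law])
    show "variance (V n) = \<sigma>\<^sup>2" for n
      using var[of n] by (simp add: mean \<sigma> ip_self)
  qed
  then have "(\<lambda>n. char (distr M borel (\<lambda>x. (\<Sum>i<n. V i x) / sqrt (real n * \<sigma>\<^sup>2))) \<sigma>) \<longlonglongrightarrow> char std_normal_distribution \<sigma>"
    by (intro levy_continuity1 real_distribution_distr real_dist_normal_dist) measurable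
  moreover have "char (distr M borel (\<lambda>x. (\<Sum>i<n. V i x) / sqrt (real n * \<sigma>\<^sup>2))) \<sigma> = (CLINT \<omega>|M. iexp ((\<Sum>i<n. V i \<omega>) / sqrt (real n)))" for n
  proof -
    have "\<sigma> * ((\<Sum>i<n. V i x) / sqrt (real n * \<sigma>\<^sup>2)) = (\<Sum>i<n. V i x) / sqrt (real n)" for x
      using \<sigma>(1) by (simp add: real_sqrt_mult)
    then show ?thesis unfolding char_def by (subst integral_distr) auto
  qed
  ultimately show ?thesis by (simp add: char_std_normal_distribution \<sigma>)
qed

section \<open>Independent samples\<close>

lemma ip_bessel:
  fixes \<phi> :: "nat \<Rightarrow> real \<Rightarrow> real" and J :: nat
  assumes "square_int U f" "\<And>j. square_int U (\<phi> j)" "\<And>j k. ip U (\<phi> j) (\<phi> k) = (if j = k then 1 else 0)"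
  shows "(\<Sum>j<J. (ip U f (\<phi> j))\<^sup>2) \<le> ip U f f"
proof -
  have "to_l2 (\<phi> j) \<bullet> to_l2 (\<phi> k) = (if j = k then 1 else 0)" for j k
    by (simp add: inner_to_l2 assms)
  from bessel[of J "\<lambda>j. to_l2 (\<phi> j)", OF this, of "to_l2 f"] show ?thesis
    by (simp add: inner_to_l2 norm_to_l2 assms)
qed

section \<open>Joint measurability of the explicit solution\<close>

lemma ip_jointly_measurable:
  assumes [measurable]: "(\<lambda>(\<omega>, t). f \<omega> t) \<in> borel_measurable (M \<Otimes>\<^sub>M U)" "(\<lambda>(\<omega>, t). g \<omega> t) \<in> borel_measurable (M \<Otimes>\<^sub>M U)"
  shows "(\<lambda>\<omega>. ip U (f \<omega>) (g \<omega>)) \<in> borel_measurable M"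
  unfolding ip_def by (rule U.borel_measurable_lebesgue_integral) measurable

lemma rsv_jointly_measurable:
  assumes "\<And>i. i < k \<Longrightarrow> (\<lambda>(\<omega>, t). c \<omega> i t) \<in> borel_measurable (M \<Otimes>\<^sub>M U)"
    and "(\<lambda>(\<omega>, t). f \<omega> t) \<in> borel_measurable (M \<Otimes>\<^sub>M U)"
  shows "(\<lambda>(\<omega>, t). rsv \<alpha> \<kappa> (c \<omega>) k (f \<omega>) t) \<in> borel_measurable (M \<Otimes>\<^sub>M U)"
  using assms
proof (induction k arbitrary: f)
  case 0
  have [measurable]: "(\<lambda>(\<omega>, t). f \<omega> t) \<in> borel_measurable (M \<Otimes>\<^sub>M U)" by fact
  show ?case unfolding rsv.simps by measurable
next
  case (Suc k)
  have [measurable]: "(\<lambda>(\<omega>, t). rsv \<alpha> \<kappa> (c \<omega>) k (f \<omega>) t) \<in> borel_measurable (M \<Otimes>\<^sub>M U)"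
    using Suc.prems by (intro Suc.IH) auto
  have [measurable]: "(\<lambda>(\<omega>, t). rsv \<alpha> \<kappa> (c \<omega>) k (c \<omega> k) t) \<in> borel_measurable (M \<Otimes>\<^sub>M U)"
    using Suc.prems by (intro Suc.IH) auto
  have c: "(\<lambda>(\<omega>, t). c \<omega> k t) \<in> borel_measurable (M \<Otimes>\<^sub>M U)" using Suc.prems by auto
  have [measurable]: "(\<lambda>\<omega>. ip U (c \<omega> k) (rsv \<alpha> \<kappa> (c \<omega>) k (f \<omega>))) \<in> borel_measurable M"
    "(\<lambda>\<omega>. ip U (c \<omega> k) (rsv \<alpha> \<kappa> (c \<omega>) k (c \<omega> k))) \<in> borel_measurable M"
    by (intro ip_jointly_measurable c; measurable)+
  show ?case unfolding rsv.simps by measurable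
qed

section \<open>The sample and its rescaled mean\<close>

locale sample = prob_space M for M :: "'a measure" +
  fixes Z :: "nat \<Rightarrow> 'a \<Rightarrow> real \<Rightarrow> real" and K :: "real \<Rightarrow> real \<Rightarrow> real"
  assumes Z_continuous: "\<And>i \<omega>. \<omega> \<in> space M \<Longrightarrow> continuous_on {0..1} (Z i \<omega>)"
    and Z_square_int: "\<And>i t. t \<in> {0..1} \<Longrightarrow> square_int M (\<lambda>\<omega>. Z i \<omega> t)"
    and Z_mean: "\<And>i t. t \<in> {0..1} \<Longrightarrow> expectation (\<lambda>\<omega>. Z i \<omega> t) = 0"
    and Z_cov: "\<And>i s t. s \<in> {0..1} \<Longrightarrow> t \<in> {0..1} \<Longrightarrow> expectation (\<lambda>\<omega>. Z i \<omega> s * Z i \<omega> t) = K s t"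
    and K_continuous: "continuous_on ({0..1} \<times> {0..1}) (\<lambda>(s, t). K s t)"
    and Z_indep: "indep_vars (\<lambda>_. paths) (\<lambda>i \<omega>. restrict (Z i \<omega>) {0..1}) UNIV"
    and Z_law: "\<And>i. distr M paths (\<lambda>\<omega>. restrict (Z i \<omega>) {0..1}) = distr M paths (\<lambda>\<omega>. restrict (Z 0 \<omega>) {0..1})"
begin

lemma Z_path_measurable [measurable]: "(\<lambda>\<omega>. restrict (Z i \<omega>) {0..1}) \<in> measurable M paths"
  using Z_indep by (simp add: indep_vars_def)

lemma Z_measurable: "(\<lambda>(\<omega>, t). Z i \<omega> t) \<in> borel_measurable (M \<Otimes>\<^sub>M U)"
  by (rule measurable_process[OF Z_path_measurable Z_continuous])

lemma process_Z: "process M (Z i) K"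
  by unfold_locales (auto intro: Z_measurable Z_continuous Z_square_int Z_mean Z_cov K_continuous)

lemma functional_indep:
  assumes "\<And>i. G i \<in> borel_measurable paths"
  shows "indep_vars (\<lambda>_. borel) (\<lambda>i \<omega>. G i (restrict (Z i \<omega>) {0..1})) UNIV"
  using indep_vars_compose2[OF Z_indep, of G "\<lambda>_. borel"] assms by simp

lemma functional_law:
  assumes G: "G \<in> borel_measurable paths"
  shows "distr M borel (\<lambda>\<omega>. G (restrict (Z i \<omega>) {0..1})) = distr M borel (\<lambda>\<omega>. G (restrict (Z 0 \<omega>) {0..1}))"
proof -
  have "distr M borel (\<lambda>\<omega>. G (restrict (Z k \<omega>) {0..1})) = distr (distr M paths (\<lambda>\<omega>. restrict (Z k \<omega>) {0..1})) borel G" for k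
    by (subst distr_distr[OF G Z_path_measurable]) (simp add: comp_def)
  then show ?thesis by (simp add: Z_law[of i])
qed

definition scaled :: "nat \<Rightarrow> 'a \<Rightarrow> real \<Rightarrow> real" where
  "scaled n \<omega> t = (\<Sum>i<n. Z i \<omega> t) / sqrt (real n)"

lemma scaled_measurable: "(\<lambda>(\<omega>, t). scaled n \<omega> t) \<in> borel_measurable (M \<Otimes>\<^sub>M U)"
  using Z_measurable unfolding scaled_def split_beta
  by (intro borel_measurable_divide borel_measurable_sum borel_measurable_const) auto

lemma cross_cov:
  assumes s: "s \<in> {0..1}" and t: "t \<in> {0..1}" and ik: "i \<noteq> k"
  shows "expectation (\<lambda>\<omega>. Z i \<omega> s * Z k \<omega> t) = 0"
proof -
  \<comment> \<open>An evaluation point for each index puts both factors into one independent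
    family.\<close>
  define \<tau> where "\<tau> l = (if l = i then s else t)" for l
  have \<tau>: "\<tau> l \<in> {0..1}" for l using s t by (simp add: \<tau>_def)
  have "indep_vars (\<lambda>_. borel) (\<lambda>l \<omega>. (\<lambda>x. x (\<tau> l)) (restrict (Z l \<omega>) {0..1})) UNIV"
    using \<tau> by (intro functional_indep measurable_component_singleton)
  then have "indep_vars (\<lambda>_. borel) (\<lambda>l \<omega>. Z l \<omega> (\<tau> l)) UNIV" using \<tau> by simp
  from indep_expectation_mult[OF this square_int_imp_integrable[OF Z_square_int[OF \<tau>]] ik]
  show ?thesis using ik Z_mean[OF s] by (simp add: \<tau>_def)
qed

text \<open>Mixed terms vanish by independence and the n diagonal ones are divided by n, so the
  rescaled mean has covariance K for every positive n. All moment identities for a process hence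
  hold for it uniformly in n.\<close>

lemma process_scaled:
  assumes n: "0 < n" shows "process M (scaled n) K"
proof unfold_locales
  show "(\<lambda>(\<omega>, t). scaled n \<omega> t) \<in> borel_measurable (M \<Otimes>\<^sub>M U)" by (rule scaled_measurable)
  show "continuous_on ({0..1} \<times> {0..1}) (\<lambda>(s, t). K s t)" by (rule K_continuous)
  show "continuous_on {0..1} (scaled n \<omega>)" if "\<omega> \<in> space M" for \<omega>
    unfolding scaled_def divide_inverse using Z_continuous that by (intro continuous_intros) auto
  have eq: "(\<lambda>\<omega>. scaled n \<omega> t) = (\<lambda>\<omega>. \<Sum>i<n. (1 / sqrt (real n)) * Z i \<omega> t)" for t
    by (simp add: scaled_def sum_divide_distrib)
  show "square_int M (\<lambda>\<omega>. scaled n \<omega> t)" if "t \<in> {0..1}" for t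
    unfolding eq using that by (intro square_int_lincomb Z_square_int)
  show "expectation (\<lambda>\<omega>. scaled n \<omega> t) = 0" if "t \<in> {0..1}" for t
    unfolding eq using square_int_imp_integrable[OF Z_square_int[OF that]] Z_mean[OF that]
    by (subst Bochner_Integration.integral_sum) auto
  show "expectation (\<lambda>\<omega>. scaled n \<omega> s * scaled n \<omega> t) = K s t" if st: "s \<in> {0..1}" "t \<in> {0..1}" for s t
  proof -
    have cov: "expectation (\<lambda>\<omega>. Z i \<omega> s * Z k \<omega> t) = (if i = k then K s t else 0)" for i k
      using cross_cov[OF st, of i k] Z_cov[OF st, of i] by auto
    have int: "integrable M (\<lambda>\<omega>. Z i \<omega> s * Z k \<omega> t)" for i k
      by (intro square_int_mult Z_square_int st)
    have "expectation (\<lambda>\<omega>. scaled n \<omega> s * scaled n \<omega> t) = expectation (\<lambda>\<omega>. \<Sum>i<n. \<Sum>k<n. Z i \<omega> s * Z k \<omega> t / real n)"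
      by (simp add: scaled_def sum_product sum_divide_distrib)
    also have "\<dots> = (\<Sum>i<n. \<Sum>k<n. expectation (\<lambda>\<omega>. Z i \<omega> s * Z k \<omega> t) / real n)"
      using int by (simp add: Bochner_Integration.integral_sum)
    also have "\<dots> = (\<Sum>i<n. \<Sum>k<n. (if i = k then K s t else 0) / real n)" by (simp only: cov)
    also have "\<dots> = K s t" using n by (simp add: if_distrib[of "\<lambda>x. x / real n"] cong: if_cong)
    finally show ?thesis .
  qed
qed

end

locale spectral_sample = sample +
  fixes \<phi> :: "nat \<Rightarrow> real \<Rightarrow> real" and lam :: "nat \<Rightarrow> real"
  assumes \<phi>_sq: "\<And>j. sq_int (\<phi> j)"
    and \<phi>_orthonormal: "\<And>i j. ip U (\<phi> i) (\<phi> j) = (if i = j then 1 else 0)"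
    and \<phi>_eigen: "\<And>j. AE s in U. int_op K (\<phi> j) s = lam j * \<phi> j s"
    and \<phi>_complement: "\<And>f. sq_int f \<Longrightarrow> (\<And>j. ip U (\<phi> j) f = 0) \<Longrightarrow> AE s in U. int_op K f s = 0"
begin

lemma spectral_Z: "spectral_process M (Z i) K \<phi> lam"
  by (intro spectral_process.intro process_Z spectral_process_axioms.intro \<phi>_sq \<phi>_orthonormal \<phi>_eigen \<phi>_complement)

lemma spectral_scaled: "0 < n \<Longrightarrow> spectral_process M (scaled n) K \<phi> lam"
  by (intro spectral_process.intro process_scaled spectral_process_axioms.intro \<phi>_sq \<phi>_orthonormal \<phi>_eigen \<phi>_complement)

lemma lam_nonneg: "0 \<le> lam j"
  by (rule spectral_process.lam_nonneg[OF spectral_Z])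

lemma \<phi>_square_int: "square_int U (\<phi> j)"
  by (rule sq_int_square_int[OF \<phi>_sq])

lemma Z_path: "\<omega> \<in> space M \<Longrightarrow> square_int U (Z i \<omega>)"
  by (intro square_int_continuous Z_continuous)

abbreviation \<xi> :: "nat \<Rightarrow> nat \<Rightarrow> 'a \<Rightarrow> real" where "\<xi> i j \<equiv> \<lambda>\<omega>. ip U (Z i \<omega>) (\<phi> j)"

abbreviation \<eta> :: "nat \<Rightarrow> nat \<Rightarrow> 'a \<Rightarrow> real" where "\<eta> n j \<equiv> \<lambda>\<omega>. ip U (scaled n \<omega>) (\<phi> j)"

lemma \<phi>_jointly_measurable: "(\<lambda>(\<omega>, t). \<phi> j t) \<in> borel_measurable (M \<Otimes>\<^sub>M U)"
  unfolding case_prod_beta'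
  by (rule measurable_compose[OF measurable_snd square_int_measurable[OF \<phi>_square_int]])

lemma \<eta>_measurable [measurable]: "\<eta> n j \<in> borel_measurable M"
  by (intro ip_jointly_measurable scaled_measurable \<phi>_jointly_measurable)

lemma pairing_Z: "\<omega> \<in> space M \<Longrightarrow> pairing (\<phi> j) (restrict (Z i \<omega>) {0..1}) = \<xi> i j \<omega>"
  by (intro pairing_restrict Z_continuous)

lemma pairing_measurable': "pairing (\<phi> j) \<in> borel_measurable paths"
  by (intro pairing_measurable square_int_measurable \<phi>_square_int)

lemma \<eta>_eq: "\<omega> \<in> space M \<Longrightarrow> \<eta> n j \<omega> = (\<Sum>i<n. \<xi> i j \<omega>) / sqrt (real n)"
proof -
  assume \<omega>: "\<omega> \<in> space M"
  have "\<eta> n j \<omega> = ip U (\<lambda>t. \<Sum>i<n. (1 / sqrt (real n)) * Z i \<omega> t) (\<phi> j)"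
    by (rule ip_cong) (auto simp: scaled_def sum_divide_distrib)
  also have "\<dots> = (\<Sum>i<n. (1 / sqrt (real n)) * \<xi> i j \<omega>)"
    using \<omega> by (intro ip_lincomb_left Z_path \<phi>_square_int)
  finally show ?thesis by (simp add: sum_divide_distrib)
qed

text \<open>The combination is a normalised sum of functionals V of single paths, which inherit
  independence and a common law. The variance has no mixed terms because the coefficients of one
  path are uncorrelated.\<close>

lemma clt_linear_combination:
  "(\<lambda>n. CLINT \<omega>|M. iexp (\<Sum>j<J. \<theta> j * \<eta> n j \<omega>)) \<longlonglongrightarrow> exp (- (\<Sum>j<J. (\<theta> j)\<^sup>2 * lam j) / 2)"
proof -
  define G where "G x = (\<Sum>j<J. \<theta> j * pairing (\<phi> j) x)" for x
  define V where "V i \<omega> = G (restrict (Z i \<omega>) {0..1})" for i \<omega>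
  have G: "G \<in> borel_measurable paths"
    unfolding G_def[abs_def] using pairing_measurable'
    by (intro borel_measurable_sum borel_measurable_times borel_measurable_const) auto
  have V: "V i \<omega> = (\<Sum>j<J. \<theta> j * \<xi> i j \<omega>)" if "\<omega> \<in> space M" for i \<omega>
    using that by (simp add: V_def G_def pairing_Z)
  note \<xi>_sq = spectral_process.\<xi>_square_int[OF spectral_Z]
  have sq': "square_int M (\<lambda>\<omega>. \<Sum>j<J. \<theta> j * \<xi> i j \<omega>)" for i
    by (intro square_int_lincomb \<xi>_sq)
  have sq: "square_int M (V i)" for i
    using sq'[of i] V[of _ i] unfolding square_int_def
    by (auto cong: measurable_cong Bochner_Integration.integrable_cong)
  have "expectation (V i) = expectation (\<lambda>\<omega>. \<Sum>j<J. \<theta> j * \<xi> i j \<omega>)" for i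
    by (intro Bochner_Integration.integral_cong V) auto
  also have "\<dots> i = 0" for i
    using square_int_imp_integrable[OF \<xi>_sq] spectral_process.\<xi>_mean[OF spectral_Z]
    by (subst Bochner_Integration.integral_sum) auto
  finally have mean: "expectation (V i) = 0" for i .
  have var: "ip M (V i) (V i) = (\<Sum>j<J. (\<theta> j)\<^sup>2 * lam j)" for i
  proof -
    define S where "S = (\<lambda>\<omega>. \<Sum>j<J. \<theta> j * \<xi> i j \<omega>)"
    have S: "square_int M S" unfolding S_def by (rule sq')
    have \<xi>S: "ip M (\<xi> i j) S = \<theta> j * lam j" if "j < J" for j
    proof -
      have "ip M (\<xi> i j) S = ip M S (\<xi> i j)" by (rule ip_commute)
      also have "\<dots> = (\<Sum>k<J. \<theta> k * ip M (\<xi> i k) (\<xi> i j))"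
        unfolding S_def by (intro ip_lincomb_left \<xi>_sq)
      also have "\<dots> = \<theta> j * lam j"
        using that by (simp add: spectral_process.ip_\<xi>[OF spectral_Z] if_distrib cong: if_cong)
      finally show ?thesis .
    qed
    have "ip M (V i) (V i) = ip M S S" unfolding S_def by (rule ip_cong) (auto simp: V)
    also have "\<dots> = (\<Sum>j<J. \<theta> j * ip M (\<xi> i j) S)"
      by (subst (1) S_def) (intro ip_lincomb_left \<xi>_sq S)
    also have "\<dots> = (\<Sum>j<J. (\<theta> j)\<^sup>2 * lam j)"
      by (rule sum.cong) (auto simp: \<xi>S power2_eq_square)
    finally show ?thesis .
  qed
  have "indep_vars (\<lambda>_. borel) V UNIV"
    unfolding V_def[abs_def] by (intro functional_indep G)
  moreover have "distr M borel (V i) = distr M borel (V 0)" for i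
    unfolding V_def[abs_def] by (intro functional_law G)
  ultimately have "(\<lambda>n. CLINT \<omega>|M. iexp ((\<Sum>i<n. V i \<omega>) / sqrt (real n))) \<longlonglongrightarrow> exp (- (\<Sum>j<J. (\<theta> j)\<^sup>2 * lam j) / 2)"
    by (intro clt_char mean sq var)
  moreover have "(CLINT \<omega>|M. iexp ((\<Sum>i<n. V i \<omega>) / sqrt (real n))) = (CLINT \<omega>|M. iexp (\<Sum>j<J. \<theta> j * \<eta> n j \<omega>))" for n
  proof (rule Bochner_Integration.integral_cong)
    fix \<omega> assume \<omega>: "\<omega> \<in> space M"
    have "(\<Sum>i<n. V i \<omega>) = (\<Sum>j<J. \<theta> j * (\<Sum>i<n. \<xi> i j \<omega>))"
      using \<omega> by (simp add: V sum_distrib_left) (rule sum.swap)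
    then have "(\<Sum>i<n. V i \<omega>) / sqrt (real n) = (\<Sum>j<J. \<theta> j * \<eta> n j \<omega>)"
      using \<omega> by (simp only: \<eta>_eq sum_divide_distrib[of _ "{..<J}"] times_divide_eq_right)
    then show "iexp ((\<Sum>i<n. V i \<omega>) / sqrt (real n)) = iexp (\<Sum>j<J. \<theta> j * \<eta> n j \<omega>)" by simp
  qed simp
  ultimately show ?thesis by simp
qed

lemma empirical_covariance_limit:
  "(\<lambda>n. expectation (\<lambda>\<omega>. \<bar>1 / real n * (\<Sum>i<n. \<xi> i j \<omega> * \<xi> i k \<omega>) - (if j = k then lam j else 0)\<bar>)) \<longlonglongrightarrow> 0"
proof -
  define G where "G x = pairing (\<phi> j) x * pairing (\<phi> k) x" for x
  define V where "V i \<omega> = G (restrict (Z i \<omega>) {0..1})" for i \<omega>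
  have G: "G \<in> borel_measurable paths"
    unfolding G_def[abs_def] by (intro borel_measurable_times pairing_measurable')
  have V: "V i \<omega> = \<xi> i j \<omega> * \<xi> i k \<omega>" if "\<omega> \<in> space M" for i \<omega>
    using that by (simp add: V_def G_def pairing_Z)
  have "integrable M (\<lambda>\<omega>. \<xi> 0 j \<omega> * \<xi> 0 k \<omega>)"
    by (intro square_int_mult spectral_process.\<xi>_square_int[OF spectral_Z])
  then have int: "integrable M (V 0)"
    by (rule Bochner_Integration.integrable_cong[THEN iffD1, rotated -1]) (auto simp: V)
  have mean: "expectation (V 0) = (if j = k then lam j else 0)"
    using spectral_process.\<xi>_cov[OF spectral_Z, of 0 j k]
    by (subst Bochner_Integration.integral_cong[OF refl V]) auto
  have "(\<lambda>n. expectation (\<lambda>\<omega>. \<bar>1 / real n * (\<Sum>i<n. V i \<omega>) - expectation (V 0)\<bar>)) \<longlonglongrightarrow> 0"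
    unfolding V_def[abs_def] by (intro L1_weak_law functional_indep functional_law G int[unfolded V_def[abs_def]])
  moreover have "expectation (\<lambda>\<omega>. \<bar>1 / real n * (\<Sum>i<n. V i \<omega>) - expectation (V 0)\<bar>)
      = expectation (\<lambda>\<omega>. \<bar>1 / real n * (\<Sum>i<n. \<xi> i j \<omega> * \<xi> i k \<omega>) - (if j = k then lam j else 0)\<bar>)" for n
    unfolding mean by (intro Bochner_Integration.integral_cong) (auto simp: V)
  ultimately show ?thesis by simp
qed

section \<open>Truncation errors in expectation\<close>

definition tr :: real where "tr = (\<integral>t. K t t \<partial>U)"

text \<open>The expected squared norm outside the first J eigenfunctions, the same for one
  observation and for the rescaled mean.\<close>

definition tail :: "nat \<Rightarrow> real" where "tail J = tr - (\<Sum>j<J. lam j)"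

lemma tr_nonneg: "0 \<le> tr"
  unfolding tr_def by (intro integral_nonneg_AE AE_I2) (simp add: process.K_diag_nonneg[OF process_Z])

lemma lam_sums: "lam sums tr"
  unfolding tr_def by (rule spectral_process.trace_sums[OF spectral_Z])

lemma tail_tendsto: "tail \<longlonglongrightarrow> 0"
  using tendsto_diff[OF tendsto_const lam_sums[unfolded sums_def], of tr] by (simp add: tail_def[abs_def])

lemma residual_expectation:
  assumes "spectral_process M W K \<phi> lam"
  shows "integrable M (\<lambda>\<omega>. ip U (W \<omega>) (W \<omega>) - (\<Sum>j<J. (ip U (W \<omega>) (\<phi> j))\<^sup>2))"
    and "expectation (\<lambda>\<omega>. ip U (W \<omega>) (W \<omega>) - (\<Sum>j<J. (ip U (W \<omega>) (\<phi> j))\<^sup>2)) = tail J"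
proof -
  interpret W: spectral_process M W K \<phi> lam by fact
  have sq: "integrable M (\<lambda>\<omega>. (ip U (W \<omega>) (\<phi> j))\<^sup>2)" for j
    by (rule square_int_integrable[OF W.\<xi>_square_int])
  have E: "expectation (\<lambda>\<omega>. (ip U (W \<omega>) (\<phi> j))\<^sup>2) = lam j" for j
    using W.\<xi>_cov[of j j] by (simp add: power2_eq_square)
  show "integrable M (\<lambda>\<omega>. ip U (W \<omega>) (W \<omega>) - (\<Sum>j<J. (ip U (W \<omega>) (\<phi> j))\<^sup>2))"
    by (intro Bochner_Integration.integrable_diff Bochner_Integration.integrable_sum sq W.norm_W(1))
  show "expectation (\<lambda>\<omega>. ip U (W \<omega>) (W \<omega>) - (\<Sum>j<J. (ip U (W \<omega>) (\<phi> j))\<^sup>2)) = tail J"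
    using W.norm_W sq E by (simp add: tail_def tr_def)
qed

text \<open>The matrix error of the pathwise bound; the second summand is the price of
  centring.\<close>

definition \<Delta> :: "nat \<Rightarrow> nat \<Rightarrow> 'a \<Rightarrow> real" where
  "\<Delta> J n \<omega> = (\<Sum>j<J. \<Sum>k<J. \<bar>1 / real n * (\<Sum>i<n. \<xi> i j \<omega> * \<xi> i k \<omega>) - (if j = k then lam j else 0)\<bar>
      + 1 / real n * \<bar>\<eta> n j \<omega> * \<eta> n k \<omega>\<bar>)"

lemma \<Delta>_integrable: "0 < n \<Longrightarrow> integrable M (\<Delta> J n)"
  unfolding \<Delta>_def[abs_def]
  by (intro Bochner_Integration.integrable_sum Bochner_Integration.integrable_add integrable_abs
      Bochner_Integration.integrable_diff integrable_mult_right square_int_mult integrable_const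
      spectral_process.\<xi>_square_int[OF spectral_Z] spectral_process.\<xi>_square_int[OF spectral_scaled])

lemma \<Delta>_nonneg: "0 \<le> \<Delta> J n \<omega>"
  unfolding \<Delta>_def by (intro sum_nonneg) auto

text \<open>The first summand is handled by the law of large numbers in mean. The second has
  expectation at most (lam j + lam k) / (2 n), because the coefficients of the rescaled mean keep
  their variances for every n.\<close>

lemma \<Delta>_limit: "(\<lambda>n. expectation (\<Delta> J n)) \<longlonglongrightarrow> 0"
proof -
  define A where "A j k n = expectation (\<lambda>\<omega>. \<bar>1 / real n * (\<Sum>i<n. \<xi> i j \<omega> * \<xi> i k \<omega>) - (if j = k then lam j else 0)\<bar>)" for j k n
  define B where "B n = (\<Sum>j<J. \<Sum>k<J. A j k n + 1 / real n * ((lam j + lam k) / 2))" for n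
  have A: "A j k \<longlonglongrightarrow> 0" for j k unfolding A_def[abs_def] by (rule empirical_covariance_limit)
  have "B \<longlonglongrightarrow> (\<Sum>j<J. \<Sum>k<J. 0 + 0 * ((lam j + lam k) / 2))"
    unfolding B_def[abs_def] by (intro tendsto_intros A lim_1_over_n)
  then have B: "B \<longlonglongrightarrow> 0" by simp
  have le: "expectation (\<Delta> J n) \<le> B n" if n: "0 < n" for n
  proof -
    note iz = square_int_mult[OF spectral_process.\<xi>_square_int[OF spectral_Z] spectral_process.\<xi>_square_int[OF spectral_Z]]
    note isq = spectral_process.\<xi>_square_int[OF spectral_scaled[OF n]]
    have E\<eta>: "expectation (\<lambda>\<omega>. \<bar>\<eta> n j \<omega> * \<eta> n k \<omega>\<bar>) \<le> (lam j + lam k) / 2" for j k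
    proof -
      have "expectation (\<lambda>\<omega>. \<bar>\<eta> n j \<omega> * \<eta> n k \<omega>\<bar>) \<le> expectation (\<lambda>\<omega>. ((\<eta> n j \<omega>)\<^sup>2 + (\<eta> n k \<omega>)\<^sup>2) / 2)"
      proof (rule integral_mono)
        show "\<bar>\<eta> n j \<omega> * \<eta> n k \<omega>\<bar> \<le> ((\<eta> n j \<omega>)\<^sup>2 + (\<eta> n k \<omega>)\<^sup>2) / 2" for \<omega>
          using sum_squares_bound[of "\<bar>\<eta> n j \<omega>\<bar>" "\<bar>\<eta> n k \<omega>\<bar>"] by (simp add: abs_mult)
      qed (use isq in \<open>auto intro!: integrable_abs Bochner_Integration.integrable_divide
          Bochner_Integration.integrable_add square_int_mult square_int_integrable\<close>)
      also have "\<dots> = (lam j + lam k) / 2"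
        using isq spectral_process.\<xi>_cov[OF spectral_scaled[OF n], of j j] spectral_process.\<xi>_cov[OF spectral_scaled[OF n], of k k]
        by (simp add: square_int_integrable power2_eq_square[symmetric])
      finally show ?thesis .
    qed
    have "expectation (\<Delta> J n) = (\<Sum>j<J. \<Sum>k<J. A j k n + 1 / real n * expectation (\<lambda>\<omega>. \<bar>\<eta> n j \<omega> * \<eta> n k \<omega>\<bar>))"
      unfolding \<Delta>_def[abs_def] A_def using iz square_int_mult[OF isq isq]
      by (simp add: Bochner_Integration.integral_sum)
    also have "\<dots> \<le> B n"
      unfolding B_def by (intro sum_mono add_left_mono mult_left_mono E\<eta>) auto
    finally show ?thesis .
  qed
  show ?thesis
  proof (rule tendsto_sandwich[OF _ _ tendsto_const B])
    show "\<forall>\<^sub>F n in sequentially. 0 \<le> expectation (\<Delta> J n)"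
      by (intro always_eventually allI integral_nonneg_AE AE_I2 \<Delta>_nonneg)
    show "\<forall>\<^sub>F n in sequentially. expectation (\<Delta> J n) \<le> B n"
      using le by (intro eventually_sequentiallyI[of 1]) auto
  qed
qed

section \<open>The statistic and its Laplace transform\<close>

context
  fixes Xs :: "nat \<Rightarrow> 'a \<Rightarrow> real \<Rightarrow> real" and m :: "real \<Rightarrow> real" and \<alpha> :: real
  assumes Xs: "\<And>i \<omega> t. \<omega> \<in> space M \<Longrightarrow> t \<in> {0..1} \<Longrightarrow> Xs i \<omega> t = Z i \<omega> t + m t"
    and m_continuous: "continuous_on {0..1} m" and \<alpha>_pos: "0 < \<alpha>"
begin

definition Q :: "nat \<Rightarrow> 'a \<Rightarrow> real" where
  "Q n \<omega> = real n * (M_hat \<alpha> n (\<lambda>i. Xs i \<omega>) (xbar n (\<lambda>i. Xs i \<omega>)) m)\<^sup>2"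

lemma Q_nonneg: "0 \<le> Q n \<omega>"
  by (simp add: Q_def)

lemma Xs_continuous: "\<omega> \<in> space M \<Longrightarrow> continuous_on {0..1} (Xs i \<omega>)"
  using continuous_on_add[OF Z_continuous m_continuous]
  by (rule continuous_on_cong[THEN iffD1, rotated -1]) (auto simp: Xs)

lemma M_hat_path:
  assumes n: "0 < n" and \<omega>: "\<omega> \<in> space M"
  defines "c \<equiv> \<lambda>i t. Xs i \<omega> t - xbar n (\<lambda>i. Xs i \<omega>) t"
  shows "M_hat \<alpha> n (\<lambda>i. Xs i \<omega>) (xbar n (\<lambda>i. Xs i \<omega>)) m = sqrt (1 / real n * (\<Sum>i<n. (ip U (c i)
    (\<lambda>t. rsv \<alpha> (1 / real n) c n (xbar n (\<lambda>i. Xs i \<omega>)) t - rsv \<alpha> (1 / real n) c n m t))\<^sup>2))"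
proof -
  have "continuous_on {0..1} (xbar n (\<lambda>i. Xs i \<omega>))"
    unfolding xbar_def by (intro continuous_intros Xs_continuous \<omega>)
  then show ?thesis
    unfolding c_def by (rule M_hat_eq(1)[OF Xs_continuous[OF \<omega>] n \<alpha>_pos _ m_continuous])
qed

text \<open>\<open>distr\<close> and expectations describe the statistic only once it is known to be
  measurable; the explicit formula reduces this to joint measurability of
  \<open>rsv\<close>.\<close>

lemma M_hat_measurable:
  "(\<lambda>\<omega>. sqrt (real n) * M_hat \<alpha> n (\<lambda>i. Xs i \<omega>) (xbar n (\<lambda>i. Xs i \<omega>)) m) \<in> borel_measurable M"
proof (cases "n = 0")
  case False
  then have n: "0 < n" by simp
  have m [measurable]: "(\<lambda>(\<omega>, t). m t) \<in> borel_measurable (M \<Otimes>\<^sub>M U)"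
    unfolding case_prod_beta'
    by (rule measurable_compose[OF measurable_snd continuous_measurable_U[OF m_continuous]])
  have X [measurable]: "(\<lambda>(\<omega>, t). Xs i \<omega> t) \<in> borel_measurable (M \<Otimes>\<^sub>M U)" for i
  proof -
    have "(\<lambda>p. Z i (fst p) (snd p) + m (snd p)) \<in> borel_measurable (M \<Otimes>\<^sub>M U)"
      using Z_measurable[of i] m unfolding case_prod_beta' by (rule borel_measurable_add)
    then show ?thesis
      unfolding case_prod_beta'
      by (rule measurable_cong[THEN iffD1, rotated]) (auto simp: space_pair_measure Xs)
  qed
  define c where "c \<omega> i t = Xs i \<omega> t - xbar n (\<lambda>i. Xs i \<omega>) t" for \<omega> i t
  define w where "w \<omega> t = rsv \<alpha> (1 / real n) (c \<omega>) n (xbar n (\<lambda>i. Xs i \<omega>)) t - rsv \<alpha> (1 / real n) (c \<omega>) n m t" for \<omega> t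
  have xb [measurable]: "(\<lambda>(\<omega>, t). xbar n (\<lambda>i. Xs i \<omega>) t) \<in> borel_measurable (M \<Otimes>\<^sub>M U)"
    unfolding xbar_def by measurable
  have c [measurable]: "(\<lambda>(\<omega>, t). c \<omega> i t) \<in> borel_measurable (M \<Otimes>\<^sub>M U)" for i
    unfolding c_def by measurable
  have [measurable]: "(\<lambda>(\<omega>, t). rsv \<alpha> (1 / real n) (c \<omega>) n (xbar n (\<lambda>i. Xs i \<omega>)) t) \<in> borel_measurable (M \<Otimes>\<^sub>M U)"
    by (intro rsv_jointly_measurable c xb)
  have [measurable]: "(\<lambda>(\<omega>, t). rsv \<alpha> (1 / real n) (c \<omega>) n m t) \<in> borel_measurable (M \<Otimes>\<^sub>M U)"
    by (intro rsv_jointly_measurable c m)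
  have w: "(\<lambda>(\<omega>, t). w \<omega> t) \<in> borel_measurable (M \<Otimes>\<^sub>M U)" unfolding w_def by measurable
  have [measurable]: "(\<lambda>\<omega>. ip U (c \<omega> i) (w \<omega>)) \<in> borel_measurable M" for i
    by (intro ip_jointly_measurable c w)
  have "(\<lambda>\<omega>. sqrt (real n) * sqrt (1 / real n * (\<Sum>i<n. (ip U (c \<omega> i) (w \<omega>))\<^sup>2))) \<in> borel_measurable M"
    by measurable
  then show ?thesis
    by (rule measurable_cong[THEN iffD1, rotated]) (simp add: M_hat_path[OF n] c_def[abs_def] w_def[abs_def])
qed simp

lemma Q_eq: "Q n \<omega> = (sqrt (real n) * M_hat \<alpha> n (\<lambda>i. Xs i \<omega>) (xbar n (\<lambda>i. Xs i \<omega>)) m)\<^sup>2"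
  by (simp add: Q_def power_mult_distrib)

lemma Q_measurable [measurable]: "Q n \<in> borel_measurable M"
  unfolding Q_eq[abs_def] by (intro borel_measurable_power M_hat_measurable)

lemma sqrt_Q:
  assumes "\<omega> \<in> space M"
  shows "sqrt (Q n \<omega>) = sqrt (real n) * M_hat \<alpha> n (\<lambda>i. Xs i \<omega>) (xbar n (\<lambda>i. Xs i \<omega>)) m"
proof (cases "n = 0")
  case False
  then have "0 \<le> M_hat \<alpha> n (\<lambda>i. Xs i \<omega>) (xbar n (\<lambda>i. Xs i \<omega>)) m"
    using assms by (subst M_hat_path) (auto intro!: real_sqrt_ge_zero divide_nonneg_nonneg sum_nonneg)
  then show ?thesis unfolding Q_eq by simp
qed (simp add: Q_def)

definition S :: "nat \<Rightarrow> nat \<Rightarrow> 'a \<Rightarrow> real" where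
  "S J n \<omega> = (\<Sum>j<J. lam j / (lam j + \<alpha>)\<^sup>2 * (\<eta> n j \<omega>)\<^sup>2)"

lemma S_nonneg: "0 \<le> S J n \<omega>"
  unfolding S_def using lam_nonneg by (intro sum_nonneg mult_nonneg_nonneg divide_nonneg_nonneg) auto

lemma S_measurable [measurable]: "S J n \<in> borel_measurable M"
  unfolding S_def[abs_def] by measurable

text \<open>In the pathwise bound the squared norm \<open>nD\<close> still multiplies other random
  terms. Where it exceeds R, the exponentials differ by at most 1, which is at most
  \<open>nD / R\<close>, a pointwise Markov inequality; elsewhere it is replaced by R. The resulting
  F is linear in variables of computable expectation.\<close>

lemma laplace_comparison:
  assumes n: "0 < n" and \<epsilon>: "0 < \<epsilon>" and R: "0 < R" and s: "0 \<le> s"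
  shows "\<bar>expectation (\<lambda>\<omega>. exp (- s * Q n \<omega>)) - expectation (\<lambda>\<omega>. exp (- s * S J n \<omega>))\<bar>
    \<le> tr / R + s * (3 / \<alpha>) * ((\<epsilon> * tr + tail J / \<epsilon>) / 2 + R / \<alpha> * (expectation (\<Delta> J n) + (\<epsilon> * tr + tail J / \<epsilon>) / 2))"
proof -
  define nD where "nD \<omega> = ip U (scaled n \<omega>) (scaled n \<omega>)" for \<omega>
  define tD where "tD \<omega> = ip U (scaled n \<omega>) (scaled n \<omega>) - (\<Sum>j<J. (\<eta> n j \<omega>)\<^sup>2)" for \<omega>
  define \<tau> where "\<tau> \<omega> = 1 / real n * (\<Sum>i<n. ip U (Z i \<omega>) (Z i \<omega>))" for \<omega>
  define \<rho> where "\<rho> \<omega> = 1 / real n * (\<Sum>i<n. ip U (Z i \<omega>) (Z i \<omega>) - (\<Sum>j<J. (\<xi> i j \<omega>)\<^sup>2))" for \<omega>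
  define F where "F \<omega> = nD \<omega> / R + s * (3 / \<alpha>) * ((\<epsilon> * nD \<omega> + tD \<omega> / \<epsilon>) / 2 + R / \<alpha> * (\<Delta> J n \<omega> + (\<epsilon> * \<tau> \<omega> + \<rho> \<omega> / \<epsilon>) / 2))" for \<omega>
  note PZ = process.norm_W[OF process_Z, folded tr_def]
  note PD = process.norm_W[OF process_scaled[OF n], folded tr_def]
  note RZ = residual_expectation[OF spectral_Z]
  note RD = residual_expectation[OF spectral_scaled[OF n]]
  have nD: "integrable M nD" "expectation nD = tr"
    unfolding nD_def[abs_def] by (rule PD)+
  have tD: "integrable M tD" "expectation tD = tail J"
    unfolding tD_def[abs_def] by (rule RD)+
  have \<tau>: "integrable M \<tau>" "expectation \<tau> = tr"
    unfolding \<tau>_def[abs_def] using PZ n by (simp_all add: Bochner_Integration.integral_sum)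
  have \<rho>: "integrable M \<rho>" "expectation \<rho> = tail J"
  proof -
    show "integrable M \<rho>"
      unfolding \<rho>_def[abs_def] by (intro integrable_mult_right Bochner_Integration.integrable_sum RZ)
    have "expectation \<rho> = 1 / real n * (\<Sum>i<n. tail J)"
      unfolding \<rho>_def[abs_def]
      by (subst integral_mult_right_zero, subst Bochner_Integration.integral_sum, rule RZ, simp only: RZ)
    then show "expectation \<rho> = tail J" using n by simp
  qed
  note \<Delta> = \<Delta>_integrable[OF n, of J]
  have F_int: "integrable M F"
    unfolding F_def[abs_def]
    by (intro Bochner_Integration.integrable_add integrable_mult_right integrable_divide nD tD \<tau> \<rho> \<Delta>)
  have F_exp: "expectation F = tr / R + s * (3 / \<alpha>) * ((\<epsilon> * tr + tail J / \<epsilon>) / 2 + R / \<alpha> * (expectation (\<Delta> J n) + (\<epsilon> * tr + tail J / \<epsilon>) / 2))"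
    unfolding F_def[abs_def] using nD tD \<tau> \<rho> \<Delta> by simp
  have exp_le: "\<bar>exp (- x) - exp (- y)\<bar> \<le> \<bar>x - y\<bar>" "\<bar>exp (- x) - exp (- y)\<bar> \<le> 1" if "0 \<le> x" "0 \<le> y" for x y :: real
  proof -
    have *: "exp (- x) - exp (- y) \<le> y - x" if "0 \<le> x" "x \<le> y" for x y :: real
    proof -
      have "exp (- x) - exp (- y) = exp (- x) * (1 - exp (- (y - x)))"
        by (simp add: right_diff_distrib exp_add[symmetric])
      also have "\<dots> \<le> 1 * (y - x)"
      proof (intro mult_mono)
        show "1 - exp (- (y - x)) \<le> y - x" using exp_ge_add_one_self[of "- (y - x)"] by linarith
      qed (use that in auto)
      finally show ?thesis by simp
    qed
    show "\<bar>exp (- x) - exp (- y)\<bar> \<le> \<bar>x - y\<bar>"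
      using *[of x y] *[of y x] that by (cases "x \<le> y") (auto simp: abs_if)
    have "exp (- x) \<le> 1" "exp (- y) \<le> 1" "0 < exp (- x)" "0 < exp (- y)" using that by auto
    then show "\<bar>exp (- x) - exp (- y)\<bar> \<le> 1" by linarith
  qed
  have F_le: "\<bar>exp (- s * Q n \<omega>) - exp (- s * S J n \<omega>)\<bar> \<le> F \<omega>" if \<omega>: "\<omega> \<in> space M" for \<omega>
  proof -
    have Dsq: "square_int U (scaled n \<omega>)" by (rule process.W_path[OF process_scaled[OF n] \<omega>])
    have zb: "(\<Sum>j<J. (\<xi> i j \<omega>)\<^sup>2) \<le> ip U (Z i \<omega>) (Z i \<omega>)" for i
      by (rule ip_bessel[OF Z_path[OF \<omega>] \<phi>_square_int \<phi>_orthonormal])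
    have nn: "0 \<le> nD \<omega>" "0 \<le> tD \<omega>" "0 \<le> \<tau> \<omega>" "0 \<le> \<rho> \<omega>"
      using ip_bessel[OF Dsq \<phi>_square_int \<phi>_orthonormal, of J] zb
      unfolding nD_def tD_def \<tau>_def \<rho>_def
      by (auto simp: ip_self_nonneg intro!: sum_nonneg divide_nonneg_nonneg)
    define X where "X = \<Delta> J n \<omega> + (\<epsilon> * \<tau> \<omega> + \<rho> \<omega> / \<epsilon>) / 2"
    have X: "0 \<le> X" unfolding X_def using nn \<epsilon> \<Delta>_nonneg[of J n \<omega>] by simp
    define Y where "Y = (\<epsilon> * nD \<omega> + tD \<omega> / \<epsilon>) / 2"
    have Y: "0 \<le> Y" unfolding Y_def using nn \<epsilon> by simp
    have QS: "\<bar>Q n \<omega> - S J n \<omega>\<bar> \<le> 3 / \<alpha> * (Y + nD \<omega> / \<alpha> * X)"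
    proof -
      have sc: "scaled n \<omega> = (\<lambda>t. (\<Sum>i<n. Z i \<omega> t) / sqrt (real n))" by (simp add: scaled_def[abs_def])
      show ?thesis
        unfolding Q_def S_def Y_def X_def nD_def tD_def \<tau>_def \<rho>_def \<Delta>_def sc
        by (rule pathwise_comparison[OF Z_continuous[OF \<omega>] m_continuous Xs[OF \<omega>] \<phi>_square_int \<phi>_orthonormal lam_nonneg \<alpha>_pos n \<epsilon>])
    qed
    have F: "F \<omega> = nD \<omega> / R + s * (3 / \<alpha> * (Y + R / \<alpha> * X))" by (simp add: F_def X_def Y_def mult.assoc)
    have sQ: "0 \<le> s * Q n \<omega>" "0 \<le> s * S J n \<omega>" using s Q_nonneg S_nonneg by simp_all
    show ?thesis
    proof (cases "nD \<omega> \<le> R")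
      case True
      have "\<bar>exp (- s * Q n \<omega>) - exp (- s * S J n \<omega>)\<bar> \<le> s * \<bar>Q n \<omega> - S J n \<omega>\<bar>"
        using exp_le(1)[OF sQ] s by (simp add: right_diff_distrib[symmetric] abs_mult)
      also have "\<dots> \<le> s * (3 / \<alpha> * (Y + nD \<omega> / \<alpha> * X))" using QS s by (intro mult_left_mono)
      also have "\<dots> \<le> s * (3 / \<alpha> * (Y + R / \<alpha> * X))"
        using True X s \<alpha>_pos by (intro mult_left_mono add_left_mono mult_right_mono divide_right_mono) auto
      also have "\<dots> \<le> F \<omega>" unfolding F using nn R by simp
      finally show ?thesis .
    next
      case False
      have "\<bar>exp (- s * Q n \<omega>) - exp (- s * S J n \<omega>)\<bar> \<le> 1" using exp_le(2)[OF sQ] by simp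
      also have "1 \<le> nD \<omega> / R" using False R by simp
      also have "\<dots> \<le> F \<omega>" unfolding F using X Y s \<alpha>_pos R by simp
      finally show ?thesis .
    qed
  qed
  have intQ: "integrable M (\<lambda>\<omega>. exp (- s * Q n \<omega>))"
    using s Q_nonneg by (intro integrable_const_bound[of _ 1] AE_I2) auto
  have intS: "integrable M (\<lambda>\<omega>. exp (- s * S J n \<omega>))"
    using s S_nonneg by (intro integrable_const_bound[of _ 1] AE_I2) auto
  have "\<bar>expectation (\<lambda>\<omega>. exp (- s * Q n \<omega>)) - expectation (\<lambda>\<omega>. exp (- s * S J n \<omega>))\<bar>
    = \<bar>expectation (\<lambda>\<omega>. exp (- s * Q n \<omega>) - exp (- s * S J n \<omega>))\<bar>" using intQ intS by simp
  also have "\<dots> \<le> expectation (\<lambda>\<omega>. \<bar>exp (- s * Q n \<omega>) - exp (- s * S J n \<omega>)\<bar>)" by (rule integral_abs_bound)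
  also have "\<dots> \<le> expectation F"
    using intQ intS by (intro integral_mono F_int F_le) auto
  finally show ?thesis unfolding F_exp .
qed

text \<open>The quadratic form carries the weight lam j / (lam j + \<alpha>)^2, and the limiting
  variance \<open>lam j\<close> of the coordinate supplies the second factor of the
  numerator.\<close>

lemma S_laplace_limit:
  assumes s: "0 \<le> s"
  shows "(\<lambda>n. expectation (\<lambda>\<omega>. exp (- s * S J n \<omega>))) \<longlonglongrightarrow> (\<Prod>j<J. 1 / sqrt (1 + 2 * (s * ((lam j)\<^sup>2 / (lam j + \<alpha>)\<^sup>2))))"
proof -
  have "(\<lambda>n. expectation (\<lambda>\<omega>. exp (- (\<Sum>j<J. s * (lam j / (lam j + \<alpha>)\<^sup>2) * (\<eta> n j \<omega>)\<^sup>2))))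
    \<longlonglongrightarrow> (\<Prod>j<J. 1 / sqrt (1 + 2 * (s * (lam j / (lam j + \<alpha>)\<^sup>2) * lam j)))"
    using s lam_nonneg
    by (intro gaussian_linearisation \<eta>_measurable clt_linear_combination mult_nonneg_nonneg divide_nonneg_nonneg) auto
  note conv = this
  have 1: "s * (lam j / (lam j + \<alpha>)\<^sup>2) * lam j = s * ((lam j)\<^sup>2 / (lam j + \<alpha>)\<^sup>2)" for j
    by (simp add: power2_eq_square)
  have 2: "(\<Sum>j<J. s * (lam j / (lam j + \<alpha>)\<^sup>2) * (\<eta> n j \<omega>)\<^sup>2) = s * S J n \<omega>" for n \<omega>
    by (simp add: S_def sum_distrib_left mult.assoc)
  show ?thesis unfolding mult_minus_left using conv unfolding 1 2 .
qed

text \<open>R makes the Markov term small, \<epsilon> is chosen given R, J given \<epsilon>, and n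
  last. Four error terms of size e / 8 compare Q with its truncation; e / 4 is left for the limit in
  n of the truncation and e / 4 for the limit in J.\<close>

lemma Q_laplace_limit:
  assumes s: "0 \<le> s"
    and L: "(\<lambda>J. \<Prod>j<J. 1 / sqrt (1 + 2 * (s * ((lam j)\<^sup>2 / (lam j + \<alpha>)\<^sup>2)))) \<longlonglongrightarrow> L"
  shows "(\<lambda>n. expectation (\<lambda>\<omega>. exp (- s * Q n \<omega>))) \<longlonglongrightarrow> L"
proof (rule LIMSEQ_I)
  fix e :: real assume e: "0 < e"
  define P where "P J = (\<Prod>j<J. 1 / sqrt (1 + 2 * (s * ((lam j)\<^sup>2 / (lam j + \<alpha>)\<^sup>2))))" for J
  define a where "a n = expectation (\<lambda>\<omega>. exp (- s * Q n \<omega>))" for n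
  define b where "b J n = expectation (\<lambda>\<omega>. exp (- s * S J n \<omega>))" for J n
  define R where "R = 8 * (tr + 1) / e"
  define A where "A = s * (3 / \<alpha>)"
  \<comment> \<open>The common coefficient of \<open>\<epsilon> * tr\<close> and
    \<open>tail J / \<epsilon>\<close> after expanding the bound.\<close>
  define B where "B = A * (1 + R / \<alpha>) / 2"
  \<comment> \<open>Adding 1 keeps T positive even when the trace or B is 0.\<close>
  define T where "T = B * tr + 1"
  define \<epsilon> where "\<epsilon> = e / (8 * T)"
  have R: "0 < R" using tr_nonneg e by (simp add: R_def)
  have A: "0 \<le> A" using s \<alpha>_pos by (simp add: A_def)
  have B: "0 \<le> B" using A R \<alpha>_pos by (simp add: B_def)
  have T: "0 < T" using B tr_nonneg by (simp add: T_def add_nonneg_pos)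
  have \<epsilon>: "0 < \<epsilon>" using e T by (simp add: \<epsilon>_def)
  have expand: "x * ((u + t) / 2 + r * (\<delta> + (u + t) / 2)) = x * (1 + r) / 2 * u + x * (1 + r) / 2 * t + x * r * \<delta>"
    for x u t r \<delta> :: real by (simp add: field_simps)
  have 1: "tr / R \<le> e / 8"
  proof -
    have "e / 8 * R = tr + 1" using e by (simp add: R_def)
    then show ?thesis using R by (simp add: pos_divide_le_eq)
  qed
  have 2: "B * (\<epsilon> * tr) \<le> e / 8"
  proof -
    have "\<epsilon> * T = e / 8" using T by (simp add: \<epsilon>_def)
    then show ?thesis using \<epsilon> by (simp add: T_def distrib_left mult.left_commute)
  qed
  have "(\<lambda>J. B * (tail J / \<epsilon>)) \<longlonglongrightarrow> B * (0 / \<epsilon>)"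
    using \<epsilon> by (intro tendsto_intros tail_tendsto) auto
  then have "\<forall>\<^sub>F J in sequentially. B * (tail J / \<epsilon>) < e / 8"
    using e by (intro order_tendstoD(2)[of _ 0]) auto
  moreover have "\<forall>\<^sub>F J in sequentially. dist (P J) L < e / 4"
    using L e unfolding P_def by (intro tendstoD) auto
  ultimately have "\<forall>\<^sub>F J in sequentially. B * (tail J / \<epsilon>) < e / 8 \<and> dist (P J) L < e / 4"
    by (rule eventually_conj)
  then obtain J where J: "B * (tail J / \<epsilon>) < e / 8" "\<bar>P J - L\<bar> < e / 4"
    by (auto simp: eventually_sequentially dist_real_def)
  have "(\<lambda>n. A * (R / \<alpha>) * expectation (\<Delta> J n)) \<longlonglongrightarrow> A * (R / \<alpha>) * 0"
    by (intro tendsto_intros \<Delta>_limit)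
  then have "\<forall>\<^sub>F n in sequentially. A * (R / \<alpha>) * expectation (\<Delta> J n) < e / 8"
    using e by (intro order_tendstoD(2)[of _ 0]) auto
  moreover have "\<forall>\<^sub>F n in sequentially. dist (b J n) (P J) < e / 4"
    using S_laplace_limit[OF s, of J] e unfolding b_def P_def by (intro tendstoD) auto
  moreover have "\<forall>\<^sub>F n in sequentially. 0 < n" by (rule eventually_gt_at_top)
  ultimately have "\<forall>\<^sub>F n in sequentially. norm (a n - L) < e"
  proof eventually_elim
    case (elim n)
    have "\<bar>a n - b J n\<bar> \<le> tr / R + A * ((\<epsilon> * tr + tail J / \<epsilon>) / 2 + R / \<alpha> * (expectation (\<Delta> J n) + (\<epsilon> * tr + tail J / \<epsilon>) / 2))"
      unfolding a_def b_def A_def using elim \<epsilon> R s by (intro laplace_comparison)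
    also have "\<dots> = tr / R + B * (\<epsilon> * tr) + B * (tail J / \<epsilon>) + A * (R / \<alpha>) * expectation (\<Delta> J n)"
      by (simp only: expand B_def add.assoc)
    also have "\<dots> < e / 2" using 1 2 J elim by linarith
    finally have "\<bar>a n - b J n\<bar> < e / 2" .
    moreover have "\<bar>b J n - P J\<bar> < e / 4" using elim by (simp add: dist_real_def)
    ultimately show ?case using J(2) unfolding real_norm_def by linarith
  qed
  then show "\<exists>n0. \<forall>n\<ge>n0. norm (expectation (\<lambda>\<omega>. exp (- s * Q n \<omega>)) - L) < e"
    unfolding a_def by (simp add: eventually_sequentially)
qed

text \<open>One factor lam j / (lam j + \<alpha>) is at most lam j / \<alpha> and the other at most
  1, so the finite trace dominates.\<close>

lemma weights_summable: "summable (\<lambda>j. (lam j)\<^sup>2 / (lam j + \<alpha>)\<^sup>2)"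
proof (rule summable_comparison_test')
  show "summable (\<lambda>j. lam j / \<alpha>)" using lam_sums by (intro summable_divide) (rule sums_summable)
  show "norm ((lam j)\<^sup>2 / (lam j + \<alpha>)\<^sup>2) \<le> lam j / \<alpha>" if "0 \<le> j" for j
  proof -
    have "(lam j / (lam j + \<alpha>)) * (lam j / (lam j + \<alpha>)) \<le> (lam j / \<alpha>) * 1"
      using lam_nonneg[of j] \<alpha>_pos by (intro mult_mono divide_left_mono) auto
    then show ?thesis by (simp add: power2_eq_square)
  qed
qed

lemma M_hat_weak_conv:
  fixes N :: "'b measure" and Y :: "nat \<Rightarrow> 'b \<Rightarrow> real"
  assumes N: "prob_space N" and indep: "prob_space.indep_vars N (\<lambda>_. borel) Y UNIV"
    and Y: "\<And>j. distributed N lborel (Y j) (\<lambda>x. ennreal (chi2_1_density x))"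
  shows "weak_conv_m
    (\<lambda>n. distr M borel (\<lambda>\<omega>. sqrt (real n) * M_hat \<alpha> n (\<lambda>i. Xs i \<omega>) (xbar n (\<lambda>i. Xs i \<omega>)) m))
    (distr N borel (\<lambda>\<omega>. sqrt (\<Sum>j. (lam j)\<^sup>2 / (lam j + \<alpha>)\<^sup>2 * Y j \<omega>)))"
proof -
  interpret N: prob_space N by fact
  have [measurable]: "Y j \<in> borel_measurable N" for j using distributed_measurable[OF Y] by simp
  note series = N.chi2_series_laplace[OF indep Y _ weights_summable]
  have "weak_conv_m (\<lambda>n. distr M borel (\<lambda>\<omega>. sqrt (Q n \<omega>)))
    (distr N borel (\<lambda>\<omega>. sqrt (\<Sum>j. (lam j)\<^sup>2 / (lam j + \<alpha>)\<^sup>2 * Y j \<omega>)))"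
  proof (rule laplace_imp_weak_conv_sqrt)
    show "AE \<omega> in N. 0 \<le> (\<Sum>j. (lam j)\<^sup>2 / (lam j + \<alpha>)\<^sup>2 * Y j \<omega>)" by (rule series(1)) simp
    fix k :: nat
    show "(\<lambda>n. expectation (\<lambda>\<omega>. exp (- real k * Q n \<omega>)))
        \<longlonglongrightarrow> N.expectation (\<lambda>\<omega>. exp (- real k * (\<Sum>j. (lam j)\<^sup>2 / (lam j + \<alpha>)\<^sup>2 * Y j \<omega>)))"
      by (intro Q_laplace_limit series(2)) auto
  qed (auto simp: Q_nonneg N prob_space_axioms)
  moreover have "distr M borel (\<lambda>\<omega>. sqrt (Q n \<omega>))
      = distr M borel (\<lambda>\<omega>. sqrt (real n) * M_hat \<alpha> n (\<lambda>i. Xs i \<omega>) (xbar n (\<lambda>i. Xs i \<omega>)) m)" for n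
    by (rule distr_cong) (auto simp: sqrt_Q)
  ultimately show ?thesis by simp
qed

end

end

section \<open>Reduction to the centred sample\<close>

theorem theorem3:
  fixes M :: "'a measure"
    and X :: "'a \<Rightarrow> real \<Rightarrow> real"
    and Xs :: "nat \<Rightarrow> 'a \<Rightarrow> real \<Rightarrow> real"
    and m :: "real \<Rightarrow> real"
    and K :: "real \<Rightarrow> real \<Rightarrow> real"
    and lam :: "nat \<Rightarrow> real"
    and \<alpha> :: real
  assumes prob: "prob_space M"
    and meas: "\<forall>t\<in>{0..1}. (\<lambda>\<omega>. X \<omega> t) \<in> borel_measurable M"
    and second_order: "\<forall>t\<in>{0..1}. integrable M (\<lambda>\<omega>. (X \<omega> t)\<^sup>2)"
    and cont_paths: "\<forall>\<omega>\<in>space M. continuous_on {0..1} (X \<omega>)"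
    and m_def: "\<forall>t\<in>{0..1}. m t = (\<integral>\<omega>. X \<omega> t \<partial>M)"
    and K_def: "\<forall>s\<in>{0..1}. \<forall>t\<in>{0..1}. K s t = (\<integral>\<omega>. (X \<omega> s - m s) * (X \<omega> t - m t) \<partial>M)"
    and m_cont: "continuous_on {0..1} m"
    and K_cont: "continuous_on ({0..1} \<times> {0..1}) (\<lambda>(s, t). K s t)"
    and K_pd: "\<forall>k (t :: nat \<Rightarrow> real) (a :: nat \<Rightarrow> real).
                 inj_on t {..<k} \<and> t ` {..<k} \<subseteq> {0..1} \<and> (\<exists>i<k. a i \<noteq> 0) \<longrightarrow>
                 (\<Sum>i<k. \<Sum>j<k. a i * a j * K (t i) (t j)) > 0"
    and norm_sq: "integrable M (\<lambda>\<omega>. LBINT t=0..1. (X \<omega> t)\<^sup>2)"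
    and eig: "cov_eigenvalues K lam"
    and sample_paths: "\<forall>i. \<forall>\<omega>\<in>space M. continuous_on {0..1} (Xs i \<omega>)"
    and sample_indep: "prob_space.indep_vars M (\<lambda>_. PiM {0..1} (\<lambda>_. borel))
                         (\<lambda>i \<omega>. restrict (Xs i \<omega>) {0..1}) UNIV"
    and sample_law: "\<forall>i. distr M (PiM {0..1} (\<lambda>_. borel)) (\<lambda>\<omega>. restrict (Xs i \<omega>) {0..1})
                        = distr M (PiM {0..1} (\<lambda>_. borel)) (\<lambda>\<omega>. restrict (X \<omega>) {0..1})"
    and alpha_pos: "\<alpha> > 0"
  shows "\<forall>(N :: 'b measure) (Y :: nat \<Rightarrow> 'b \<Rightarrow> real).
           prob_space N \<and> prob_space.indep_vars N (\<lambda>_. borel) Y UNIV \<and>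
           (\<forall>j. distributed N lborel (Y j) (\<lambda>x. ennreal (chi2_1_density x))) \<longrightarrow>
           weak_conv_m
             (\<lambda>n. distr M borel (\<lambda>\<omega>. sqrt (real n) * M_hat \<alpha> n (\<lambda>i. Xs i \<omega>) (xbar n (\<lambda>i. Xs i \<omega>)) m))
             (distr N borel (\<lambda>\<omega>. sqrt (\<Sum>j. (lam j)\<^sup>2 / (lam j + \<alpha>)\<^sup>2 * Y j \<omega>)))"
proof -
  interpret prob_space M by (rule prob)
  define Z where "Z i \<omega> t = Xs i \<omega> t - m t" for i \<omega> t
  define path where "path Y \<omega> = restrict (Y \<omega>) {0..1}" for Y :: "'a \<Rightarrow> real \<Rightarrow> real" and \<omega>
  have X_path [measurable]: "path X \<in> measurable M paths"
    unfolding path_def[abs_def] using meas by (intro measurable_restrict) auto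
  have Xs_path [measurable]: "path (Xs i) \<in> measurable M paths" for i
    using sample_indep unfolding path_def[abs_def] by (simp add: indep_vars_def)
  have Xs_law: "distr M paths (path (Xs i)) = distr M paths (path X)" for i
    unfolding path_def[abs_def] using sample_law by blast
  \<comment> \<open>Moments are given for X and needed for the \<open>Xs i\<close>; they are carried
    over as integrals of functionals under the common law on path space.\<close>
  have transfer: "integrable M (\<lambda>\<omega>. G (path (Xs i) \<omega>)) \<longleftrightarrow> integrable M (\<lambda>\<omega>. G (path X \<omega>))"
    "expectation (\<lambda>\<omega>. G (path (Xs i) \<omega>)) = expectation (\<lambda>\<omega>. G (path X \<omega>))"
    if "G \<in> borel_measurable paths" for G :: "(real \<Rightarrow> real) \<Rightarrow> real" and i
    using integrable_distr_eq[OF Xs_path[of i] that] integrable_distr_eq[OF X_path that]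
      integral_distr[OF Xs_path[of i] that] integral_distr[OF X_path that] Xs_law[of i] by simp_all
  have eval: "(\<lambda>x. x t) \<in> borel_measurable paths" if "t \<in> {0..1}" for t :: real
    using that by (rule measurable_component_singleton)
  have X_sq: "square_int M (\<lambda>\<omega>. X \<omega> t - m t)" if "t \<in> {0..1}" for t
    using that meas second_order by (intro square_int_diff square_intI) auto
  obtain \<phi> where \<phi>: "\<And>j. sq_int (\<phi> j)" "\<And>i j. (LBINT t=0..1. \<phi> i t * \<phi> j t) = (if i = j then 1 else 0)"
    "\<And>j. AE s in lborel. s \<in> {0..1} \<longrightarrow> int_op K (\<phi> j) s = lam j * \<phi> j s"
    "\<And>f. sq_int f \<Longrightarrow> (\<And>j. (LBINT t=0..1. \<phi> j t * f t) = 0) \<Longrightarrow> AE s in lborel. s \<in> {0..1} \<longrightarrow> int_op K f s = 0"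
    using eig unfolding cov_eigenvalues_def by blast
  \<comment> \<open>Centring as a measurable map of path space, so that independence and the common
    law pass to the centred paths by composition.\<close>
  define sh where "sh x = (\<lambda>t\<in>{0..1}. x t - m t)" for x :: "real \<Rightarrow> real"
  have sh [measurable]: "sh \<in> measurable paths paths"
    unfolding sh_def[abs_def] using eval by (intro measurable_restrict borel_measurable_diff) auto
  have Z_sh: "(\<lambda>\<omega>. restrict (Z i \<omega>) {0..1}) = (\<lambda>\<omega>. sh (path (Xs i) \<omega>))" for i
    by (auto simp: Z_def sh_def path_def restrict_def fun_eq_iff)
  have Z_at: "Z i \<omega> t = path (Xs i) \<omega> t - m t" "X \<omega> t - m t = path X \<omega> t - m t" if "t \<in> {0..1}" for i \<omega> t
    using that by (simp_all add: Z_def path_def)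
  have diff_meas: "(\<lambda>x. x t - m t) \<in> borel_measurable paths" if "t \<in> {0..1}" for t
    using eval[OF that] by measurable
  interpret spectral_sample M Z K \<phi> lam
  proof
    show "continuous_on {0..1} (Z i \<omega>)" if "\<omega> \<in> space M" for i \<omega>
      unfolding Z_def using sample_paths m_cont that by (intro continuous_on_diff) auto
    show "square_int M (\<lambda>\<omega>. Z i \<omega> t)" if t: "t \<in> {0..1}" for i t
    proof (rule square_intI)
      have "(\<lambda>\<omega>. (\<lambda>x. x t - m t) (path (Xs i) \<omega>)) \<in> borel_measurable M"
        by (rule measurable_compose[OF Xs_path diff_meas[OF t]])
      then show "(\<lambda>\<omega>. Z i \<omega> t) \<in> borel_measurable M" using Z_at[OF t] by simp
      have "integrable M (\<lambda>\<omega>. (path X \<omega> t - m t)\<^sup>2)"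
        using square_int_integrable[OF X_sq[OF t]] Z_at(2)[OF t] by simp
      then have "integrable M (\<lambda>\<omega>. (path (Xs i) \<omega> t - m t)\<^sup>2)"
        using transfer(1)[of "\<lambda>x. (x t - m t)\<^sup>2" i] diff_meas[OF t] by simp
      then show "integrable M (\<lambda>\<omega>. (Z i \<omega> t)\<^sup>2)" using Z_at(1)[OF t] by simp
    qed
    show "expectation (\<lambda>\<omega>. Z i \<omega> t) = 0" if t: "t \<in> {0..1}" for i t
    proof -
      have "square_int M (\<lambda>\<omega>. X \<omega> t)" using t meas second_order by (intro square_intI) auto
      then have int: "integrable M (\<lambda>\<omega>. X \<omega> t)" by (rule square_int_imp_integrable)
      have "expectation (\<lambda>\<omega>. Z i \<omega> t) = expectation (\<lambda>\<omega>. X \<omega> t - m t)"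
        using transfer(2)[OF diff_meas[OF t], of i] Z_at[OF t] by simp
      also have "\<dots> = 0" using int m_def t by (simp add: prob_space)
      finally show ?thesis .
    qed
    show "expectation (\<lambda>\<omega>. Z i \<omega> s * Z i \<omega> t) = K s t" if st: "s \<in> {0..1}" "t \<in> {0..1}" for i s t
      using transfer(2)[of "\<lambda>x. (x s - m s) * (x t - m t)" i] diff_meas[OF st(1)] diff_meas[OF st(2)]
        K_def st Z_at[OF st(1)] Z_at[OF st(2)] by simp
    show "continuous_on ({0..1} \<times> {0..1}) (\<lambda>(s, t). K s t)" by (rule K_cont)
    show "indep_vars (\<lambda>_. paths) (\<lambda>i \<omega>. restrict (Z i \<omega>) {0..1}) UNIV"
      using indep_vars_compose2[OF sample_indep, of "\<lambda>_. sh" "\<lambda>_. paths"] sh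
      unfolding Z_sh path_def by simp
    show "distr M paths (\<lambda>\<omega>. restrict (Z i \<omega>) {0..1}) = distr M paths (\<lambda>\<omega>. restrict (Z 0 \<omega>) {0..1})" for i
    proof -
      have "distr M paths (\<lambda>\<omega>. sh (path (Xs k) \<omega>)) = distr (distr M paths (path X)) paths sh" for k
        unfolding Xs_law[of k, symmetric] by (subst distr_distr[OF sh Xs_path]) (simp add: comp_def)
      then show ?thesis unfolding Z_sh by simp
    qed
    show "sq_int (\<phi> j)" for j by (rule \<phi>(1))
    show "ip U (\<phi> i) (\<phi> j) = (if i = j then 1 else 0)" for i j
      using \<phi>(2)[of i j] by (simp add: LBINT_eq_U ip_def)
    show "AE s in U. int_op K (\<phi> j) s = lam j * \<phi> j s" for j
      using \<phi>(3)[of j] by (simp add: AE_U_iff)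
    show "AE s in U. int_op K f s = 0" if "sq_int f" "\<And>j. ip U (\<phi> j) f = 0" for f
      using \<phi>(4)[OF that(1)] that(2) by (simp add: AE_U_iff LBINT_eq_U ip_def)
  qed
  show ?thesis
  proof (intro allI impI, elim conjE)
    fix N :: "'b measure" and Y :: "nat \<Rightarrow> 'b \<Rightarrow> real"
    assume "prob_space N" "prob_space.indep_vars N (\<lambda>_. borel) Y UNIV"
      "\<forall>j. distributed N lborel (Y j) (\<lambda>x. ennreal (chi2_1_density x))"
    then show "weak_conv_m
        (\<lambda>n. distr M borel (\<lambda>\<omega>. sqrt (real n) * M_hat \<alpha> n (\<lambda>i. Xs i \<omega>) (xbar n (\<lambda>i. Xs i \<omega>)) m))
        (distr N borel (\<lambda>\<omega>. sqrt (\<Sum>j. (lam j)\<^sup>2 / (lam j + \<alpha>)\<^sup>2 * Y j \<omega>)))"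
      by (intro M_hat_weak_conv m_cont alpha_pos) (auto simp: Z_def)
  qed
qed

end
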